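(* Let $\kappa=(\kappa_1\ge\dots\ge\kappa_n\ge0)$ be a partition and $\delta=(n-1,n-2,\dots,1,0)$. Then $$S_{\kappa+\delta}(z;q,t)=\Delta_t(z)\,P_\kappa(z;q,qt),\qquad \Delta_t(z):=\prod_{1\le i<j\le n}(z_i-t^{-1}z_j),$$ where $S_{\kappa+\delta}(z;q,t)$ is the $t$-antisymmetric Macdonald polynomial with parameters $q,t$ and $P_\kappa(z;q,qt)$ is the symmetric Macdonald polynomial with parameters $q$ and $qt$ (that is, $P_\kappa(z;q,t)$ with $t$ replaced by $qt$).
   Context: Let $n\ge1$, let $q,t$ be indeterminates and $z=(z_1,\dots,z_n)$. The operator $s_i$ ($1\le i\le n-1$) exchanges $z_i,z_{i+1}$ in functions. Put $$T_i:=t+\frac{tz_i-z_{i+1}}{z_i-z_{i+1}}(s_i-1),\qquad (\omega_0 f)(z_1,\dots,z_n):=f(qz_n,z_1,\dots,z_{n-1}),$$ $$Y_i:=t^{-n+i}\,T_i\cdots T_{n-1}\,\omega_0\,T_1^{-1}\cdots T_{i-1}^{-1}\qquad(1\le i\le n).$$ A composition is $\eta=(\eta_1,\dots,\eta_n)\in\mathbb Z_{\ge0}^n$; $|\eta|=\sum\eta_i$; $\eta^+$ is the partition obtained by permuting the entries of $\eta$; $l'_\eta(i):=\#\{j<i:\eta_j\ge\eta_i\}+\#\{j>i:\eta_j>\eta_i\}$ and $\overline\eta_i:=q^{\eta_i}t^{-l'_\eta(i)}$. For compositions of equal modulus, $\mu<\eta$ iff $\mu\ne\eta$ and $\sum_{i=1}^p(\eta_i-\mu_i)\ge0$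 for all $1\le p\le n$; and $\mu\prec\eta$ iff $\mu^+<\eta^+$, or $\mu^+=\eta^+$ and $\mu<\eta$. The nonsymmetric Macdonald polynomial $E_\eta=E_\eta(z;q,t)$ is the unique polynomial with coefficients in $\mathbb Q(q,t)$ of the form $E_\eta=z^\eta+\sum_{\nu\prec\eta}b_{\eta\nu}z^\nu$ with $Y_iE_\eta=\overline\eta_iE_\eta$ for all $i$. For a reduced word $\sigma=s_{i_l}\cdots s_{i_1}\in S_n$ put $T_\sigma:=T_{i_l}\cdots T_{i_1}$, with $l(\sigma)$ the length, and $$U^+:=\sum_{\sigma\in S_n}T_\sigma,\qquad U^-:=\sum_{\sigma\in S_n}\left(-\tfrac1t\right)^{l(\sigma)}T_\sigma .$$ For a partition $\kappa$, the symmetric Macdonald polynomial $P_\kappa(z;q,t)$ is the scalar multiple of $U^+E_\eta$ (for any $\eta$ that is a permutation of $\kappa$) in which $z^\kappa$ has coefficient $1$. It is the unique symmetric eigenfunction of $D^1_n(q,t):=t^{n-1}\sum_{i=1}^nY_i$ with leading term the monomial symmetric polynomial $m_\kappa$. The antisymmetric Macdonald polynomial $S_{\kappa+\delta}(z;q,t)$ is the scalar multiple of $U^-E_\mu$ (for any $\mu$ that is a permutation of $\kappa+\delta$) in which $z^{\kappa+\delta}$ has coefficient $1$. *)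

theory Defs
  imports
    "HOL-Library.Poly_Mapping"
    "HOL-Computational_Algebra.Computational_Algebra"
    "HOL-Combinatorics.Permutations"
begin

text \<open>
  A composition of length \<open>n\<close> is an exponent vector supported on \<open>{1..n}\<close>; the same type
  \<open>nat \<Rightarrow>\<^sub>0 nat\<close> indexes the monomials of the polynomial type below, whose variables are
  \<open>z\<^sub>0, z\<^sub>1, z\<^sub>2, \<dots>\<close>. Only \<open>z\<^sub>1, \<dots>, z\<^sub>n\<close> matter for a given \<open>n\<close>.
\<close>

type_synonym expo = "nat \<Rightarrow>\<^sub>0 nat"

definition composition :: "nat \<Rightarrow> expo \<Rightarrow> bool" where
  "composition n \<eta> \<longleftrightarrow> Poly_Mapping.keys \<eta> \<subseteq> {1..n}"

definition is_partition :: "nat \<Rightarrow> expo \<Rightarrow> bool" where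
  "is_partition n \<kappa> \<longleftrightarrow> composition n \<kappa> \<and>
     (\<forall>i j. 1 \<le> i \<and> i \<le> j \<and> j \<le> n \<longrightarrow> Poly_Mapping.lookup \<kappa> j \<le> Poly_Mapping.lookup \<kappa> i)"

definition modulus :: "nat \<Rightarrow> expo \<Rightarrow> nat" where
  "modulus n \<eta> = (\<Sum>i=1..n. Poly_Mapping.lookup \<eta> i)"

definition is_permutation_of :: "nat \<Rightarrow> expo \<Rightarrow> expo \<Rightarrow> bool" where
  "is_permutation_of n \<mu> \<eta> \<longleftrightarrow>
     (\<exists>\<pi>. \<pi> permutes {1..n} \<and> (\<forall>i\<in>{1..n}. Poly_Mapping.lookup \<mu> i = Poly_Mapping.lookup \<eta> (\<pi> i)))"

definition plus_part :: "nat \<Rightarrow> expo \<Rightarrow> expo" where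
  "plus_part n \<eta> = (THE \<kappa>. is_partition n \<kappa> \<and> is_permutation_of n \<kappa> \<eta>)"

definition delta :: "nat \<Rightarrow> expo" where
  "delta n = (\<Sum>i=1..n. Poly_Mapping.single i (n - i))"

definition dominance_less :: "nat \<Rightarrow> expo \<Rightarrow> expo \<Rightarrow> bool" where
  "dominance_less n \<mu> \<eta> \<longleftrightarrow> modulus n \<mu> = modulus n \<eta> \<and> \<mu> \<noteq> \<eta> \<and>
     (\<forall>p\<in>{1..n}. (\<Sum>i=1..p. int (Poly_Mapping.lookup \<eta> i) - int (Poly_Mapping.lookup \<mu> i)) \<ge> 0)"

definition prec :: "nat \<Rightarrow> expo \<Rightarrow> expo \<Rightarrow> bool" where
  "prec n \<mu> \<eta> \<longleftrightarrow> dominance_less n (plus_part n \<mu>) (plus_part n \<eta>) \<or>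
     (plus_part n \<mu> = plus_part n \<eta> \<and> dominance_less n \<mu> \<eta>)"

definition leg_colength :: "nat \<Rightarrow> expo \<Rightarrow> nat \<Rightarrow> nat" where
  "leg_colength n \<eta> i =
     card {j\<in>{1..n}. j < i \<and> Poly_Mapping.lookup \<eta> j \<ge> Poly_Mapping.lookup \<eta> i} +
     card {j\<in>{1..n}. j > i \<and> Poly_Mapping.lookup \<eta> j > Poly_Mapping.lookup \<eta> i}"

definition eigval :: "'a::field \<Rightarrow> 'a \<Rightarrow> nat \<Rightarrow> expo \<Rightarrow> nat \<Rightarrow> 'a" where
  "eigval q t n \<eta> i = q ^ Poly_Mapping.lookup \<eta> i * inverse t ^ leg_colength n \<eta> i"

type_synonym 'a mpol = "expo \<Rightarrow>\<^sub>0 'a"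

definition const :: "'a::field \<Rightarrow> 'a mpol" where
  "const c = Poly_Mapping.single 0 c"

definition var :: "nat \<Rightarrow> 'a::field mpol" where
  "var i = Poly_Mapping.single (Poly_Mapping.single i 1) 1"

text \<open>\<open>psubst g f\<close> is \<open>f(g\<^sub>1, g\<^sub>2, \<dots>)\<close>.\<close>

definition psubst :: "(nat \<Rightarrow> 'a::field mpol) \<Rightarrow> 'a mpol \<Rightarrow> 'a mpol" where
  "psubst g f = (\<Sum>\<alpha>\<in>Poly_Mapping.keys f. const (Poly_Mapping.lookup f \<alpha>) *
     (\<Prod>i\<in>Poly_Mapping.keys \<alpha>. g i ^ Poly_Mapping.lookup \<alpha> i))"

definition swap_op :: "nat \<Rightarrow> 'a::field mpol \<Rightarrow> 'a mpol" where
  "swap_op i f = psubst (\<lambda>j. var (transpose i (Suc i) j)) f"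

text \<open>The exact quotient \<open>(s\<^sub>i f - f) / (z\<^sub>i - z\<^bsub>i+1\<^esub>)\<close>, which is again a polynomial.\<close>

definition div_diff :: "nat \<Rightarrow> 'a::field mpol \<Rightarrow> 'a mpol" where
  "div_diff i f = (THE g. (var i - var (Suc i)) * g = swap_op i f - f)"

definition T_op :: "'a::field \<Rightarrow> nat \<Rightarrow> 'a mpol \<Rightarrow> 'a mpol" where
  "T_op t i f = const t * f + (const t * var i - var (Suc i)) * div_diff i f"

definition omega0 :: "'a::field \<Rightarrow> nat \<Rightarrow> 'a mpol \<Rightarrow> 'a mpol" where
  "omega0 q n f = psubst (\<lambda>j. if j = 1 then const q * var n
                               else if 2 \<le> j \<and> j \<le> n then var (j - 1) else var j) f"

text \<open>Product of a list of operators; the rightmost one acts first.\<close>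

definition op_prod :: "('b \<Rightarrow> 'b) list \<Rightarrow> 'b \<Rightarrow> 'b" where
  "op_prod Fs = foldr (\<circ>) Fs id"

definition Y_op :: "'a::field \<Rightarrow> 'a \<Rightarrow> nat \<Rightarrow> nat \<Rightarrow> 'a mpol \<Rightarrow> 'a mpol" where
  "Y_op q t n i f = const (inverse t ^ (n - i)) *
     (op_prod (map (T_op t) [i..<n]) \<circ> omega0 q n \<circ>
      op_prod (map (\<lambda>j. inv (T_op t j)) [1..<i])) f"

text \<open>
  The parameters \<open>q\<close> and \<open>t\<close> are explicit arguments, so that \<open>t\<close> can be replaced by \<open>qt\<close>.
\<close>

definition is_macdonald_E :: "'a::field \<Rightarrow> 'a \<Rightarrow> nat \<Rightarrow> expo \<Rightarrow> 'a mpol \<Rightarrow> bool" where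
  "is_macdonald_E q t n \<eta> f \<longleftrightarrow>
     Poly_Mapping.lookup f \<eta> = 1 \<and>
     (\<forall>\<nu>\<in>Poly_Mapping.keys f. \<nu> \<noteq> \<eta> \<longrightarrow> composition n \<nu> \<and> prec n \<nu> \<eta>) \<and>
     (\<forall>i\<in>{1..n}. Y_op q t n i f = const (eigval q t n \<eta> i) * f)"

definition macdonald_E :: "'a::field \<Rightarrow> 'a \<Rightarrow> nat \<Rightarrow> expo \<Rightarrow> 'a mpol" where
  "macdonald_E q t n \<eta> = (THE f. is_macdonald_E q t n \<eta> f)"

definition word_perm :: "nat list \<Rightarrow> nat \<Rightarrow> nat" where
  "word_perm w = op_prod (map (\<lambda>i. transpose i (Suc i)) w)"

definition perm_length :: "nat \<Rightarrow> (nat \<Rightarrow> nat) \<Rightarrow> nat" where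
  "perm_length n \<sigma> = (LEAST l. \<exists>w. length w = l \<and> set w \<subseteq> {1..<n} \<and> word_perm w = \<sigma>)"

definition reduced_word :: "nat \<Rightarrow> (nat \<Rightarrow> nat) \<Rightarrow> nat list \<Rightarrow> bool" where
  "reduced_word n \<sigma> w \<longleftrightarrow> set w \<subseteq> {1..<n} \<and> word_perm w = \<sigma> \<and> length w = perm_length n \<sigma>"

text \<open>The operators satisfy the braid relations, so the choice of reduced word is immaterial.\<close>

definition T_perm :: "'a::field \<Rightarrow> nat \<Rightarrow> (nat \<Rightarrow> nat) \<Rightarrow> 'a mpol \<Rightarrow> 'a mpol" where
  "T_perm t n \<sigma> = op_prod (map (T_op t) (SOME w. reduced_word n \<sigma> w))"

definition U_plus :: "'a::field \<Rightarrow> nat \<Rightarrow> 'a mpol \<Rightarrow> 'a mpol" where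
  "U_plus t n f = (\<Sum>\<sigma> | \<sigma> permutes {1..n}. T_perm t n \<sigma> f)"

definition U_minus :: "'a::field \<Rightarrow> nat \<Rightarrow> 'a mpol \<Rightarrow> 'a mpol" where
  "U_minus t n f =
     (\<Sum>\<sigma> | \<sigma> permutes {1..n}. const ((- (1 / t)) ^ perm_length n \<sigma>) * T_perm t n \<sigma> f)"

text \<open>
  Both are determined by any single rearrangement of the indexing partition; the definitions ask
  for proportionality to the (anti)symmetrisation for every rearrangement at once.
\<close>

definition macdonald_P :: "'a::field \<Rightarrow> 'a \<Rightarrow> nat \<Rightarrow> expo \<Rightarrow> 'a mpol" where
  "macdonald_P q t n \<kappa> = (THE f. Poly_Mapping.lookup f \<kappa> = 1 \<and>
     (\<forall>\<eta>. composition n \<eta> \<and> is_permutation_of n \<eta> \<kappa> \<longrightarrow>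
        (\<exists>c. f = const c * U_plus t n (macdonald_E q t n \<eta>))))"

definition macdonald_S :: "'a::field \<Rightarrow> 'a \<Rightarrow> nat \<Rightarrow> expo \<Rightarrow> 'a mpol" where
  "macdonald_S q t n \<kappa> = (THE f. Poly_Mapping.lookup f \<kappa> = 1 \<and>
     (\<forall>\<mu>. composition n \<mu> \<and> is_permutation_of n \<mu> \<kappa> \<longrightarrow>
        (\<exists>c. f = const c * U_minus t n (macdonald_E q t n \<mu>))))"

definition Delta_t :: "'a::field \<Rightarrow> nat \<Rightarrow> 'a mpol" where
  "Delta_t t n = (\<Prod>i\<in>{1..n}. \<Prod>j\<in>{i<..n}. var i - const (inverse t) * var j)"

text \<open>
  \<open>\<rat>(q,t)\<close> as the fraction field of \<open>\<rat>[q][t]\<close>. It is also \<open>\<rat>(q,qt)\<close>, so polynomials with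
  parameters \<open>q\<close> and \<open>qt\<close> live over the same field.
\<close>

type_synonym ratfun_qt = "rat poly poly fract"

definition q_ind :: ratfun_qt where
  "q_ind = Fract [:[:0, 1:]:] 1"

definition t_ind :: ratfun_qt where
  "t_ind = Fract [:0, 1:] 1"

end

theory Submission
  imports Defs
begin

text \<open>
  Over the field of fractions, multiplication by \<open>\<Delta>\<^sub>t\<close> conjugates \<open>T\<^sub>i\<close> into \<open>-t\<close> times the operator
  \<open>T\<^sub>i\<close> with parameter \<open>1/t\<close>. Hence, for symmetric \<open>h\<close>, the operator \<open>\<Sum>\<^sub>i Y\<^sub>i\<close> sends \<open>\<Delta>\<^sub>t h\<close> to \<open>q\<^bsup>n-1\<^esup> \<Delta>\<^sub>t h'\<close>,
  where \<open>h'\<close> is the image of \<open>h\<close> under the same operator with parameter \<open>qt\<close>. So \<open>\<Delta>\<^sub>t P\<^sub>\<kappa>(z;q,qt)\<close> is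
  \<open>t\<close>-antisymmetric with leading term \<open>z\<^bsup>\<kappa>+\<delta>\<^esup>\<close>, and it is an eigenvector for the eigenvalue of \<open>\<kappa>+\<delta>\<close>.
  Different partitions have different eigenvalues, so it lies in the span of the \<open>E\<^sub>\<mu>\<close> with \<open>\<mu>\<close> a
  permutation of \<open>\<kappa>+\<delta>\<close>. The intertwiners \<open>T\<^sub>i E\<^sub>\<eta> + \<gamma> E\<^sub>\<eta> = b E\<^bsub>s\<^sub>i\<eta>\<^esub>\<close> make all \<open>U\<^sup>- E\<^sub>\<mu>\<close> proportional,
  and applying \<open>U\<^sup>-\<close> identifies it with \<open>S\<^bsub>\<kappa>+\<delta>\<^esub>\<close>.
\<close>

section \<open>Polynomials, substitutions and exchange operators\<close>

text \<open>Products of the polynomial operators are hard to expand because \<open>T_op\<close>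
  contains an exact quotient. On the fraction field T_i is a combination of 1 and s_i with rational
  coefficients, and since \<open>to_fract\<close> is injective, every relation checked there returns
  to polynomials. The sum of the Y_i cannot be used to construct the E's: its eigenvalue is the same
  for all rearrangements of a partition. The weighted sum \<open>Ysep\<close> separates compositions
  and gives existence and uniqueness; the unweighted sum commutes with all T_i and is kept for
  separating partitions. The order \<open>prec\<close> refers to sorted compositions, which is
  awkward when single monomials are tracked through a product of operators. The relation
  \<open>below\<close> implies it and is transitive and well-founded by numerical statistics.
  Genericity of the parameters is linear independence of the monomials q^a t^b over the integers. It
  passes from (q, t) to (q, qt), so the theory developed once serves S at t and P at qt.\<close>

abbreviation mon :: "expo \<Rightarrow> 'a::field mpol" where
  "mon \<alpha> \<equiv> Poly_Mapping.single \<alpha> 1"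

abbreviation coef :: "'a::field mpol \<Rightarrow> expo \<Rightarrow> 'a" where
  "coef \<equiv> Poly_Mapping.lookup"

abbreviation supp :: "'a::field mpol \<Rightarrow> expo set" where
  "supp \<equiv> Poly_Mapping.keys"

lemma const_add: "const (a + b) = const a + const b"
  by (simp add: const_def single_add)
lemma const_diff: "const (a - b) = const a - const b"
  by (simp add: const_def single_diff)
lemma const_uminus: "const (- a) = - const a"
  by (simp add: const_def single_uminus)
lemma const_mult: "const (a * b) = const a * const b"
  by (simp add: const_def mult_single)
lemma const_0 [simp]: "const 0 = 0"
  by (simp add: const_def)
lemma const_1 [simp]: "const 1 = 1"
  by (simp add: const_def)
lemma const_power: "const (a ^ k) = const a ^ k"
  by (induction k) (simp_all add: const_mult)
lemma const_sum: "const (sum f A) = (\<Sum>x\<in>A. const (f x))"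
  by (induction A rule: infinite_finite_induct) (simp_all add: const_add)
lemma const_eq_iff [simp]: "const a = const b \<longleftrightarrow> a = b"
  by (metis const_def lookup_single_eq)
lemma const_eq_0_iff [simp]: "const a = 0 \<longleftrightarrow> a = 0"
  using const_eq_iff[of a 0] by simp

lemma const_mult_single: "const c * Poly_Mapping.single \<alpha> d = Poly_Mapping.single \<alpha> (c * d)"
  by (simp add: const_def mult_single)

lemma sum_single_expand:
  assumes "finite A" "supp f \<subseteq> A"
  shows "f = (\<Sum>\<alpha>\<in>A. Poly_Mapping.single \<alpha> (coef f \<alpha>))"
proof (rule poly_mapping_eqI)
  fix \<beta>
  have "coef (\<Sum>\<alpha>\<in>A. Poly_Mapping.single \<alpha> (coef f \<alpha>)) \<beta>
      = (\<Sum>\<alpha>\<in>A. if \<alpha> = \<beta> then coef f \<alpha> else 0)"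
    by (auto simp: lookup_sum lookup_single when_def intro!: sum.cong)
  also have "\<dots> = coef f \<beta>"
    using assms by (auto simp: in_keys_iff subset_iff)
  finally show "coef f \<beta> = coef (\<Sum>\<alpha>\<in>A. Poly_Mapping.single \<alpha> (coef f \<alpha>)) \<beta>" ..
qed

lemma coef_const_mult [simp]: "coef (const c * f) \<alpha> = c * coef f \<alpha>"
proof -
  have "const c * f = (\<Sum>\<alpha>\<in>supp f. Poly_Mapping.single \<alpha> (c * coef f \<alpha>))"
    by (subst sum_single_expand[of "supp f" f])
       (simp_all add: sum_distrib_left const_mult_single)
  also have "coef \<dots> \<alpha> = (\<Sum>\<beta>\<in>supp f. if \<beta> = \<alpha> then c * coef f \<beta> else 0)"
    by (auto simp: lookup_sum lookup_single when_def intro!: sum.cong)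
  also have "\<dots> = c * coef f \<alpha>"
    by (auto simp: in_keys_iff)
  finally show ?thesis .
qed

lemma supp_const_mult: "supp (const c * f) \<subseteq> supp f"
  by (auto simp: in_keys_iff)

lemma sum_mon_expand:
  assumes "finite A" "supp f \<subseteq> A"
  shows "f = (\<Sum>\<alpha>\<in>A. const (coef f \<alpha>) * mon \<alpha>)"
  using sum_single_expand[OF assms] by (simp add: const_mult_single)

lemma mon_add: "mon (\<alpha> + \<beta>) = mon \<alpha> * mon \<beta>"
  by (simp add: mult_single)

lemma var_power: "var i ^ k = mon (Poly_Mapping.single i k)"
  by (induction k) (simp_all add: var_def mult_single flip: single_add)

text \<open>Constants and variables generate the ring, so an identity between ring homomorphisms is
  checked on them alone. Most commutation rules for substitutions below are proved this way.\<close>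

lemma mpol_induct [case_names const var add mult]:
  assumes c: "\<And>c. P (const c)" and v: "\<And>i. P (var i)"
    and a: "\<And>f g. P f \<Longrightarrow> P g \<Longrightarrow> P (f + g)" and m: "\<And>f g. P f \<Longrightarrow> P g \<Longrightarrow> P (f * g)"
  shows "P (f :: 'a::field mpol)"
proof -
  have p: "P (var i ^ k)" for i k
    by (induction k) (use c[of 1] v m in auto)
  have mm: "P (mon \<alpha>)" for \<alpha>
  proof (induction \<alpha> rule: update_induct)
    case const
    then show ?case using c[of 1] by simp
  next
    case (update \<alpha> i k)
    have "Poly_Mapping.update i k \<alpha> = \<alpha> + Poly_Mapping.single i k"
      using update(1) by (intro poly_mapping_eqI) (auto simp: lookup_update lookup_add lookup_single in_keys_iff)
    then show ?case using m[OF update(3) p[of i k]] by (simp add: mon_add var_power)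
  qed
  have s: "P (\<Sum>\<alpha>\<in>A. const (coef f \<alpha>) * mon \<alpha>)" if "finite A" for A
    using that by (induction A) (use c[of 0] in \<open>auto intro: a m c mm\<close>)
  show ?thesis by (subst sum_mon_expand[of "supp f" f]) (simp_all add: s)
qed

section \<open>Substitution as a ring homomorphism\<close>

definition pmon :: "(nat \<Rightarrow> 'a::field mpol) \<Rightarrow> expo \<Rightarrow> 'a mpol" where
  "pmon g \<alpha> = (\<Prod>i\<in>Poly_Mapping.keys \<alpha>. g i ^ Poly_Mapping.lookup \<alpha> i)"

lemma pmon_superset:
  "finite A \<Longrightarrow> Poly_Mapping.keys \<alpha> \<subseteq> A \<Longrightarrow> pmon g \<alpha> = (\<Prod>i\<in>A. g i ^ Poly_Mapping.lookup \<alpha> i)"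
  unfolding pmon_def by (rule prod.mono_neutral_left) (auto simp: in_keys_iff)

lemma pmon_add: "pmon g (\<alpha> + \<beta>) = pmon g \<alpha> * pmon g \<beta>"
proof -
  let ?A = "Poly_Mapping.keys \<alpha> \<union> Poly_Mapping.keys \<beta>"
  have "pmon g (\<alpha> + \<beta>) = (\<Prod>i\<in>?A. g i ^ Poly_Mapping.lookup (\<alpha> + \<beta>) i)"
    by (rule pmon_superset) (simp_all add: keys_add)
  also have "\<dots> = (\<Prod>i\<in>?A. g i ^ Poly_Mapping.lookup \<alpha> i) * (\<Prod>i\<in>?A. g i ^ Poly_Mapping.lookup \<beta> i)"
    by (simp add: lookup_add power_add prod.distrib)
  also have "\<dots> = pmon g \<alpha> * pmon g \<beta>"
    by (simp add: pmon_superset[of ?A])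
  finally show ?thesis .
qed

lemma psubst_superset:
  "finite A \<Longrightarrow> supp f \<subseteq> A \<Longrightarrow> psubst g f = (\<Sum>\<alpha>\<in>A. const (coef f \<alpha>) * pmon g \<alpha>)"
  unfolding psubst_def pmon_def[symmetric] by (rule sum.mono_neutral_left) (auto simp: in_keys_iff)

lemma psubst_add: "psubst g (f + h) = psubst g f + psubst g h"
proof -
  let ?A = "supp f \<union> supp h"
  have "psubst g (f + h) = (\<Sum>\<alpha>\<in>?A. const (coef (f + h) \<alpha>) * pmon g \<alpha>)"
    by (rule psubst_superset) (simp_all add: keys_add)
  then show ?thesis
    by (simp add: lookup_add const_add distrib_right sum.distrib psubst_superset[of ?A])
qed

lemma psubst_0 [simp]: "psubst g 0 = 0"
  by (simp add: psubst_def)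

lemma psubst_sum: "psubst g (sum F A) = (\<Sum>x\<in>A. psubst g (F x))"
  by (induction A rule: infinite_finite_induct) (simp_all add: psubst_add)

lemma psubst_single: "psubst g (Poly_Mapping.single \<alpha> c) = const c * pmon g \<alpha>"
  by (subst psubst_superset[of "{\<alpha>}"]) auto

lemma psubst_mult: "psubst g (f * h) = psubst g f * psubst g h"
proof -
  have f: "f = (\<Sum>\<alpha>\<in>supp f. Poly_Mapping.single \<alpha> (coef f \<alpha>))"
    and h: "h = (\<Sum>\<alpha>\<in>supp h. Poly_Mapping.single \<alpha> (coef h \<alpha>))"
    by (rule sum_single_expand; simp)+
  have "f * h = (\<Sum>\<alpha>\<in>supp f. \<Sum>\<beta>\<in>supp h. Poly_Mapping.single (\<alpha> + \<beta>) (coef f \<alpha> * coef h \<beta>))"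
    by (subst f, subst h) (simp add: sum_product mult_single)
  then have "psubst g (f * h)
      = (\<Sum>\<alpha>\<in>supp f. \<Sum>\<beta>\<in>supp h. (const (coef f \<alpha>) * pmon g \<alpha>) * (const (coef h \<beta>) * pmon g \<beta>))"
    by (simp add: psubst_sum psubst_single const_mult pmon_add mult_ac)
  also have "\<dots> = psubst g f * psubst g h"
    by (simp add: psubst_superset[of "supp f" f] psubst_superset[of "supp h" h] sum_product)
  finally show ?thesis .
qed

lemma psubst_const [simp]: "psubst g (const c) = const c"
  by (simp add: const_def psubst_single pmon_def)

lemma psubst_1 [simp]: "psubst g 1 = 1"
  using psubst_const[of g 1] by simp

lemma psubst_var [simp]: "psubst g (var i) = g i"
  by (simp add: var_def psubst_single pmon_def)

lemma psubst_uminus: "psubst g (- f) = - psubst g f"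
  using psubst_add[of g f "- f"] by (simp add: add_eq_0_iff2)

lemma psubst_diff: "psubst g (f - h) = psubst g f - psubst g h"
  using psubst_add[of g f "- h"] by (simp add: psubst_uminus)

lemma psubst_power: "psubst g (f ^ k) = psubst g f ^ k"
  by (induction k) (simp_all add: psubst_mult)

lemma psubst_prod: "psubst g (prod F A) = (\<Prod>x\<in>A. psubst g (F x))"
  by (induction A rule: infinite_finite_induct) (simp_all add: psubst_mult)

lemmas psubst_hom = psubst_add psubst_mult psubst_diff psubst_uminus psubst_power psubst_sum psubst_prod

lemma psubst_var_id: "psubst var f = f"
  by (induction f rule: mpol_induct) (simp_all add: psubst_hom)

lemma var_eq_iff [simp]: "(var i :: 'a::field mpol) = var j \<longleftrightarrow> i = j"
proof
  assume "(var i :: 'a mpol) = var j"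
  then have "coef (var i :: 'a mpol) (Poly_Mapping.single i 1) = coef (var j :: 'a mpol) (Poly_Mapping.single i 1)" by simp
  then have "Poly_Mapping.single j (1::nat) = Poly_Mapping.single i 1"
    by (auto simp: var_def lookup_single when_def split: if_splits)
  then have "Poly_Mapping.lookup (Poly_Mapping.single j (1::nat)) i = 1" by simp
  then show "i = j" by (auto simp: lookup_single when_def split: if_splits)
qed simp

section \<open>Exchange operators and divided differences\<close>

lemma swap_op_var [simp]: "swap_op i (var j) = var (transpose i (Suc i) j)"
  by (simp add: swap_op_def)
lemma swap_op_const [simp]: "swap_op i (const c) = const c"
  by (simp add: swap_op_def)
lemma swap_op_hom:
  "swap_op i (f + g) = swap_op i f + swap_op i g" "swap_op i (f * g) = swap_op i f * swap_op i g"
  "swap_op i (f - g) = swap_op i f - swap_op i g" "swap_op i (- f) = - swap_op i f"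
  "swap_op i (f ^ k) = swap_op i f ^ k" "swap_op i (sum F A) = (\<Sum>x\<in>A. swap_op i (F x))"
  "swap_op i (prod F A) = (\<Prod>x\<in>A. swap_op i (F x))"
  by (simp_all add: swap_op_def psubst_hom)

lemma swap_op_0 [simp]: "swap_op i 0 = 0" and swap_op_1 [simp]: "swap_op i 1 = 1"
  by (simp_all add: swap_op_def)

lemma swap_op_swap_op [simp]: "swap_op i (swap_op i f) = f"
  by (induction f rule: mpol_induct) (simp_all add: swap_op_hom)

lemma swap_op_braid:
  "swap_op i (swap_op (Suc i) (swap_op i f)) = swap_op (Suc i) (swap_op i (swap_op (Suc i) f))"
  by (induction f rule: mpol_induct) (simp_all add: swap_op_hom transpose_def)

lemma swap_op_comm:
  "Suc i < j \<Longrightarrow> swap_op i (swap_op j f) = swap_op j (swap_op i f)"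
  by (induction f rule: mpol_induct) (auto simp add: swap_op_hom transpose_def)

lemma inj_swap_op: "inj (swap_op i)"
  by (rule inj_on_inverseI[of _ "swap_op i"]) simp

lemma var_diff_neq_0 [simp]: "var i - var (Suc i) \<noteq> (0::'a::field mpol)"
  by simp

text \<open>The polynomials f for which z_i - z_(i+1) divides s_i f - f form a subring containing
  constants and variables; closure under products is the twisted Leibniz rule in the last
  case.\<close>

lemma div_diff_exists: "\<exists>g. (var i - var (Suc i)) * g = swap_op i f - (f::'a::field mpol)"
proof (induction f rule: mpol_induct)
  case (const c)
  then show ?case by (intro exI[of _ 0]) simp
next
  case (var j)
  consider "j = i" | "j = Suc i" | "j \<noteq> i" "j \<noteq> Suc i" by blast
  then show ?case
    by cases (auto intro: exI[of _ "-1"] exI[of _ 1] exI[of _ 0])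
next
  case (add f g)
  then obtain a b where "(var i - var (Suc i)) * a = swap_op i f - f" "(var i - var (Suc i)) * b = swap_op i g - g" by blast
  then show ?case by (intro exI[of _ "a + b"]) (simp add: swap_op_hom distrib_left)
next
  case (mult f g)
  then obtain a b where ab: "(var i - var (Suc i)) * a = swap_op i f - f" "(var i - var (Suc i)) * b = swap_op i g - g" by blast
  have "swap_op i (f * g) - f * g = swap_op i f * (swap_op i g - g) + (swap_op i f - f) * g"
    by (simp add: swap_op_hom algebra_simps)
  then show ?case
    by (intro exI[of _ "swap_op i f * b + a * g"]) (simp add: ab[symmetric] algebra_simps)
qed

lemma div_diff: "(var i - var (Suc i)) * div_diff i f = swap_op i f - (f::'a::field mpol)"
  unfolding div_diff_def
proof (rule theI')
  show "\<exists>!g. (var i - var (Suc i)) * g = swap_op i f - f"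
    using div_diff_exists[of i f] by (metis mult_left_cancel var_diff_neq_0)
qed

lemma T_op_char:
  "(var i - var (Suc i)) * T_op t i f
    = const (1 - t) * var (Suc i) * f + (const t * var i - var (Suc i)) * swap_op i f"
proof -
  have "(var i - var (Suc i)) * T_op t i f = const t * (var i - var (Suc i)) * f
     + (const t * var i - var (Suc i)) * ((var i - var (Suc i)) * div_diff i f)"
    by (simp add: T_op_def algebra_simps)
  also have "\<dots> = const (1 - t) * var (Suc i) * f + (const t * var i - var (Suc i)) * swap_op i f"
    unfolding div_diff by (simp add: const_diff algebra_simps)
  finally show ?thesis .
qed

text \<open>Multiplication by z_i - z_(i+1) is injective. From here on T_i is evaluated by verifying
  the equation with cleared denominator, never through \<open>div_diff\<close>.\<close>

lemma T_op_unique: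
  assumes "(var i - var (Suc i)) * g
    = const (1 - t) * var (Suc i) * f + (const t * var i - var (Suc i)) * swap_op i f"
  shows "T_op t i f = g"
  using assms T_op_char[of i t f] mult_left_cancel[OF var_diff_neq_0] by metis

lemma T_op_add: "T_op t i (f + g) = T_op t i f + T_op t i g"
  by (rule T_op_unique) (simp only: distrib_left T_op_char swap_op_hom, simp only: algebra_simps)

lemma T_op_mult_sym: "swap_op i g = g \<Longrightarrow> T_op t i (g * f) = g * T_op t i f"
  by (rule T_op_unique)
     (simp only: swap_op_hom T_op_char mult.left_commute[of _ g], simp only: algebra_simps)

lemma T_op_const_mult: "T_op t i (const c * f) = const c * T_op t i f"
  by (rule T_op_mult_sym) simp

text \<open>\<open>SOME\<close> ranges over the images of all representations of x as a fraction;
  \<open>fract_ext_Fract\<close> shows that these agree. Injectivity of \<phi> keeps the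
  denominators nonzero.\<close>

definition fract_ext :: "('a::idom \<Rightarrow> 'a) \<Rightarrow> 'a fract \<Rightarrow> 'a fract" where
  "fract_ext \<phi> x = (SOME y. \<exists>a b. b \<noteq> 0 \<and> x = Fract a b \<and> y = Fract (\<phi> a) (\<phi> b))"

locale inj_ring_hom =
  fixes \<phi> :: "'a::idom \<Rightarrow> 'a"
  assumes hom_add: "\<phi> (a + b) = \<phi> a + \<phi> b" and hom_mult: "\<phi> (a * b) = \<phi> a * \<phi> b"
    and hom_1: "\<phi> 1 = 1" and inj_hom: "inj \<phi>"
begin

lemma hom_0: "\<phi> 0 = 0"
  using hom_add[of 0 0] by (metis add_cancel_right_right add_0)

lemma hom_eq_0_iff: "\<phi> a = 0 \<longleftrightarrow> a = 0"
  using inj_hom hom_0 by (metis injD)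

lemma fract_ext_Fract: "b \<noteq> 0 \<Longrightarrow> fract_ext \<phi> (Fract a b) = Fract (\<phi> a) (\<phi> b)"
  unfolding fract_ext_def
proof (rule some_equality)
  fix y assume b: "b \<noteq> 0" and "\<exists>a' b'. b' \<noteq> 0 \<and> Fract a b = Fract a' b' \<and> y = Fract (\<phi> a') (\<phi> b')"
  then obtain a' b' where *: "b' \<noteq> 0" "Fract a b = Fract a' b'" "y = Fract (\<phi> a') (\<phi> b')" by blast
  then have "a * b' = a' * b" using b by (simp add: eq_fract)
  then have "\<phi> a * \<phi> b' = \<phi> a' * \<phi> b" by (metis hom_mult)
  then show "y = Fract (\<phi> a) (\<phi> b)" using * b by (simp add: eq_fract hom_eq_0_iff)
qed blast

lemma fract_ext_add: "fract_ext \<phi> (x + y) = fract_ext \<phi> x + fract_ext \<phi> y"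
  by (cases x; cases y) (simp add: fract_ext_Fract hom_add hom_mult hom_eq_0_iff)

lemma fract_ext_mult: "fract_ext \<phi> (x * y) = fract_ext \<phi> x * fract_ext \<phi> y"
  by (cases x; cases y) (simp add: fract_ext_Fract hom_mult hom_eq_0_iff)

lemma fract_ext_to_fract: "fract_ext \<phi> (to_fract a) = to_fract (\<phi> a)"
  by (simp add: to_fract_def fract_ext_Fract hom_1)

lemma fract_ext_0: "fract_ext \<phi> 0 = 0" and fract_ext_1: "fract_ext \<phi> 1 = 1"
  using fract_ext_to_fract[of 0] fract_ext_to_fract[of 1] by (simp_all add: hom_0 hom_1)

lemma fract_ext_uminus: "fract_ext \<phi> (- x) = - fract_ext \<phi> x"
  using fract_ext_add[of x "- x"] by (simp add: fract_ext_0 add_eq_0_iff2)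

lemma fract_ext_diff: "fract_ext \<phi> (x - y) = fract_ext \<phi> x - fract_ext \<phi> y"
  using fract_ext_add[of x "- y"] by (simp add: fract_ext_uminus)

lemma fract_ext_inverse: "fract_ext \<phi> (inverse x) = inverse (fract_ext \<phi> x)"
proof (cases "x = 0")
  case False
  then have "fract_ext \<phi> x * fract_ext \<phi> (inverse x) = 1"
    by (metis fract_ext_mult fract_ext_1 right_inverse)
  then show ?thesis by (simp add: inverse_unique)
qed (simp add: fract_ext_0)

lemma fract_ext_divide: "fract_ext \<phi> (x / y) = fract_ext \<phi> x / fract_ext \<phi> y"
  by (simp add: divide_inverse fract_ext_mult fract_ext_inverse)

end

section \<open>Exchange operators and T_i on the fraction field\<close>

interpretation swap: inj_ring_hom "swap_op i :: 'a::field mpol \<Rightarrow> 'a mpol" for i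
  by unfold_locales (simp_all add: swap_op_hom inj_swap_op)

abbreviation K :: "'a::field mpol \<Rightarrow> 'a mpol fract" where
  "K \<equiv> to_fract"

abbreviation Kvar :: "nat \<Rightarrow> 'a::field mpol fract" where
  "Kvar i \<equiv> to_fract (var i)"

abbreviation Kconst :: "'a::field \<Rightarrow> 'a mpol fract" where
  "Kconst c \<equiv> to_fract (const c)"

definition sK :: "nat \<Rightarrow> 'a::field mpol fract \<Rightarrow> 'a mpol fract" where
  "sK i = fract_ext (swap_op i)"

lemma sK_K: "sK i (K f) = K (swap_op i f)"
  by (simp add: sK_def swap.fract_ext_to_fract)

lemma sK_Kvar [simp]: "sK i (Kvar j) = Kvar (transpose i (Suc i) j)"
  and sK_Kconst [simp]: "sK i (Kconst c) = Kconst c"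
  by (simp_all add: sK_K)

lemma sK_hom:
  "sK i (f + g) = sK i f + sK i g" "sK i (f * g) = sK i f * sK i g"
  "sK i (f - g) = sK i f - sK i g" "sK i (- f) = - sK i f" "sK i (f / g) = sK i f / sK i g"
  by (simp_all add: sK_def swap.fract_ext_add swap.fract_ext_mult swap.fract_ext_diff
      swap.fract_ext_uminus swap.fract_ext_divide)

lemma sK_0 [simp]: "sK i 0 = 0" and sK_1 [simp]: "sK i 1 = 1"
  by (simp_all add: sK_def swap.fract_ext_0 swap.fract_ext_1)

lemma sK_sum: "sK i (sum F A) = (\<Sum>x\<in>A. sK i (F x))"
  by (induction A rule: infinite_finite_induct) (simp_all add: sK_hom)

lemma sK_prod: "sK i (prod F A) = (\<Prod>x\<in>A. sK i (F x))"
  by (induction A rule: infinite_finite_induct) (simp_all add: sK_hom)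

lemma fract_cases_K:
  obtains a b where "x = K a / K b" "b \<noteq> 0"
  by (cases x) (auto simp: Fract_conv_to_fract)

text \<open>Maps that respect quotients are determined by their values on polynomials; this
  transports the Coxeter relations of \<open>swap_op\<close> to \<open>sK\<close>.\<close>

lemma sK_eqI:
  assumes "\<And>a. F (K a) = G (K a)" "\<And>a b. F (a / b) = F a / F b" "\<And>a b. G (a / b) = G a / G b"
  shows "F x = G (x :: 'a::field mpol fract)"
  by (rule fract_cases_K[of x]) (simp add: assms)

lemma sK_sK [simp]: "sK i (sK i f) = f"
  by (rule sK_eqI[of "\<lambda>f. sK i (sK i f)" "\<lambda>f. f"]) (simp_all add: sK_K sK_hom)

lemma sK_braid: "sK i (sK (Suc i) (sK i f)) = sK (Suc i) (sK i (sK (Suc i) f))"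
  by (rule sK_eqI[of "\<lambda>f. sK i (sK (Suc i) (sK i f))"]) (simp_all add: sK_K sK_hom swap_op_braid)

lemma sK_comm: "Suc i < j \<Longrightarrow> sK i (sK j f) = sK j (sK i f)"
  by (rule sK_eqI[of "\<lambda>f. sK i (sK j f)"]) (simp_all add: sK_K sK_hom swap_op_comm[of i j])

text \<open>T_i with the exact quotient replaced by a division, so that the Hecke relations become
  identities between rational functions.\<close>

definition TK :: "'a::field \<Rightarrow> nat \<Rightarrow> 'a mpol fract \<Rightarrow> 'a mpol fract" where
  "TK t i f = (Kconst (1 - t) * Kvar (Suc i) * f + (Kconst t * Kvar i - Kvar (Suc i)) * sK i f)
     / (Kvar i - Kvar (Suc i))"

lemma Kvar_eq_iff [simp]: "Kvar i = Kvar j \<longleftrightarrow> i = j"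
  by (simp add: to_fract_eq_iff)

lemma K_T_op: "K (T_op t i f) = TK t i (K f)"
proof -
  have "(Kvar i - Kvar (Suc i)) * K (T_op t i f) = K ((var i - var (Suc i)) * T_op t i f)"
    by simp
  then show ?thesis
    unfolding T_op_char by (simp add: TK_def sK_K field_simps)
qed

lemma TK_quadratic: "TK t i (TK t i f) = Kconst (t - 1) * TK t i f + Kconst t * f"
proof -
  define x y F where "x = (Kvar i :: 'a mpol fract)" and "y = (Kvar (Suc i) :: 'a mpol fract)" and "F = sK i f"
  have "x \<noteq> y" "y \<noteq> x" by (simp_all add: x_def y_def)
  moreover have "sK i x = y" "sK i y = x" "sK i F = f" by (simp_all add: x_def y_def F_def)
  ultimately show ?thesis
    unfolding TK_def x_def[symmetric] y_def[symmetric] F_def[symmetric]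
    apply (simp add: sK_hom F_def[symmetric] const_diff divide_simps)
    apply (simp add: algebra_simps)
    done
qed

lemma TK_comm: assumes "Suc i < j" shows "TK t i (TK t j f) = TK t j (TK t i f)"
proof -
  have [simp]: "Kvar i \<noteq> (Kvar (Suc i)::'a mpol fract)" "Kvar j \<noteq> (Kvar (Suc j)::'a mpol fract)" by simp_all
  have [simp]: "transpose i (Suc i) j = j" "transpose i (Suc i) (Suc j) = Suc j"
    "transpose j (Suc j) i = i" "transpose j (Suc j) (Suc i) = Suc i"
    using assms by (auto simp: transpose_def)
  show ?thesis
    by (simp add: TK_def sK_hom sK_comm[OF assms] divide_simps) (simp add: algebra_simps)
qed


text \<open>Writing T_i = a + b s_i, both triple products expand over the six elements of S_3 and
  the coefficients are compared. Those of the two words of length two and of the longest word agree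
  at sight.\<close>

lemma TK_braid: "TK t i (TK t (Suc i) (TK t i f)) = TK t (Suc i) (TK t i (TK t (Suc i) f))"
proof -
  define x y z where "x = (Kvar i :: 'a mpol fract)" and "y = (Kvar (Suc i) :: 'a mpol fract)"
    and "z = (Kvar (Suc (Suc i)) :: 'a mpol fract)"
  define s r where "s = (sK i :: 'a mpol fract \<Rightarrow> _)" and "r = (sK (Suc i) :: 'a mpol fract \<Rightarrow> _)"
  define T where "T = Kconst t"
  have ne: "x - y \<noteq> 0" "y - x \<noteq> 0" "x - z \<noteq> 0" "z - x \<noteq> 0" "y - z \<noteq> 0" "z - y \<noteq> 0"
    by (simp_all add: x_def y_def z_def)
  have im: "s x = y" "s y = x" "s z = z" "r x = x" "r y = z" "r z = y" "s T = T" "r T = T"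
    by (simp_all add: s_def r_def x_def y_def z_def T_def)
  have ss: "s (s g) = g" "r (r g) = g" "r (s (r g)) = s (r (s g))" for g
    by (simp_all add: s_def r_def sK_braid)
  have hom: "s (a + b) = s a + s b" "s (a * b) = s a * s b" "s (a - b) = s a - s b" "s (a / b) = s a / s b" "s 1 = 1"
    "r (a + b) = r a + r b" "r (a * b) = r a * r b" "r (a - b) = r a - r b" "r (a / b) = r a / r b" "r 1 = 1" for a b
    by (simp_all add: s_def r_def sK_hom)
  define a b where "a = (\<lambda>x y. (1 - T) * y / (x - y))" and "b = (\<lambda>x y. (T * x - y) / (x - y))"
  have sr: "s (a u v) = a (s u) (s v)" "s (b u v) = b (s u) (s v)"
    "r (a u v) = a (r u) (r v)" "r (b u v) = b (r u) (r v)" for u v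
    by (simp_all add: a_def b_def hom im)
  have 1: "TK t i g = a x y * g + b x y * s g" for g
    by (simp add: TK_def x_def y_def T_def s_def const_diff a_def b_def add_divide_distrib)
  have 2: "TK t (Suc i) g = a y z * g + b y z * r g" for g
    by (simp add: TK_def z_def y_def T_def r_def const_diff a_def b_def add_divide_distrib)
  \<comment> \<open>Identities 3 and 4 match the coefficients of \<open>s f\<close> and of
    \<open>r f\<close>.\<close>
  have 3: "a x y * a y z + a x z * a y x = a y z * a x z"
    using ne unfolding a_def by (simp add: divide_simps) (simp add: algebra_simps)
  have 4: "a x y * a x z = a y z * a x y + a x z * a z y"
    using ne unfolding a_def by (simp add: divide_simps) (simp add: algebra_simps)
  have bb: "b x y * b y x = T - (1 - T) * a x y - a x y * a x y"
    "b y z * b z y = T - (1 - T) * a y z - a y z * a y z"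
    using ne unfolding a_def b_def by (simp_all add: divide_simps) (simp_all add: algebra_simps)
  have aa: "a y x = - (1 - T) - a x y" "a z y = - (1 - T) - a y z"
    using ne unfolding a_def by (simp_all add: divide_simps) (simp_all add: algebra_simps)
  \<comment> \<open>The coefficient of f itself. By \<open>bb\<close> the products of two b's are
    quadratic in the a's, and then identity 3 multiplied by \<open>a x y - a y z\<close> suffices;
    this avoids one large rational identity.\<close>
  have 5: "a x y * a x y * a y z + b x y * a x z * b y x = a y z * a y z * a x y + b y z * a x z * b z y"
  proof -
    have "a x y * a y z = a x z * ((1 - T) + a x y + a y z)"
      using 3 unfolding aa by (simp add: algebra_simps)
    then have "a x y * a y z * (a x y - a y z) = a x z * ((1 - T) + a x y + a y z) * (a x y - a y z)"
      by simp
    also have "\<dots> = a x z * (b y z * b z y - b x y * b y x)"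
      unfolding bb by (simp add: algebra_simps)
    finally show ?thesis by (simp add: algebra_simps)
  qed
  have "TK t i (TK t (Suc i) (TK t i f)) =
     (a x y * a x y * a y z + b x y * a x z * b y x) * f
     + (a x y * a y z + a x z * a y x) * b x y * s f + (a x y * a x z) * b y z * r f
     + b x y * b x z * a y z * s (r f) + a x y * b y z * b x z * r (s f) + b x y * b x z * b y z * s (r (s f))"
    unfolding 1 2 by (simp only: hom sr im ss) (simp add: algebra_simps)
  moreover have "TK t (Suc i) (TK t i (TK t (Suc i) f)) =
     (a y z * a y z * a x y + b y z * a x z * b z y) * f
     + (a y z * a x z) * b x y * s f + (a y z * a x y + a x z * a z y) * b y z * r f
     + b x y * b x z * a y z * s (r f) + a x y * b y z * b x z * r (s f) + b x y * b x z * b y z * s (r (s f))"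
    unfolding 1 2 by (simp only: hom sr im ss) (simp add: algebra_simps)
  ultimately show ?thesis
    unfolding 3 4[symmetric] 5 by simp
qed

section \<open>Words and symmetrisers\<close>

definition word_op :: "(nat \<Rightarrow> 'b \<Rightarrow> 'b) \<Rightarrow> nat list \<Rightarrow> 'b \<Rightarrow> 'b" where
  "word_op G w = op_prod (map G w)"

lemma word_op_Nil [simp]: "word_op G [] = id"
  and word_op_Cons: "word_op G (i # w) = G i \<circ> word_op G w"
  by (simp_all add: word_op_def op_prod_def)

lemma word_op_append: "word_op G (u @ v) = word_op G u \<circ> word_op G v"
  by (induction u) (simp_all add: word_op_Cons comp_assoc)

lemma word_perm_word_op: "word_perm w = word_op (\<lambda>i. transpose i (Suc i)) w"
  by (simp add: word_perm_def word_op_def)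

lemma word_perm_Nil [simp]: "word_perm [] = id"
  and word_perm_Cons: "word_perm (i # w) = transpose i (Suc i) \<circ> word_perm w"
  and word_perm_append: "word_perm (u @ v) = word_perm u \<circ> word_perm v"
  by (simp_all add: word_perm_word_op word_op_Cons word_op_append)

text \<open>Only braid and commutation moves, no cancellation of repeated letters: the relation
  preserves length, and it holds for every family with the braid relations whatever its quadratic
  relation is.\<close>

inductive braid_eq :: "nat list \<Rightarrow> nat list \<Rightarrow> bool" where
  refl: "braid_eq w w"
| sym: "braid_eq u v \<Longrightarrow> braid_eq v u"
| trans: "braid_eq u v \<Longrightarrow> braid_eq v w \<Longrightarrow> braid_eq u w"
| braid: "braid_eq (u @ [i, Suc i, i] @ v) (u @ [Suc i, i, Suc i] @ v)"
| comm: "Suc i < j \<Longrightarrow> braid_eq (u @ [i, j] @ v) (u @ [j, i] @ v)"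

lemma braid_eq_context: "braid_eq w w' \<Longrightarrow> braid_eq (u @ w @ v) (u @ w' @ v)"
proof (induction rule: braid_eq.induct)
  case (braid a i b)
  then show ?case using braid_eq.braid[of "u @ a" i "b @ v"] by simp
next
  case (comm i j a b)
  then show ?case using braid_eq.comm[of i j "u @ a" "b @ v"] by simp
qed (auto intro: braid_eq.intros)

lemma braid_eq_append1: "braid_eq w w' \<Longrightarrow> braid_eq (u @ w) (u @ w')"
  using braid_eq_context[of w w' u "[]"] by simp
lemma braid_eq_append2: "braid_eq w w' \<Longrightarrow> braid_eq (w @ v) (w' @ v)"
  using braid_eq_context[of w w' "[]" v] by simp
lemma braid_eq_Cons: "braid_eq w w' \<Longrightarrow> braid_eq (i # w) (i # w')"
  using braid_eq_append1[of w w' "[i]"] by simp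

lemma braid_eq_length: "braid_eq w w' \<Longrightarrow> length w = length w'"
  by (induction rule: braid_eq.induct) auto

lemma braid_eq_commute:
  "\<forall>j\<in>set w. Suc i < j \<or> Suc j < i \<Longrightarrow> braid_eq (i # w) (w @ [i])"
proof (induction w)
  case (Cons j w)
  have "braid_eq ([i, j] @ w) ([j, i] @ w)"
    using Cons.prems comm[of i j "[]" w] comm[of j i "[]" w, THEN sym] by auto
  then show ?case
    using braid_eq_Cons[of "i # w" "w @ [i]" j] Cons by (auto intro: braid_eq.trans)
qed (auto intro: refl)

text \<open>The letter i commutes with the letters below i - 1, one braid move turns i, i-1, i into
  i-1, i, i-1, and the freed i - 1 commutes with the letters above i. The normal forms and the
  commutation of T_j with Y_i both rest on this shift.\<close>

lemma braid_eq_shift: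
  assumes "k < i" "i < n"
  shows "braid_eq (i # [k..<n]) ([k..<n] @ [i - 1])"
proof -
  obtain j where j: "i = Suc j" using assms by (cases i) auto
  define a b where "a = [k..<j]" and "b = [Suc (Suc j)..<n]"
  have split: "[k..<n] = a @ [j, Suc j] @ b"
  proof -
    have "[k..<n] = [k..<j] @ [j..<n]"
      using assms j upt_add_eq_append[of k j "n - j"] by simp
    then show ?thesis using assms j by (simp add: a_def b_def upt_conv_Cons)
  qed
  have "braid_eq ((i # a) @ ([j, Suc j] @ b)) ((a @ [i]) @ ([j, Suc j] @ b))"
    by (intro braid_eq_append2 braid_eq_commute) (auto simp: a_def j)
  moreover have "braid_eq (a @ [Suc j, j, Suc j] @ b) (a @ [j, Suc j, j] @ b)"
    by (rule braid[THEN sym])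
  moreover have "braid_eq ((a @ [j, Suc j]) @ (j # b)) ((a @ [j, Suc j]) @ (b @ [j]))"
    by (intro braid_eq_append1 braid_eq_commute) (auto simp: b_def)
  ultimately show ?thesis
    unfolding split by (auto simp: j intro: braid_eq.trans)
qed

text \<open>Shared by the transpositions, by T_i and its inverse, and by s_i and T_i on the fraction
  field.\<close>

locale braided =
  fixes G :: "nat \<Rightarrow> 'b \<Rightarrow> 'b"
  assumes G_braid: "G i (G (Suc i) (G i x)) = G (Suc i) (G i (G (Suc i) x))"
    and G_comm: "Suc i < j \<Longrightarrow> G i (G j x) = G j (G i x)"
begin

lemma word_op_braid_eq: "braid_eq w w' \<Longrightarrow> word_op G w = word_op G w'"
proof (induction rule: braid_eq.induct)
  case (comm i j u v)
  then show ?case by (simp add: word_op_append word_op_Cons fun_eq_iff G_comm[OF comm])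
qed (auto simp: word_op_append word_op_Cons fun_eq_iff G_braid)

end

interpretation perm: braided "\<lambda>i. transpose i (Suc i)"
  by unfold_locales (auto simp: transpose_def)

lemma word_perm_braid_eq: "braid_eq w w' \<Longrightarrow> word_perm w = word_perm w'"
  unfolding word_perm_word_op by (rule perm.word_op_braid_eq)

lemma bij_word_perm: "bij (word_perm w)"
  by (induction w) (auto simp only: word_perm_Cons word_perm_Nil bij_id bij_transpose intro!: bij_comp)

lemma word_perm_permutes: "set w \<subseteq> {1..<n} \<Longrightarrow> word_perm w permutes {1..n}"
  by (induction w) (auto simp: word_perm_Cons permutes_id intro!: permutes_compose permutes_swap_id)

text \<open>Normal forms of words, from the coset decomposition of \<open>S\<^sub>n\<close> modulo \<open>S\<^bsub>n-1\<^esub>\<close>.\<close>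

fun canon :: "nat \<Rightarrow> nat list set" where
  "canon 0 = {[]}"
| "canon (Suc m) = {[k..<Suc m] @ w | k w. 1 \<le> k \<and> k \<le> Suc m \<and> w \<in> canon m}"

lemma Nil_in_canon: "[] \<in> canon n"
proof (induction n)
  case (Suc m)
  then have "[Suc m..<Suc m] @ [] \<in> canon (Suc m)" by (simp del: upt_Suc) blast
  then show ?case by simp
qed simp

lemma set_canon: "w \<in> canon n \<Longrightarrow> set w \<subseteq> {1..<n}"
proof (induction n arbitrary: w)
  case (Suc m)
  then obtain k v where "w = [k..<Suc m] @ v" "1 \<le> k" "v \<in> canon m" by auto
  then show ?case using Suc.IH[of v] by fastforce
qed auto

text \<open>The exchange property for normal forms: prefixing i yields a normal form, or i can be
  split off the given one. Compare i with the start k of the leading run: far below k it passes to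
  the tail, at k - 1 it prolongs the run, at k the run loses its first letter, and above k it passes
  to the tail as i - 1.\<close>

lemma canon_step:
  "w \<in> canon n \<Longrightarrow> i \<in> {1..<n} \<Longrightarrow> \<exists>w'\<in>canon n. braid_eq (i # w) w' \<or> braid_eq (i # w') w"
proof (induction n arbitrary: w i)
  case (Suc m)
  obtain k v where w: "w = [k..<Suc m] @ v" and k: "1 \<le> k" "k \<le> Suc m" and v: "v \<in> canon m"
    using Suc.prems by auto
  have in_canon: "[l..<Suc m] @ u \<in> canon (Suc m)" if "1 \<le> l" "l \<le> Suc m" "u \<in> canon m" for l u
    using that by auto
  have push: "\<exists>w'\<in>canon (Suc m). braid_eq (i # w) w' \<or> braid_eq (i # w') w"
    if *: "braid_eq (i # [k..<Suc m]) ([k..<Suc m] @ [j])" and j: "j \<in> {1..<m}" for j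
  proof -
    obtain v' where v': "v' \<in> canon m" "braid_eq (j # v) v' \<or> braid_eq (j # v') v"
      using Suc.IH[OF v j] by blast
    have a: "braid_eq (i # [k..<Suc m] @ u) ([k..<Suc m] @ j # u)" for u
      using braid_eq_append2[OF *, of u] by simp
    show ?thesis
      using v'(2) braid_eq_append1[of "j # v" v' "[k..<Suc m]"] braid_eq_append1[of "j # v'" v "[k..<Suc m]"]
        a in_canon[OF k v'(1)] unfolding w
      by (meson braid_eq.trans)
  qed
  consider "Suc i < k" | "Suc i = k" | "i = k" | "k < i" by linarith
  then show ?case
  proof cases
    case 1
    have "braid_eq (i # [k..<Suc m]) ([k..<Suc m] @ [i])"
      by (rule braid_eq_commute) (use 1 in auto)
    then show ?thesis by (rule push) (use 1 k Suc.prems in auto)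
  next
    case 2
    then have "i # w = [i..<Suc m] @ v" using k by (simp add: w upt_conv_Cons del: upt_Suc)
    then show ?thesis using in_canon[of i v] 2 Suc.prems v by (auto simp del: upt_Suc intro: refl)
  next
    case 3
    then have "w = i # [Suc i..<Suc m] @ v" using Suc.prems by (simp add: w upt_conv_Cons del: upt_Suc)
    then show ?thesis using in_canon[of "Suc i" v] 3 Suc.prems v by (force simp del: upt_Suc intro: refl)
  next
    case 4
    show ?thesis by (rule push[OF braid_eq_shift]) (use 4 k Suc.prems in auto)
  qed
qed auto

lemma word_perm_fixes: "set w \<subseteq> {1..<n} \<Longrightarrow> n < j \<Longrightarrow> word_perm w j = j"
  using word_perm_permutes[of w n] by (auto simp: permutes_def)

lemma word_perm_upt: "k \<le> n \<Longrightarrow> word_perm [k..<n] n = k"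
  by (induction n) (auto simp: word_perm_append word_perm_Cons le_Suc_eq)

text \<open>The tail fixes the last point \<open>Suc m\<close>, so the image of that point is the
  start k of the leading run. The permutation thus determines k, and then the tail by
  induction.\<close>

lemma canon_inj: "w \<in> canon n \<Longrightarrow> w' \<in> canon n \<Longrightarrow> word_perm w = word_perm w' \<Longrightarrow> w = w'"
proof (induction n arbitrary: w w')
  case (Suc m)
  obtain k v where w: "w = [k..<Suc m] @ v" and k: "1 \<le> k" "k \<le> Suc m" and v: "v \<in> canon m"
    using Suc.prems by auto
  obtain k' v' where w': "w' = [k'..<Suc m] @ v'" and k': "1 \<le> k'" "k' \<le> Suc m" and v': "v' \<in> canon m"
    using Suc.prems by auto
  have fixed: "word_perm u (Suc m) = Suc m" if "u \<in> canon m" for u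
    by (rule word_perm_fixes[OF set_canon[OF that]]) simp
  have "word_perm w (Suc m) = k" "word_perm w' (Suc m) = k'"
    using k k' by (simp_all add: w w' word_perm_append fixed v v' word_perm_upt del: upt_Suc)
  then have kk: "k = k'" using Suc.prems(3) by simp
  have "word_perm v = word_perm v'"
    using Suc.prems(3) bij_word_perm[of "[k..<Suc m]", THEN bij_is_inj]
    by (simp add: w w' kk word_perm_append fun_eq_iff inj_eq del: upt_Suc)
  then show ?case using Suc.IH[OF v v'] by (simp add: w w' kk)
qed auto

lemma canon_surj: "\<sigma> permutes {1..n} \<Longrightarrow> \<exists>w\<in>canon n. word_perm w = \<sigma>"
proof (induction n arbitrary: \<sigma>)
  case (Suc m)
  define k where "k = \<sigma> (Suc m)"
  define c where "c = word_perm [k..<Suc m]"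
  have k: "1 \<le> k" "k \<le> Suc m"
    using permutes_in_image[OF Suc.prems, of "Suc m"] by (auto simp: k_def)
  have c: "c permutes {1..Suc m}" unfolding c_def by (rule word_perm_permutes) (use k in auto)
  have "c (Suc m) = k" using k by (simp add: c_def word_perm_upt del: upt_Suc)
  then have "(inv c \<circ> \<sigma>) (Suc m) = Suc m"
    using permutes_inverses[OF c] by (metis comp_apply k_def)
  moreover have "inv c \<circ> \<sigma> permutes {1..Suc m}"
    by (rule permutes_compose[OF Suc.prems permutes_inv[OF c]])
  ultimately have "inv c \<circ> \<sigma> permutes {1..m}"
    by (elim permutes_superset) (auto simp: le_Suc_eq)
  then obtain v where v: "v \<in> canon m" "word_perm v = inv c \<circ> \<sigma>" using Suc.IH by blast
  have "word_perm ([k..<Suc m] @ v) = \<sigma>"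
    using permutes_inverses[OF c] by (simp add: word_perm_append v c_def[symmetric] fun_eq_iff del: upt_Suc)
  then show ?case using v k by (intro bexI[of _ "[k..<Suc m] @ v"]) auto
qed auto

text \<open>The word is straightened from the right. In the second alternative of
  \<open>canon_step\<close> the two letters i cancel in the permutation, so the length never
  grows.\<close>

lemma canon_of_word:
  "set u \<subseteq> {1..<n} \<Longrightarrow> \<exists>w\<in>canon n. word_perm w = word_perm u \<and> length w \<le> length u"
proof (induction u)
  case Nil
  then show ?case using Nil_in_canon by auto
next
  case (Cons i u)
  then obtain w where w: "w \<in> canon n" "word_perm w = word_perm u" "length w \<le> length u" by auto
  obtain w' where w': "w' \<in> canon n" "braid_eq (i # w) w' \<or> braid_eq (i # w') w"
    using canon_step[OF w(1), of i] Cons.prems by auto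
  from w'(2) show ?case
  proof
    assume *: "braid_eq (i # w) w'"
    show ?thesis
      using w w'(1) word_perm_braid_eq[OF *] braid_eq_length[OF *]
      by (intro bexI[of _ w']) (auto simp: word_perm_Cons)
  next
    assume *: "braid_eq (i # w') w"
    then have "word_perm w = transpose i (Suc i) \<circ> word_perm w'" "length w = Suc (length w')"
      using word_perm_braid_eq[OF *] braid_eq_length[OF *] by (auto simp: word_perm_Cons)
    then show ?thesis
      using w w'(1) by (intro bexI[of _ w']) (auto simp: word_perm_Cons fun_eq_iff)
  qed
qed

lemma perm_length_le: "set u \<subseteq> {1..<n} \<Longrightarrow> perm_length n (word_perm u) \<le> length u"
  unfolding perm_length_def by (rule Least_le) auto

text \<open>A shortest word straightens to a normal form that is no longer, and by injectivity that
  normal form is w.\<close>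

lemma perm_length_canon: "w \<in> canon n \<Longrightarrow> perm_length n (word_perm w) = length w"
proof (rule antisym)
  assume w: "w \<in> canon n"
  show "perm_length n (word_perm w) \<le> length w"
    by (rule perm_length_le) (use set_canon[OF w] in auto)
  have "\<exists>u. length u = perm_length n (word_perm w) \<and> set u \<subseteq> {1..<n} \<and> word_perm u = word_perm w"
    unfolding perm_length_def by (rule LeastI[of _ "length w"]) (use set_canon[OF w] in auto)
  then obtain u where u: "length u = perm_length n (word_perm w)" "set u \<subseteq> {1..<n}" "word_perm u = word_perm w" by blast
  then show "length w \<le> perm_length n (word_perm w)"
    using canon_of_word[OF u(2)] canon_inj[OF w] by metis
qed

lemma reduced_word_canon: "w \<in> canon n \<Longrightarrow> reduced_word n (word_perm w) w"
  using set_canon[of w n] by (simp add: reduced_word_def perm_length_canon)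

lemma reduced_word_exists: "\<sigma> permutes {1..n} \<Longrightarrow> \<exists>w. reduced_word n \<sigma> w"
  using canon_surj reduced_word_canon by blast

text \<open>Straightening a reduced word uses only the first alternative of
  \<open>canon_step\<close>: the second would produce a strictly shorter word for the same
  permutation.\<close>

lemma reduced_word_canon_eq: "reduced_word n (word_perm u) u \<Longrightarrow> \<exists>w\<in>canon n. braid_eq u w"
proof (induction u)
  case Nil
  then show ?case using Nil_in_canon by (auto intro: refl)
next
  case (Cons i u)
  then have set: "set u \<subseteq> {1..<n}" "i \<in> {1..<n}" and len: "Suc (length u) = perm_length n (word_perm (i # u))"
    by (auto simp: reduced_word_def)
  \<comment> \<open>A shorter word for the tail would, after prefixing i, contradict the minimality
    of \<open>i # u\<close>.\<close>
  have "reduced_word n (word_perm u) u"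
  proof -
    obtain v where v: "v \<in> canon n" "word_perm v = word_perm u" "length v \<le> length u"
      using canon_of_word[OF set(1)] by blast
    have "perm_length n (word_perm (i # v)) \<le> length (i # v)"
      by (rule perm_length_le) (use set_canon[OF v(1)] set in auto)
    then have "length u \<le> length v" using v(2) len by (simp add: word_perm_Cons)
    then show ?thesis using v perm_length_canon[OF v(1)] set by (simp add: reduced_word_def)
  qed
  then obtain w where w: "w \<in> canon n" "braid_eq u w" using Cons.IH by blast
  obtain w' where w': "w' \<in> canon n" "braid_eq (i # w) w' \<or> braid_eq (i # w') w"
    using canon_step[OF w(1) set(2)] by auto
  from w'(2) show ?case
  proof
    assume "braid_eq (i # w) w'"
    then show ?thesis using w w'(1) braid_eq_Cons[OF w(2), of i] by (blast intro: braid_eq.trans)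
  next
    assume *: "braid_eq (i # w') w"
    have "word_perm (i # u) = word_perm w'"
      using word_perm_braid_eq[OF *] word_perm_braid_eq[OF w(2)]
      by (metis comp_assoc id_comp transpose_comp_involutory word_perm_Cons)
    then have "Suc (length u) = length w'" using len perm_length_canon[OF w'(1)] by simp
    then show ?thesis using braid_eq_length[OF *] braid_eq_length[OF w(2)] by simp
  qed
qed

text \<open>Matsumoto's theorem for S_n. It makes \<open>T_perm\<close> independent of the word
  picked by \<open>SOME\<close>.\<close>

lemma reduced_words_braid_eq:
  assumes "reduced_word n \<sigma> u" "reduced_word n \<sigma> v"
  shows "braid_eq u v"
proof -
  have *: "word_perm u = \<sigma>" "word_perm v = \<sigma>" using assms by (auto simp: reduced_word_def)
  obtain a b where "a \<in> canon n" "braid_eq u a" "b \<in> canon n" "braid_eq v b"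
    using assms reduced_word_canon_eq * by metis
  moreover from this have "a = b" using word_perm_braid_eq * canon_inj by metis
  ultimately show ?thesis by (blast intro: braid_eq.trans braid_eq.sym)
qed

lemma perm_length_step:
  assumes "\<sigma> permutes {1..n}" "i \<in> {1..<n}"
  shows "perm_length n (transpose i (Suc i) \<circ> \<sigma>) = Suc (perm_length n \<sigma>)
       \<or> perm_length n \<sigma> = Suc (perm_length n (transpose i (Suc i) \<circ> \<sigma>))"
proof -
  obtain w where w: "w \<in> canon n" "word_perm w = \<sigma>" using canon_surj[OF assms(1)] by blast
  obtain w' where w': "w' \<in> canon n" "braid_eq (i # w) w' \<or> braid_eq (i # w') w"
    using canon_step[OF w(1) assms(2)] by auto
  have wp: "word_perm w' = transpose i (Suc i) \<circ> \<sigma>"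
    using w'(2) w word_perm_braid_eq[of "i # w" w'] word_perm_braid_eq[of "i # w'" w]
    by (metis comp_assoc id_comp transpose_comp_involutory word_perm_Cons)
  show ?thesis
    using w'(2) braid_eq_length[of "i # w" w'] braid_eq_length[of "i # w'" w]
      perm_length_canon[OF w(1)] perm_length_canon[OF w'(1)] unfolding w wp by auto
qed

lemma word_perm_rev: "word_perm (rev w) = inv (word_perm w)"
  by (induction w)
     (simp_all only: rev.simps word_perm_append word_perm_Cons word_perm_Nil o_inv_distrib bij_word_perm
       bij_transpose inv_transpose_eq inv_id comp_id)

lemma perm_length_inv_le:
  assumes "\<sigma> permutes {1..n}"
  shows "perm_length n (inv \<sigma>) \<le> perm_length n \<sigma>"
proof -
  obtain w where "reduced_word n \<sigma> w" using reduced_word_exists[OF assms] by blast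
  then show ?thesis
    using perm_length_le[of "rev w" n] by (auto simp: word_perm_rev reduced_word_def)
qed

lemma perm_length_inv:
  assumes "\<sigma> permutes {1..n}"
  shows "perm_length n (inv \<sigma>) = perm_length n \<sigma>"
  using perm_length_inv_le[OF assms] perm_length_inv_le[OF permutes_inv[OF assms]]
  by (simp add: permutes_inv_inv[OF assms])

lemma perm_length_step_right:
  assumes "\<sigma> permutes {1..n}" "i \<in> {1..<n}"
  shows "perm_length n (\<sigma> \<circ> transpose i (Suc i)) = Suc (perm_length n \<sigma>)
       \<or> perm_length n \<sigma> = Suc (perm_length n (\<sigma> \<circ> transpose i (Suc i)))"
proof -
  have t: "transpose i (Suc i) permutes {1..n}" using assms(2) by (auto intro: permutes_swap_id)
  have "inv (\<sigma> \<circ> transpose i (Suc i)) = transpose i (Suc i) \<circ> inv \<sigma>"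
    by (simp add: o_inv_distrib permutes_bij[OF assms(1)] inv_transpose_eq)
  then show ?thesis
    using perm_length_step[OF permutes_inv[OF assms(1)] assms(2)]
      perm_length_inv[OF assms(1)] perm_length_inv[OF permutes_compose[OF t assms(1)]] by simp
qed

section \<open>Hecke relations on polynomials and the symmetrisers\<close>

lemma T_op_quadratic: "T_op t i (T_op t i f) = const (t - 1) * T_op t i f + const t * f"
proof -
  have "K (T_op t i (T_op t i f)) = K (const (t - 1) * T_op t i f + const t * f)"
    by (simp add: K_T_op TK_quadratic)
  then show ?thesis by (simp only: to_fract_eq_iff)
qed

interpretation T: braided "T_op t" for t :: "'a::field"
proof
  fix i j x
  have "K (T_op t i (T_op t (Suc i) (T_op t i x))) = K (T_op t (Suc i) (T_op t i (T_op t (Suc i) x)))"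
    by (simp add: K_T_op TK_braid)
  then show "T_op t i (T_op t (Suc i) (T_op t i x)) = T_op t (Suc i) (T_op t i (T_op t (Suc i) x))"
    by (simp only: to_fract_eq_iff)
  assume "Suc i < j"
  then have "K (T_op t i (T_op t j x)) = K (T_op t j (T_op t i x))"
    by (simp add: K_T_op TK_comm[of i j])
  then show "T_op t i (T_op t j x) = T_op t j (T_op t i x)"
    by (simp only: to_fract_eq_iff)
qed

lemma T_perm_word: "reduced_word n \<sigma> w \<Longrightarrow> T_perm t n \<sigma> = word_op (T_op t) w"
  unfolding T_perm_def word_op_def[symmetric]
  by (rule T.word_op_braid_eq, rule reduced_words_braid_eq) (auto intro: someI)

lemma T_perm_left:
  assumes "\<sigma> permutes {1..n}" "i \<in> {1..<n}" "perm_length n (transpose i (Suc i) \<circ> \<sigma>) = Suc (perm_length n \<sigma>)"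
  shows "T_perm t n (transpose i (Suc i) \<circ> \<sigma>) f = T_op t i (T_perm t n \<sigma> f)"
proof -
  obtain w where w: "reduced_word n \<sigma> w" using reduced_word_exists[OF assms(1)] by blast
  then have "reduced_word n (transpose i (Suc i) \<circ> \<sigma>) (i # w)"
    using assms by (auto simp: reduced_word_def word_perm_Cons)
  then show ?thesis by (simp add: T_perm_word[OF w] T_perm_word word_op_Cons)
qed

lemma T_perm_right:
  assumes "\<sigma> permutes {1..n}" "i \<in> {1..<n}" "perm_length n (\<sigma> \<circ> transpose i (Suc i)) = Suc (perm_length n \<sigma>)"
  shows "T_perm t n (\<sigma> \<circ> transpose i (Suc i)) f = T_perm t n \<sigma> (T_op t i f)"
proof -
  obtain w where w: "reduced_word n \<sigma> w" using reduced_word_exists[OF assms(1)] by blast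
  then have "reduced_word n (\<sigma> \<circ> transpose i (Suc i)) (w @ [i])"
    using assms by (auto simp: reduced_word_def word_perm_append word_perm_Cons)
  then show ?thesis by (simp add: T_perm_word[OF w] T_perm_word word_op_append word_op_Cons)
qed

text \<open>One family containing both symmetrisers, at x = 1 and x = -1/t, so that their properties
  are proved once.\<close>

definition U_sym :: "'a \<Rightarrow> 'a::field \<Rightarrow> nat \<Rightarrow> 'a mpol \<Rightarrow> 'a mpol" where
  "U_sym x t n f = (\<Sum>\<sigma> | \<sigma> permutes {1..n}. const (x ^ perm_length n \<sigma>) * T_perm t n \<sigma> f)"

lemma U_plus_U_sym: "U_plus t n f = U_sym 1 t n f"
  by (simp add: U_plus_def U_sym_def)

lemma U_minus_U_sym: "U_minus t n f = U_sym (- (1 / t)) t n f"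
  by (simp add: U_minus_def U_sym_def)

text \<open>Used with multiplication by s_i on one side, where \<open>A\<close> marks the shorter
  element of each coset.\<close>

lemma sum_involution_pairs:
  fixes F :: "'b \<Rightarrow> 'c::comm_monoid_add"
  assumes "finite P" and inv: "\<And>x. x \<in> P \<Longrightarrow> \<phi> x \<in> P \<and> \<phi> (\<phi> x) = x \<and> (A (\<phi> x) \<longleftrightarrow> \<not> A x)"
  shows "sum F P = (\<Sum>x | x \<in> P \<and> A x. F x + F (\<phi> x))"
proof -
  have "sum F P = sum F {x \<in> P. A x} + sum F {x \<in> P. \<not> A x}"
    using assms(1) by (subst sum.union_disjoint[symmetric]) (auto intro: sum.cong)
  also have "sum F {x \<in> P. \<not> A x} = (\<Sum>x | x \<in> P \<and> A x. F (\<phi> x))"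
    by (rule sum.reindex_bij_witness[of _ \<phi> \<phi>]) (use inv in auto)
  finally show ?thesis by (simp add: sum.distrib)
qed

lemma T_op_0 [simp]: "T_op t i 0 = 0"
  by (rule T_op_unique) simp

lemma T_op_sum: "T_op t i (sum F A) = (\<Sum>x\<in>A. T_op t i (F x))"
  by (induction A rule: infinite_finite_induct) (simp_all add: T_op_add)

text \<open>The condition on \<open>x\<close> is \<open>(1 + x T\<^sub>i) T\<^sub>i = x t (1 + x T\<^sub>i)\<close>; it holds for \<open>x = 1\<close> and \<open>x = -1/t\<close>.\<close>

lemma T_op_pair:
  assumes "1 + x * (t - 1) = x * (x * t)"
  shows "T_op t i f + const x * T_op t i (T_op t i f) = const (x * t) * (f + const x * T_op t i f)"
proof -
  have "T_op t i f + const x * T_op t i (T_op t i f)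
      = const (1 + x * (t - 1)) * T_op t i f + const (x * t) * f"
    by (simp add: T_op_quadratic const_add const_diff const_mult algebra_simps)
  also have "\<dots> = const (x * t) * (f + const x * T_op t i f)"
    unfolding assms by (simp add: const_mult algebra_simps)
  finally show ?thesis .
qed

lemma word_op_T_add: "word_op (T_op t) w (f + g) = word_op (T_op t) w f + word_op (T_op t) w g"
  by (induction w arbitrary: f g) (simp_all add: word_op_Cons T_op_add)

lemma word_op_T_const: "word_op (T_op t) w (const c * f) = const c * word_op (T_op t) w f"
  by (induction w) (simp_all add: word_op_Cons T_op_const_mult)

lemma T_perm_linear:
  assumes "\<sigma> permutes {1..n}"
  shows "T_perm t n \<sigma> (f + g) = T_perm t n \<sigma> f + T_perm t n \<sigma> g"
    "T_perm t n \<sigma> (const c * f) = const c * T_perm t n \<sigma> f"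
proof -
  obtain w where w: "reduced_word n \<sigma> w" using reduced_word_exists[OF assms(1)] by blast
  show "T_perm t n \<sigma> (f + g) = T_perm t n \<sigma> f + T_perm t n \<sigma> g"
    "T_perm t n \<sigma> (const c * f) = const c * T_perm t n \<sigma> f"
    by (simp_all add: T_perm_word[OF w] word_op_T_add word_op_T_const)
qed

lemma U_sym_add: "U_sym x t n (f + g) = U_sym x t n f + U_sym x t n g"
  unfolding U_sym_def sum.distrib[symmetric]
  by (rule sum.cong) (auto simp: T_perm_linear distrib_left)

lemma U_sym_const_mult: "U_sym x t n (const c * f) = const c * U_sym x t n f"
  unfolding U_sym_def sum_distrib_left
  by (rule sum.cong) (auto simp: T_perm_linear mult.left_commute)

lemma U_sym_0 [simp]: "U_sym x t n 0 = 0"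
  using U_sym_const_mult[of x t n 0 0] by simp

lemma U_sym_sum: "U_sym x t n (sum F A) = (\<Sum>y\<in>A. U_sym x t n (F y))"
  by (induction A rule: infinite_finite_induct) (simp_all add: U_sym_add)

text \<open>Pairing \<sigma> with \<open>?s \<circ> \<sigma>\<close> pulls a factor 1 + x T_i out of
  the symmetriser on the left, and pairing with \<open>\<sigma> \<circ> ?s\<close> pulls it out on
  the right. By \<open>T_op_pair\<close> this factor turns a further T_i into the scalar x
  t.\<close>

lemma
  assumes x: "1 + x * (t - 1) = x * (x * t)" and i: "i \<in> {1..<n}"
  shows T_op_U_sym: "T_op t i (U_sym x t n f) = const (x * t) * U_sym x t n f"
    and U_sym_T_op: "U_sym x t n (T_op t i f) = const (x * t) * U_sym x t n f"
proof -
  let ?s = "transpose i (Suc i)" and ?P = "{\<sigma>. \<sigma> permutes {1..n}}" and ?l = "perm_length n"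
  define F where "F = (\<lambda>f \<sigma>. const (x ^ ?l \<sigma>) * T_perm t n \<sigma> f)"
  have fin: "finite ?P" by (rule finite_permutations) simp
  have s: "?s permutes {1..n}" using i by (auto intro: permutes_swap_id)
  have "U_sym x t n f = (\<Sum>\<sigma> | \<sigma> \<in> ?P \<and> ?l (?s \<circ> \<sigma>) = Suc (?l \<sigma>). F f \<sigma> + F f (?s \<circ> \<sigma>))" for f
    unfolding U_sym_def F_def
  proof (rule sum_involution_pairs[OF fin])
    fix \<sigma> assume "\<sigma> \<in> ?P"
    then have "?s \<circ> (?s \<circ> \<sigma>) = \<sigma>" "?s \<circ> \<sigma> \<in> ?P" by (auto simp only: mem_Collect_eq o_assoc transpose_comp_involutory id_comp permutes_compose[OF _ s])
    then show "?s \<circ> \<sigma> \<in> ?P \<and> ?s \<circ> (?s \<circ> \<sigma>) = \<sigma> \<and>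
        (?l (?s \<circ> (?s \<circ> \<sigma>)) = Suc (?l (?s \<circ> \<sigma>))) = (?l (?s \<circ> \<sigma>) \<noteq> Suc (?l \<sigma>))"
      using perm_length_step[of \<sigma> n i] i \<open>\<sigma> \<in> ?P\<close> by auto
  qed
  also have "(\<Sum>\<sigma> | \<sigma> \<in> ?P \<and> ?l (?s \<circ> \<sigma>) = Suc (?l \<sigma>). F f \<sigma> + F f (?s \<circ> \<sigma>)) =
    (\<Sum>\<sigma> | \<sigma> \<in> ?P \<and> ?l (?s \<circ> \<sigma>) = Suc (?l \<sigma>). const (x ^ ?l \<sigma>) * (T_perm t n \<sigma> f + const x * T_op t i (T_perm t n \<sigma> f)))" for f
    by (rule sum.cong) (use i in \<open>auto simp: F_def T_perm_left const_mult algebra_simps\<close>)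
  finally have U: "U_sym x t n f = (\<Sum>\<sigma> | \<sigma> \<in> ?P \<and> ?l (?s \<circ> \<sigma>) = Suc (?l \<sigma>).
     const (x ^ ?l \<sigma>) * (T_perm t n \<sigma> f + const x * T_op t i (T_perm t n \<sigma> f)))" for f .
  show "T_op t i (U_sym x t n f) = const (x * t) * U_sym x t n f"
    unfolding U T_op_sum sum_distrib_left
    by (rule sum.cong) (auto simp: T_op_const_mult T_op_add T_op_pair[OF x] mult.left_commute)
  have "U_sym x t n f = (\<Sum>\<sigma> | \<sigma> \<in> ?P \<and> ?l (\<sigma> \<circ> ?s) = Suc (?l \<sigma>). F f \<sigma> + F f (\<sigma> \<circ> ?s))" for f
    unfolding U_sym_def F_def
  proof (rule sum_involution_pairs[OF fin])
    fix \<sigma> assume "\<sigma> \<in> ?P"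
    then have "(\<sigma> \<circ> ?s) \<circ> ?s = \<sigma>" "\<sigma> \<circ> ?s \<in> ?P" by (auto simp only: mem_Collect_eq comp_assoc transpose_comp_involutory comp_id permutes_compose[OF s])
    then show "\<sigma> \<circ> ?s \<in> ?P \<and> (\<sigma> \<circ> ?s) \<circ> ?s = \<sigma> \<and>
        (?l ((\<sigma> \<circ> ?s) \<circ> ?s) = Suc (?l (\<sigma> \<circ> ?s))) = (?l (\<sigma> \<circ> ?s) \<noteq> Suc (?l \<sigma>))"
      using perm_length_step_right[of \<sigma> n i] i \<open>\<sigma> \<in> ?P\<close> by auto
  qed
  also have "(\<Sum>\<sigma> | \<sigma> \<in> ?P \<and> ?l (\<sigma> \<circ> ?s) = Suc (?l \<sigma>). F f \<sigma> + F f (\<sigma> \<circ> ?s)) =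
    (\<Sum>\<sigma> | \<sigma> \<in> ?P \<and> ?l (\<sigma> \<circ> ?s) = Suc (?l \<sigma>). const (x ^ ?l \<sigma>) * (T_perm t n \<sigma> (f + const x * T_op t i f)))" for f
    by (rule sum.cong) (use i in \<open>auto simp: F_def T_perm_right T_perm_linear const_mult algebra_simps\<close>)
  finally have U: "U_sym x t n f = (\<Sum>\<sigma> | \<sigma> \<in> ?P \<and> ?l (\<sigma> \<circ> ?s) = Suc (?l \<sigma>).
     const (x ^ ?l \<sigma>) * (T_perm t n \<sigma> (f + const x * T_op t i f)))" for f .
  show "U_sym x t n (T_op t i f) = const (x * t) * U_sym x t n f"
    unfolding U T_op_sum sum_distrib_left
    by (rule sum.cong) (auto simp: T_perm_linear T_op_pair[OF x] mult.left_commute)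
qed

text \<open>\<open>T_perm\<close> multiplies f by e to the length, so the scalar is the Poincare
  polynomial of S_n at x e: at t for symmetric f with x = 1, at 1/t for antisymmetric f with x =
  -1/t.\<close>

lemma U_sym_eigen:
  assumes "\<And>i. i \<in> {1..<n} \<Longrightarrow> T_op t i f = const e * f"
  shows "U_sym x t n f = const (\<Sum>\<sigma> | \<sigma> permutes {1..n}. (x * e) ^ perm_length n \<sigma>) * f"
proof -
  have w: "word_op (T_op t) w f = const (e ^ length w) * f" if "set w \<subseteq> {1..<n}" for w
    using that by (induction w) (simp_all add: word_op_Cons assms T_op_const_mult const_mult mult.left_commute mult.assoc)
  have "const (x ^ perm_length n \<sigma>) * T_perm t n \<sigma> f = const ((x * e) ^ perm_length n \<sigma>) * f"
    if \<sigma>: "\<sigma> permutes {1..n}" for \<sigma>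
  proof -
    obtain w where w': "reduced_word n \<sigma> w" using reduced_word_exists[OF \<sigma>] by blast
    then show ?thesis using w[of w]
      by (simp add: T_perm_word[OF w'] reduced_word_def power_mult_distrib const_mult mult.assoc)
  qed
  then show ?thesis unfolding U_sym_def const_sum sum_distrib_right by (intro sum.cong) auto
qed

section \<open>Passage to the field of fractions\<close>

lemma word_op_comm:
  assumes "\<And>k x. k \<in> set w \<Longrightarrow> A (G k x) = G k (A x)"
  shows "A (word_op G w x) = word_op G w (A x)"
  using assms by (induction w arbitrary: x) (auto simp: word_op_Cons)

lemma bij_comm_inv:
  assumes "bij B" "\<And>x. A (B x) = B (A' x)"
  shows "inv B (A x) = A' (inv B x)"
  using assms by (metis bij_inv_eq_iff)

lemma var_neq_0 [simp]: "(var i :: 'a::field mpol) \<noteq> 0"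
  by (metis lookup_single_eq lookup_zero var_def zero_neq_one)

locale macdonald =
  fixes q t :: "'a::field" and n :: nat
  assumes q_nz [simp]: "q \<noteq> 0" and t_nz [simp]: "t \<noteq> 0"
begin

abbreviation "T \<equiv> T_op t"
abbreviation "Ti j \<equiv> inv (T j)"
abbreviation "om \<equiv> omega0 q n"
abbreviation "Y \<equiv> Y_op q t n"

lemma T_T: "T i (T i f) = const (t - 1) * T i f + const t * f"
  by (rule T_op_quadratic)

lemma bij_T: "bij (T i)"
proof (rule o_bij[of "\<lambda>f. const (1 / t) * (T i f + const (1 - t) * f)"])
  have *: "const (1 / t) * (T i (T i f) + const (1 - t) * T i f) = f" for f
  proof -
    have "T i (T i f) + const (1 - t) * T i f = const t * f"
      by (simp add: T_T const_diff algebra_simps)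
    then show ?thesis by (simp flip: mult.assoc const_mult)
  qed
  then show "(\<lambda>f. const (1 / t) * (T i f + const (1 - t) * f)) \<circ> T i = id"
    by (simp add: fun_eq_iff)
  show "T i \<circ> (\<lambda>f. const (1 / t) * (T i f + const (1 - t) * f)) = id"
    using * by (simp add: fun_eq_iff T_op_const_mult T_op_add)
qed

lemma T_Ti [simp]: "T i (Ti i f) = f" and Ti_T [simp]: "Ti i (T i f) = f"
  using bij_T[of i] by (simp_all add: bij_is_surj surj_f_inv_f bij_is_inj)

lemma Ti_eq: "Ti i f = const (1 / t) * (T i f + const (1 - t) * f)"
proof -
  have "T i (const (1 / t) * (T i f + const (1 - t) * f)) = const (1 / t) * const t * f"
    by (simp only: T_op_const_mult T_op_add T_T) (simp add: const_diff algebra_simps)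
  then have "T i (const (1 / t) * (T i f + const (1 - t) * f)) = f"
    by (simp flip: const_mult)
  then show ?thesis by (metis Ti_T)
qed

lemma Ti_linear: "Ti i (f + g) = Ti i f + Ti i g" "Ti i (const c * f) = const c * Ti i f"
  by (simp_all only: Ti_eq T_op_add T_op_const_mult) (simp_all only: algebra_simps)

section \<open>Commutation of the cyclic operator with T_i\<close>

lemma om_hom:
  "om (f + g) = om f + om g" "om (f * g) = om f * om g" "om (const c) = const c"
  "om (f - g) = om f - om g" "om (sum F A) = (\<Sum>x\<in>A. om (F x))" "om (prod F A) = (\<Prod>x\<in>A. om (F x))"
  by (simp_all add: omega0_def psubst_hom)

lemma om_var: "om (var j) = (if j = 1 then const q * var n else if 2 \<le> j \<and> j \<le> n then var (j - 1) else var j)"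
  by (simp add: omega0_def)

lemma om_swap:
  assumes "1 \<le> i" "Suc i < n"
  shows "om (swap_op (Suc i) f) = swap_op i (om f)"
proof (induction f rule: mpol_induct)
  case (var j)
  show ?case using assms by (auto simp: om_var transpose_def swap_op_hom)
qed (simp_all add: om_hom swap_op_hom)

lemma om_T:
  assumes "1 \<le> i" "Suc i < n"
  shows "om (T (Suc i) f) = T i (om f)"
proof (rule T_op_unique[symmetric])
  have v: "om (var (Suc i)) = var i" "om (var (Suc (Suc i))) = var (Suc i)"
    using assms by (auto simp: om_var)
  have "(var i - var (Suc i)) * om (T (Suc i) f) = om ((var (Suc i) - var (Suc (Suc i))) * T (Suc i) f)"
    by (simp add: om_hom v)
  then show "(var i - var (Suc i)) * om (T (Suc i) f) = const (1 - t) * var (Suc i) * om f +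
    (const t * var i - var (Suc i)) * swap_op i (om f)"
    unfolding T_op_char by (simp add: om_hom v om_swap[OF assms])
qed

lemma om_Ti:
  assumes "1 \<le> i" "Suc i < n"
  shows "Ti i (om f) = om (Ti (Suc i) f)"
  using arg_cong[OF om_T[OF assms, of "Ti (Suc i) f"], of "Ti i"] by simp

text \<open>Conjugation by the cyclic operator lowers indices, but s_1 would become the affine
  generator. A second application moves on from there to s_(n-1).\<close>

lemma om_om_swap:
  assumes "2 \<le> n"
  shows "om (om (swap_op 1 f)) = swap_op (n - 1) (om (om f))"
proof (induction f rule: mpol_induct)
  case (var j)
  consider "j = 0" | "j = 1" | "j = 2" | "2 < j" "j \<le> n" | "n < j" by linarith
  then show ?case
    using assms by cases (auto simp: om_var om_hom transpose_def swap_op_hom)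
qed (simp_all add: om_hom swap_op_hom)

lemma om_om_T:
  assumes "2 \<le> n"
  shows "om (om (T 1 f)) = T (n - 1) (om (om f))"
proof (rule T_op_unique[symmetric])
  define m where "m = n - 1"
  have v: "om (om (var 1)) = const q * var m" "om (om (var (Suc 1))) = const q * var (Suc m)"
    using assms by (auto simp: om_var om_hom m_def)
  \<comment> \<open>Both variables acquire the same factor q, and T_i is homogeneous of degree 0 in
    them, so q cancels.\<close>
  have "const q * ((var m - var (Suc m)) * om (om (T 1 f))) = om (om ((var 1 - var (Suc 1)) * T 1 f))"
    unfolding om_hom v by (simp add: algebra_simps)
  also have "\<dots> = const q * (const (1 - t) * var (Suc m) * om (om f) +
      (const t * var m - var (Suc m)) * swap_op m (om (om f)))"
    unfolding T_op_char om_hom v om_om_swap[OF assms] m_def[symmetric] by (simp add: algebra_simps)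
  finally show "(var (n - 1) - var (Suc (n - 1))) * om (om (T 1 f)) = const (1 - t) * var (Suc (n - 1)) * om (om f) +
      (const t * var (n - 1) - var (Suc (n - 1))) * swap_op (n - 1) (om (om f))"
    by (simp add: m_def)
qed

lemma om_om_Ti:
  assumes "2 \<le> n"
  shows "om (om (Ti 1 f)) = Ti (n - 1) (om (om f))"
  using arg_cong[OF om_om_T[OF assms, of "Ti 1 f"], of "Ti (n - 1)"] by simp

lemma T_comm: "Suc i < j \<or> Suc j < i \<Longrightarrow> T i (T j f) = T j (T i f)"
  using T.G_comm by metis

lemma T_Ti_comm: "Suc i < j \<or> Suc j < i \<Longrightarrow> T i (Ti j f) = Ti j (T i f)"
  using bij_comm_inv[OF bij_T, of "T i" j "T i"] T_comm[of i j] by auto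

sublocale Ti: braided Ti
proof
  fix i j f
  define x where "x = Ti i (Ti (Suc i) (Ti i f))"
  have "f = T i (T (Suc i) (T i x))" by (simp add: x_def)
  also have "\<dots> = T (Suc i) (T i (T (Suc i) x))" by (rule T.G_braid)
  finally have "Ti (Suc i) (Ti i (Ti (Suc i) f)) = x" by simp
  then show "Ti i (Ti (Suc i) (Ti i f)) = Ti (Suc i) (Ti i (Ti (Suc i) f))"
    by (simp add: x_def)
  assume "Suc i < j"
  then show "Ti i (Ti j f) = Ti j (Ti i f)"
    using arg_cong[OF T_Ti_comm[of i j "Ti i f"], of "Ti i"] by simp
qed

section \<open>Relations and commutativity of the Cherednik operators\<close>

lemma Y_eq: "Y i f = const (inverse t ^ (n - i)) * word_op T [i..<n] (om (word_op Ti [1..<i] f))"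
  by (simp add: Y_op_def word_op_def)

lemma word_op_Ti_linear:
  "word_op Ti w (f + g) = word_op Ti w f + word_op Ti w g"
  "word_op Ti w (const c * f) = const c * word_op Ti w f"
  by (induction w) (simp_all add: word_op_Cons Ti_linear)

lemma Y_add: "Y i (f + g) = Y i f + Y i g"
  by (simp add: Y_eq word_op_Ti_linear word_op_T_add om_hom distrib_left)

lemma Y_const_mult: "Y i (const c * f) = const c * Y i f"
  by (simp add: Y_eq word_op_Ti_linear word_op_T_const om_hom mult.left_commute)

lemma Y_0 [simp]: "Y i 0 = 0"
  using Y_const_mult[of i 0 0] by simp

lemma Y_sum: "Y i (sum F A) = (\<Sum>x\<in>A. Y i (F x))"
  by (induction A rule: infinite_finite_induct) (simp_all add: Y_add)

lemma Y_rec: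
  assumes "1 \<le> i" "i < n"
  shows "Y i f = const (1 / t) * T i (Y (Suc i) (T i f))"
proof -
  have 1: "[i..<n] = i # [Suc i..<n]" "n - i = Suc (n - Suc i)" "[1..<Suc i] = [1..<i] @ [i]"
    using assms by (auto simp: upt_conv_Cons)
  have "Y (Suc i) (T i f) = const (inverse t ^ (n - Suc i)) * word_op T [Suc i..<n] (om (word_op Ti [1..<i] f))"
    unfolding Y_eq 1(3) word_op_append by (simp add: word_op_Cons)
  then have "const (1 / t) * T i (Y (Suc i) (T i f))
      = const (1 / t) * const (inverse t ^ (n - Suc i)) * T i (word_op T [Suc i..<n] (om (word_op Ti [1..<i] f)))"
    by (simp add: T_op_const_mult)
  also have "\<dots> = Y i f"
    unfolding Y_eq 1(1,2) by (simp add: word_op_Cons divide_inverse flip: const_mult)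
  finally show ?thesis ..
qed

text \<open>For i < j the product of T's lowers the index j to j - 1 and the cyclic operator raises
  it again; for j + 1 < i the cyclic operator raises j to j + 1 and the product of inverses lowers
  it.\<close>

lemma T_Y_comm:
  assumes "1 \<le> i" "i \<le> n" "1 \<le> j" "j < n" "j \<noteq> i" "Suc j \<noteq> i"
  shows "T j (Y i f) = Y i (T j f)"
proof (cases "i < j")
  case True
  then obtain k where k: "j = Suc k" by (cases j) auto
  have 1: "T j (word_op T [i..<n] g) = word_op T [i..<n] (T k g)" for g
    using T.word_op_braid_eq[OF braid_eq_shift[OF True assms(4)], of t] k
    by (auto simp: word_op_Cons word_op_append fun_eq_iff)
  have 2: "T k (om g) = om (T j g)" for g
    using om_T[of k] assms True k by simp
  have 3: "T j (word_op Ti [1..<i] f) = word_op Ti [1..<i] (T j f)"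
    by (rule word_op_comm) (use True in \<open>auto intro!: T_Ti_comm\<close>)
  show ?thesis by (simp only: Y_eq T_op_const_mult 1 2 3)
next
  case False
  then have ji: "Suc j < i" using assms by auto
  have 1: "T j (word_op T [i..<n] g) = word_op T [i..<n] (T j g)" for g
    by (rule word_op_comm) (use ji in \<open>auto intro!: T_comm\<close>)
  have 2: "T j (om g) = om (T (Suc j) g)" for g
    using om_T[of j] assms ji by simp
  have "Ti (Suc j) (word_op Ti [1..<i] g) = word_op Ti [1..<i] (Ti j g)" for g
    using Ti.word_op_braid_eq[OF braid_eq_shift[of 1 "Suc j" i]] ji assms
    by (auto simp: word_op_Cons word_op_append fun_eq_iff)
  from this[of "T j f"] have 3: "T (Suc j) (word_op Ti [1..<i] f) = word_op Ti [1..<i] (T j f)"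
    by (metis T_Ti Ti_T)
  show ?thesis by (simp only: Y_eq T_op_const_mult 1 2 3)
qed

lemma Y_T_same:
  assumes "1 \<le> i" "i < n"
  shows "Y i (T i f) = T i (Y (Suc i) f) + const (t - 1) * Y i f"
proof -
  have "Y i (T i f) = const (1 / t) * T i (Y (Suc i) (const (t - 1) * T i f + const t * f))"
    by (simp only: Y_rec[OF assms] T_T)
  also have "\<dots> = const (t - 1) * Y i f + const (1 / t) * const t * T i (Y (Suc i) f)"
    by (simp only: Y_rec[OF assms, of f] Y_add Y_const_mult T_op_add T_op_const_mult) (simp only: algebra_simps)
  finally show ?thesis by (simp add: add.commute flip: const_mult)
qed

lemma Y_T_Suc:
  assumes "1 \<le> i" "i < n"
  shows "Y (Suc i) (T i f) = T i (Y i f) + const (1 - t) * Y i f"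
proof -
  have "T i (Y i f) = const (1 / t) * (const (t - 1) * T i (Y (Suc i) (T i f)) + const t * Y (Suc i) (T i f))"
    by (simp only: Y_rec[OF assms, of f] T_op_const_mult T_T)
  also have "\<dots> = const (t - 1) * Y i f + const (1 / t) * const t * Y (Suc i) (T i f)"
    by (simp only: Y_rec[OF assms, of f]) (simp only: algebra_simps)
  also have "\<dots> = const (t - 1) * Y i f + Y (Suc i) (T i f)"
    by (simp flip: const_mult)
  finally show ?thesis by (simp add: const_diff algebra_simps)
qed

text \<open>Only the summands at j and j + 1 fail to commute with T_j, and their corrections, t - 1
  and 1 - t times Y_j, cancel.\<close>

lemma sum_Y_T:
  assumes "j \<in> {1..<n}"
  shows "(\<Sum>i=1..n. Y i (T j f)) = T j (\<Sum>i=1..n. Y i f)"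
proof -
  have split: "(\<Sum>i=1..n. F i) = F j + F (Suc j) + (\<Sum>i\<in>{1..n} - {j, Suc j}. F i)" for F :: "nat \<Rightarrow> 'a mpol"
  proof -
    have "(\<Sum>i=1..n. F i) = F j + (\<Sum>i\<in>{1..n} - {j}. F i)"
      by (rule sum.remove) (use assms in auto)
    also have "(\<Sum>i\<in>{1..n} - {j}. F i) = F (Suc j) + (\<Sum>i\<in>{1..n} - {j} - {Suc j}. F i)"
      by (rule sum.remove) (use assms in auto)
    also have "{1..n} - {j} - {Suc j} = {1..n} - {j, Suc j}" by auto
    finally show ?thesis by (simp add: add.assoc)
  qed
  have "(\<Sum>i\<in>{1..n} - {j, Suc j}. Y i (T j f)) = (\<Sum>i\<in>{1..n} - {j, Suc j}. T j (Y i f))"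
    by (rule sum.cong) (use assms in \<open>auto intro!: T_Y_comm[symmetric]\<close>)
  moreover have "Y j (T j f) + Y (Suc j) (T j f) = T j (Y j f) + T j (Y (Suc j) f)"
    using assms by (simp add: Y_T_same Y_T_Suc const_diff algebra_simps)
  ultimately show ?thesis
    unfolding split T_op_add T_op_sum by (simp add: algebra_simps)
qed

lemma braid_eq_shift_word:
  "set u \<subseteq> {2..<m} \<Longrightarrow> braid_eq (u @ [1..<m]) ([1..<m] @ map (\<lambda>j. j - 1) u)"
proof (induction u)
  case (Cons j u)
  have "braid_eq (j # u @ [1..<m]) (j # [1..<m] @ map (\<lambda>j. j - 1) u)"
    using Cons by (intro braid_eq_Cons) auto
  moreover have "braid_eq ((j # [1..<m]) @ map (\<lambda>j. j - 1) u) (([1..<m] @ [j - 1]) @ map (\<lambda>j. j - 1) u)"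
    by (intro braid_eq_append2 braid_eq_shift) (use Cons.prems in auto)
  ultimately show ?case by (auto intro: braid_eq.trans)
qed (auto intro: braid_eq.refl)

text \<open>Since Y_m is T_m Y_n T_m up to a scalar (m = n - 1), the claim is that T_m Y_n T_m Y_n
  and Y_n T_m Y_n T_m agree. Both reduce to the square of the cyclic operator applied after A'
  A.\<close>

lemma Y_comm_last:
  assumes "2 \<le> n"
  shows "Y (n - 1) (Y n f) = Y n (Y (n - 1) f)"
proof -
  define m where "m = n - 1"
  then have n: "n = Suc m" "1 \<le> m" using assms by auto
  define A A' where "A = word_op Ti [1..<m]" and "A' = word_op Ti [2..<n]"
  have "[1..<n] = [1..<m] @ [m]" using n by simp
  then have Yn: "Y n g = om (A (Ti m g))" for g
    by (simp add: Y_eq A_def word_op_append word_op_Cons)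
  have "set w \<subseteq> {1..<m} \<Longrightarrow> word_op Ti w (om g) = om (word_op Ti (map Suc w) g)" for w g
    by (induction w) (auto simp: word_op_Cons om_Ti m_def)
  then have "word_op Ti [1..<m] (om g) = om (word_op Ti (map Suc [1..<m]) g)" for g
    by simp
  moreover have mS: "map Suc [1..<m] = [2..<n]" by (simp add: map_Suc_upt n numeral_2_eq_2)
  ultimately have Aom: "A (om g) = om (A' g)" for g by (simp add: A_def A'_def)
  \<comment> \<open>Moves the trailing inverse of T_m through A' A, where it becomes the inverse of
    T_1; two cyclic shifts turn it back into the inverse of T_m.\<close>
  have "braid_eq ([2..<n] @ [1..<n]) ([1..<n] @ map (\<lambda>j. j - 1) [2..<n])"
    by (rule braid_eq_shift_word) auto
  moreover have "map (\<lambda>j. j - 1) [2..<n] = [1..<m]"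
    unfolding mS[symmetric] by (simp add: comp_def)
  moreover have "[1..<n] = [1..<m] @ [m]" using n by simp
  moreover have "[1..<n] = 1 # [2..<n]" using assms by (simp add: upt_conv_Cons numeral_2_eq_2)
  ultimately have "braid_eq ([2..<n] @ [1..<m] @ [m]) (1 # [2..<n] @ [1..<m])" by (metis append_Cons)
  then have "word_op Ti ([2..<n] @ [1..<m] @ [m]) g = word_op Ti (1 # [2..<n] @ [1..<m]) g" for g
    by (simp add: Ti.word_op_braid_eq)
  then have "A' (A (Ti m g)) = Ti 1 (A' (A g))" for g
    by (simp add: word_op_append word_op_Cons A_def A'_def)
  then have AT: "om (om (A' (A (Ti m g)))) = Ti m (om (om (A' (A g))))" for g
    using om_om_Ti[OF assms] by (simp add: m_def)
  have "T m (Y n (T m (Y n f))) = Y n (T m (Y n (T m f)))"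
    by (simp add: Yn Aom AT)
  moreover have "Y m g = const (1 / t) * T m (Y n (T m g))" for g
    using Y_rec[of m g] n by simp
  ultimately show ?thesis
    by (simp only: m_def[symmetric] Y_const_mult)
qed

text \<open>Downward induction on j from n - 1. By \<open>Y_rec\<close>, Y_(j+1) is built from
  T_(j+1) and Y_(j+2). Y_j commutes with the former by \<open>T_Y_comm\<close>, and with the latter
  because Y_j is itself built from T_j and Y_(j+1), which commute with Y_(j+2).\<close>

lemma Y_comm_Suc: "1 \<le> j \<Longrightarrow> j < n \<Longrightarrow> Y j (Y (Suc j) f) = Y (Suc j) (Y j f)"
proof (induction "n - j" arbitrary: j f)
  case (Suc d)
  show ?case
  proof (cases "Suc j = n")
    case True
    then show ?thesis using Y_comm_last[of f] Suc.prems by auto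
  next
    case False
    let ?k = "Suc j"
    have IH: "Y ?k (Y (Suc ?k) g) = Y (Suc ?k) (Y ?k g)" for g
      by (rule Suc.hyps(1)) (use Suc False in auto)
    have 1: "T j (Y (Suc ?k) g) = Y (Suc ?k) (T j g)" for g
      by (rule T_Y_comm) (use Suc False in auto)
    have 2: "T ?k (Y j g) = Y j (T ?k g)" for g
      by (rule T_Y_comm) (use Suc False in auto)
    have 3: "Y j (Y (Suc ?k) g) = Y (Suc ?k) (Y j g)" for g
      using Suc False by (simp add: Y_rec[of j] 1 IH Y_const_mult)
    have "Y ?k (Y j f) = const (1 / t) * T ?k (Y (Suc ?k) (T ?k (Y j f)))"
      by (rule Y_rec) (use Suc False in auto)
    also have "\<dots> = const (1 / t) * Y j (T ?k (Y (Suc ?k) (T ?k f)))"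
      by (simp add: 2 3[symmetric])
    also have "\<dots> = Y j (const (1 / t) * T ?k (Y (Suc ?k) (T ?k f)))"
      by (simp add: Y_const_mult)
    also have "const (1 / t) * T ?k (Y (Suc ?k) (T ?k f)) = Y ?k f"
      by (rule Y_rec[symmetric]) (use Suc False in auto)
    finally show ?thesis ..
  qed
qed auto

lemma Y_comm_less: "1 \<le> i \<Longrightarrow> i < j \<Longrightarrow> j \<le> n \<Longrightarrow> Y i (Y j f) = Y j (Y i f)"
proof (induction "j - i" arbitrary: i f)
  case (Suc d)
  show ?case
  proof (cases "Suc i = j")
    case True
    then show ?thesis using Y_comm_Suc[of i f] Suc.prems by auto
  next
    case False
    have IH: "Y (Suc i) (Y j g) = Y j (Y (Suc i) g)" for g
      by (rule Suc.hyps(1)) (use Suc False in auto)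
    have 1: "T i (Y j g) = Y j (T i g)" for g
      by (rule T_Y_comm) (use Suc False in auto)
    show ?thesis
      using Suc False by (simp add: Y_rec[of i] 1 IH Y_const_mult)
  qed
qed auto

lemma Y_comm: "i \<in> {1..n} \<Longrightarrow> j \<in> {1..n} \<Longrightarrow> Y i (Y j f) = Y j (Y i f)"
  using Y_comm_less[of i j] Y_comm_less[of j i] by (cases i j rule: linorder_cases) auto

end

section \<open>Triangularity of the operators\<close>

abbreviation lk :: "expo \<Rightarrow> nat \<Rightarrow> nat" where
  "lk \<equiv> Poly_Mapping.lookup"

section \<open>Rearrangements and orders on compositions\<close>

lemma composition_lk: "composition n \<nu> \<longleftrightarrow> (\<forall>k. k \<notin> {1..n} \<longrightarrow> lk \<nu> k = 0)"
  by (auto simp: composition_def in_keys_iff)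

lemma composition_eqI:
  assumes "composition n \<mu>" "composition n \<nu>" "\<And>k. k \<in> {1..n} \<Longrightarrow> lk \<mu> k = lk \<nu> k"
  shows "\<mu> = \<nu>"
  using assms unfolding composition_lk by (intro poly_mapping_eqI) metis

lemma is_permutation_of_refl: "is_permutation_of n \<mu> \<mu>"
  unfolding is_permutation_of_def by (intro exI[of _ id]) (auto simp: permutes_id)

lemma is_permutation_of_sym:
  assumes "is_permutation_of n \<mu> \<nu>"
  shows "is_permutation_of n \<nu> \<mu>"
proof -
  obtain \<pi> where p: "\<pi> permutes {1..n}" "\<forall>i\<in>{1..n}. lk \<mu> i = lk \<nu> (\<pi> i)"
    using assms by (auto simp: is_permutation_of_def)
  have "lk \<nu> i = lk \<mu> (inv \<pi> i)" if "i \<in> {1..n}" for i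
    using that p(2) permutes_in_image[OF permutes_inv[OF p(1)], of i] by (simp add: permutes_inverses[OF p(1)])
  then show ?thesis
    using permutes_inv[OF p(1)] unfolding is_permutation_of_def by blast
qed

lemma is_permutation_of_trans:
  assumes "is_permutation_of n \<mu> \<nu>" "is_permutation_of n \<nu> \<xi>"
  shows "is_permutation_of n \<mu> \<xi>"
proof -
  obtain \<pi> where p: "\<pi> permutes {1..n}" "\<forall>i\<in>{1..n}. lk \<mu> i = lk \<nu> (\<pi> i)"
    using assms(1) by (auto simp: is_permutation_of_def)
  obtain \<rho> where r: "\<rho> permutes {1..n}" "\<forall>i\<in>{1..n}. lk \<nu> i = lk \<xi> (\<rho> i)"
    using assms(2) by (auto simp: is_permutation_of_def)
  have "lk \<mu> i = lk \<xi> ((\<rho> \<circ> \<pi>) i)" if "i \<in> {1..n}" for i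
    using that p r permutes_in_image[OF p(1), of i] by simp
  then show ?thesis
    using permutes_compose[OF p(1) r(1)] unfolding is_permutation_of_def by blast
qed

lemma is_permutation_of_sum:
  assumes "is_permutation_of n \<mu> \<nu>"
  shows "(\<Sum>i=1..n. f (lk \<mu> i)) = (\<Sum>i=1..n. f (lk \<nu> i))"
proof -
  obtain \<pi> where p: "\<pi> permutes {1..n}" "\<forall>i\<in>{1..n}. lk \<mu> i = lk \<nu> (\<pi> i)"
    using assms by (auto simp: is_permutation_of_def)
  have "(\<Sum>i=1..n. f (lk \<nu> i)) = (\<Sum>i=1..n. f (lk \<nu> (\<pi> i)))"
    using sum.permute[OF p(1), of "\<lambda>i. f (lk \<nu> i)"] by (simp add: comp_def)
  then show ?thesis using p(2) by simp
qed

definition sumsq :: "nat \<Rightarrow> expo \<Rightarrow> nat" where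
  "sumsq n \<nu> = (\<Sum>i=1..n. (lk \<nu> i)^2)"

text \<open>Dominance of the sorted sequences without sorting: the sum of the p largest entries is
  the maximum over subsets of size p.\<close>

definition subset_dom :: "nat \<Rightarrow> expo \<Rightarrow> expo \<Rightarrow> bool" where
  "subset_dom n \<nu> \<eta> \<longleftrightarrow> (\<forall>A\<subseteq>{1..n}. \<exists>B\<subseteq>{1..n}. card B = card A \<and> sum (lk \<nu>) A \<le> sum (lk \<eta>) B)"

text \<open>
  \<open>lower n \<nu> \<eta>\<close> implies that the partition of \<open>\<nu>\<close> lies strictly below that of \<open>\<eta>\<close>, without
  mentioning sorting; strictness is measured by the sum of squares.
\<close>

definition lower :: "nat \<Rightarrow> expo \<Rightarrow> expo \<Rightarrow> bool" where
  "lower n \<nu> \<eta> \<longleftrightarrow> composition n \<nu> \<and> modulus n \<nu> = modulus n \<eta> \<and> sumsq n \<nu> < sumsq n \<eta> \<and> subset_dom n \<nu> \<eta>"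

lemma subset_dom_trans: "subset_dom n \<mu> \<nu> \<Longrightarrow> subset_dom n \<nu> \<xi> \<Longrightarrow> subset_dom n \<mu> \<xi>"
  unfolding subset_dom_def
proof (intro allI impI)
  fix A
  assume 1: "\<forall>A\<subseteq>{1..n}. \<exists>B\<subseteq>{1..n}. card B = card A \<and> sum (lk \<mu>) A \<le> sum (lk \<nu>) B"
    and 2: "\<forall>A\<subseteq>{1..n}. \<exists>B\<subseteq>{1..n}. card B = card A \<and> sum (lk \<nu>) A \<le> sum (lk \<xi>) B"
    and A: "A \<subseteq> {1..n}"
  obtain B where B: "B \<subseteq> {1..n}" "card B = card A" "sum (lk \<mu>) A \<le> sum (lk \<nu>) B"
    using 1[rule_format, OF A] by auto
  obtain C where C: "C \<subseteq> {1..n}" "card C = card B" "sum (lk \<nu>) B \<le> sum (lk \<xi>) C"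
    using 2[rule_format, OF B(1)] by auto
  show "\<exists>B\<subseteq>{1..n}. card B = card A \<and> sum (lk \<mu>) A \<le> sum (lk \<xi>) B"
    by (intro exI[of _ C]) (use B C in simp)
qed

lemma subset_dom_perm:
  assumes "is_permutation_of n \<mu> \<nu>"
  shows "subset_dom n \<mu> \<nu>"
  unfolding subset_dom_def
proof (intro allI impI)
  fix A assume A: "A \<subseteq> {1..n}"
  obtain \<pi> where p: "\<pi> permutes {1..n}" "\<forall>i\<in>{1..n}. lk \<mu> i = lk \<nu> (\<pi> i)"
    using assms by (auto simp: is_permutation_of_def)
  have inj: "inj_on \<pi> A" using permutes_inj[OF p(1)] by (rule inj_on_subset) simp
  have "sum (lk \<nu>) (\<pi> ` A) = (\<Sum>i\<in>A. lk \<nu> (\<pi> i))" by (simp add: sum.reindex[OF inj])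
  also have "\<dots> = sum (lk \<mu>) A" using p(2) A by (intro sum.cong) auto
  finally have "sum (lk \<mu>) A \<le> sum (lk \<nu>) (\<pi> ` A)" by simp
  moreover have "\<pi> ` A \<subseteq> {1..n}" using permutes_image[OF p(1)] A by blast
  ultimately show "\<exists>B\<subseteq>{1..n}. card B = card A \<and> sum (lk \<mu>) A \<le> sum (lk \<nu>) B"
    using card_image[OF inj] by (intro exI[of _ "\<pi> ` A"]) simp
qed

lemma lower_trans: "lower n \<mu> \<nu> \<Longrightarrow> lower n \<nu> \<xi> \<Longrightarrow> lower n \<mu> \<xi>"
  unfolding lower_def by (auto intro: subset_dom_trans)

lemma perm_invariants:
  assumes "is_permutation_of n \<mu> \<nu>"
  shows "modulus n \<mu> = modulus n \<nu>" "sumsq n \<mu> = sumsq n \<nu>"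
  using is_permutation_of_sum[OF assms, of "\<lambda>x. x"] is_permutation_of_sum[OF assms, of "\<lambda>x. x^2"]
  by (simp_all add: modulus_def sumsq_def)

lemma lower_perm1:
  assumes "is_permutation_of n \<mu> \<nu>" "composition n \<mu>" "lower n \<nu> \<xi>"
  shows "lower n \<mu> \<xi>"
  using assms(2,3) subset_dom_trans[OF subset_dom_perm[OF assms(1)]]
  by (simp add: lower_def perm_invariants[OF assms(1)])

lemma lower_perm2:
  assumes "lower n \<mu> \<nu>" "is_permutation_of n \<nu> \<xi>"
  shows "lower n \<mu> \<xi>"
  using assms(1) subset_dom_trans[OF _ subset_dom_perm[OF assms(2)]]
  by (simp add: lower_def perm_invariants[OF assms(2)])

lemma sum_split2:
  fixes F :: "'b \<Rightarrow> 'c::comm_monoid_add"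
  assumes "finite A" "i \<in> A" "j \<in> A" "i \<noteq> j"
  shows "sum F A = F i + (F j + sum F (A - {i, j}))"
proof -
  have "sum F A = F i + sum F (A - {i})" by (rule sum.remove) (use assms in auto)
  also have "sum F (A - {i}) = F j + sum F (A - {i} - {j})" by (rule sum.remove) (use assms in auto)
  also have "A - {i} - {j} = A - {i, j}" by auto
  finally show ?thesis .
qed

definition set2 :: "expo \<Rightarrow> nat \<Rightarrow> nat \<Rightarrow> nat \<Rightarrow> expo" where
  "set2 \<nu> i x y = Poly_Mapping.update i x (Poly_Mapping.update (Suc i) y \<nu>)"

lemma lk_set2 [simp]: "lk (set2 \<nu> i x y) k = (if k = i then x else if k = Suc i then y else lk \<nu> k)"
  by (simp add: set2_def lookup_update)

definition sw :: "nat \<Rightarrow> expo \<Rightarrow> expo" where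
  "sw i \<nu> = set2 \<nu> i (lk \<nu> (Suc i)) (lk \<nu> i)"

lemma lk_sw: "lk (sw i \<nu>) k = lk \<nu> (transpose i (Suc i) k)"
  by (simp add: sw_def transpose_def)

lemma sw_sw [simp]: "sw i (sw i \<nu>) = \<nu>"
  by (rule poly_mapping_eqI) (simp add: lk_sw)

lemma composition_set2: "composition n \<nu> \<Longrightarrow> i \<in> {1..<n} \<Longrightarrow> composition n (set2 \<nu> i x y)"
  by (auto simp: composition_lk)

lemma composition_sw: "composition n \<nu> \<Longrightarrow> i \<in> {1..<n} \<Longrightarrow> composition n (sw i \<nu>)"
  by (simp add: sw_def composition_set2)

lemma is_permutation_of_sw: "i \<in> {1..<n} \<Longrightarrow> is_permutation_of n (sw i \<nu>) \<nu>"
  unfolding is_permutation_of_def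
  by (intro exI[of _ "transpose i (Suc i)"]) (auto simp: lk_sw intro!: permutes_swap_id)

lemma sw_eq: "lk \<nu> i = lk \<nu> (Suc i) \<Longrightarrow> sw i \<nu> = \<nu>"
  by (rule poly_mapping_eqI) (simp add: sw_def)

text \<open>Two entries move closer together with fixed sum. If a is the larger old entry and b the
  other, then a^2 + b^2 - x^2 - y^2 = 2 (x - a) (y - a) > 0. A subset holding just one of the two
  places is compared with the one holding the place \<open>M\<close> of the larger entry
  instead.\<close>

lemma lower_set2:
  assumes \<nu>: "composition n \<nu>" and i: "i \<in> {1..<n}" and xy: "x + y = lk \<nu> i + lk \<nu> (Suc i)"
    and m: "x < max (lk \<nu> i) (lk \<nu> (Suc i))" "y < max (lk \<nu> i) (lk \<nu> (Suc i))"
  shows "lower n (set2 \<nu> i x y) \<nu>"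
proof -
  let ?\<nu> = "set2 \<nu> i x y"
  have s: "(\<Sum>k=1..n. f (lk ?\<nu> k)) = f x + (f y + (\<Sum>k\<in>{1..n} - {i, Suc i}. f (lk \<nu> k)))"
    and s': "(\<Sum>k=1..n. f (lk \<nu> k)) = f (lk \<nu> i) + (f (lk \<nu> (Suc i)) + (\<Sum>k\<in>{1..n} - {i, Suc i}. f (lk \<nu> k)))"
    for f :: "nat \<Rightarrow> nat"
    using i by (simp_all add: sum_split2[of _ i "Suc i"])
  have sq: "x^2 + y^2 < (lk \<nu> i)^2 + (lk \<nu> (Suc i))^2"
  proof -
    have *: "x^2 + y^2 < a^2 + b^2" if "x + y = a + b" "x < a" "y < a" for x y a b :: nat
    proof -
      have "int x + int y = int a + int b" "int x < int a" "int y < int a"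
        using that by linarith+
      then have "(int x - int a) * (int y - int a) > 0" "int b = int x + int y - int a"
        by (auto intro: mult_neg_neg)
      moreover from this(2) have "int a ^ 2 + int b ^ 2 = int x ^ 2 + int y ^ 2 + 2 * ((int x - int a) * (int y - int a))"
        by (simp only:) (simp add: power2_eq_square algebra_simps)
      ultimately have "int x ^ 2 + int y ^ 2 < int a ^ 2 + int b ^ 2"
        by linarith
      then have "int (x^2 + y^2) < int (a^2 + b^2)" by simp
      then show ?thesis by linarith
    qed
    show ?thesis
      using m xy *[of x y "lk \<nu> i" "lk \<nu> (Suc i)"] *[of x y "lk \<nu> (Suc i)" "lk \<nu> i"]
      by (cases "lk \<nu> i \<le> lk \<nu> (Suc i)") (auto simp: max_def)
  qed
  have "subset_dom n ?\<nu> \<nu>"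
    unfolding subset_dom_def
  proof (intro allI impI)
    fix A assume A: "A \<subseteq> {1..n}"
    then have fin: "finite A" by (rule finite_subset) simp
    define C where "C = A - {i, Suc i}"
    have C: "sum (lk ?\<nu>) C = sum (lk \<nu>) C" by (rule sum.cong) (auto simp: C_def)
    have finC: "finite C" "i \<notin> C" "Suc i \<notin> C" using fin by (auto simp: C_def)
    define M where "M = (if lk \<nu> i \<ge> lk \<nu> (Suc i) then i else Suc i)"
    have M: "x \<le> lk \<nu> M" "y \<le> lk \<nu> M" "M \<in> {1..n}" "M \<notin> C" using m i finC by (auto simp: M_def max_def split: if_splits)
    consider "i \<in> A \<and> Suc i \<in> A" | "i \<notin> A \<and> Suc i \<notin> A" | "A = insert i C" | "A = insert (Suc i) C"
      by (auto simp: C_def)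
    then show "\<exists>B\<subseteq>{1..n}. card B = card A \<and> sum (lk ?\<nu>) A \<le> sum (lk \<nu>) B"
    proof cases
      case 1
      then have "sum (lk ?\<nu>) A = sum (lk \<nu>) A"
        using xy C fin by (simp add: sum_split2[of A i "Suc i"] C_def)
      then show ?thesis using A by auto
    next
      case 2
      then have "A = C" by (auto simp: C_def)
      then show ?thesis using A C by auto
    next
      case 3
      then have "sum (lk ?\<nu>) A \<le> sum (lk \<nu>) (insert M C)" "card (insert M C) = card A"
        using finC C M by simp_all
      moreover have "insert M C \<subseteq> {1..n}" using A 3 M by auto
      ultimately show ?thesis by blast
    next
      case 4
      then have "sum (lk ?\<nu>) A \<le> sum (lk \<nu>) (insert M C)" "card (insert M C) = card A"
        using finC C M by simp_all
      moreover have "insert M C \<subseteq> {1..n}" using A 4 M by auto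
      ultimately show ?thesis by blast
    qed
  qed
  then show ?thesis
    using sq xy s[of "\<lambda>x. x"] s'[of "\<lambda>x. x"] s[of "\<lambda>x. x^2"] s'[of "\<lambda>x. x^2"] composition_set2[OF \<nu> i]
    unfolding lower_def modulus_def sumsq_def by simp
qed

text \<open>Strictly monotone for dominance on compositions of equal modulus, hence a measure for
  that order.\<close>

definition weight :: "nat \<Rightarrow> expo \<Rightarrow> int" where
  "weight n \<nu> = (\<Sum>p=1..n. \<Sum>i=1..p. int (lk \<nu> i))"

lemma dominance_less_iff:
  "dominance_less n \<mu> \<eta> \<longleftrightarrow> modulus n \<mu> = modulus n \<eta> \<and> \<mu> \<noteq> \<eta> \<and>
     (\<forall>p\<in>{1..n}. (\<Sum>i=1..p. lk \<mu> i) \<le> (\<Sum>i=1..p. lk \<eta> i))"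
  by (simp add: dominance_less_def sum_subtractf flip: of_nat_sum)

lemma prefix_sums_eqI:
  assumes "composition n \<mu>" "composition n \<nu>" "\<And>p. p \<in> {1..n} \<Longrightarrow> (\<Sum>i=1..p. lk \<mu> i) = (\<Sum>i=1..p. lk \<nu> i)"
  shows "\<mu> = \<nu>"
proof (rule composition_eqI[OF assms(1,2)])
  fix k assume k: "k \<in> {1..n}"
  then obtain j where j: "k = Suc j" by (cases k) auto
  have "(\<Sum>i=1..j. lk \<mu> i) = (\<Sum>i=1..j. lk \<nu> i)"
    using assms(3)[of j] k j by (cases "j = 0") auto
  then show "lk \<mu> k = lk \<nu> k" using assms(3)[OF k] j by simp
qed

lemma dominance_less_weight:
  assumes "dominance_less n \<mu> \<eta>" "composition n \<mu>" "composition n \<eta>"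
  shows "weight n \<mu> < weight n \<eta>"
proof (rule ccontr)
  let ?F = "\<lambda>\<nu> p. \<Sum>i=1..p. int (lk \<nu> i)"
  assume "\<not> ?thesis"
  moreover have le: "?F \<mu> p \<le> ?F \<eta> p" if "p \<in> {1..n}" for p
    using assms(1) that by (auto simp: dominance_less_iff simp flip: of_nat_sum)
  ultimately have "(\<Sum>p=1..n. ?F \<eta> p - ?F \<mu> p) = 0"
    using sum_mono[of "{1..n}" "?F \<mu>" "?F \<eta>"] by (simp add: weight_def sum_subtractf)
  then have "\<forall>p\<in>{1..n}. ?F \<eta> p - ?F \<mu> p = 0"
    using le by (subst (asm) sum_nonneg_eq_0_iff) auto
  then have "\<mu> = \<eta>" by (intro prefix_sums_eqI[OF assms(2,3)]) (simp flip: of_nat_sum)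
  then show False using assms(1) by (simp add: dominance_less_def)
qed

lemma dominance_less_trans:
  assumes "dominance_less n \<mu> \<nu>" "dominance_less n \<nu> \<xi>" "composition n \<mu>" "composition n \<nu>" "composition n \<xi>"
  shows "dominance_less n \<mu> \<xi>"
proof -
  have "\<mu> \<noteq> \<xi>"
    using dominance_less_weight[OF assms(1,3,4)] dominance_less_weight[OF assms(2,4,5)] by auto
  then show ?thesis
    using assms(1,2) unfolding dominance_less_iff by (auto intro: order_trans)
qed

text \<open>Works in place of \<open>prec\<close>, which it implies (\<open>below_prec\<close>). Sum
  of squares, then \<open>weight\<close>, is a lexicographic measure for it, so it is irreflexive
  and well-founded.\<close>

definition below :: "nat \<Rightarrow> expo \<Rightarrow> expo \<Rightarrow> bool" where
  "below n \<nu> \<eta> \<longleftrightarrow> composition n \<nu> \<and> composition n \<eta> \<and>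
     (lower n \<nu> \<eta> \<or> is_permutation_of n \<nu> \<eta> \<and> dominance_less n \<nu> \<eta>)"

lemma below_trans: "below n \<mu> \<nu> \<Longrightarrow> below n \<nu> \<xi> \<Longrightarrow> below n \<mu> \<xi>"
  unfolding below_def
  by (elim conjE disjE)
     (auto intro: lower_trans lower_perm1 lower_perm2 is_permutation_of_trans dominance_less_trans)

lemma below_measure:
  assumes "below n \<nu> \<eta>"
  shows "sumsq n \<nu> < sumsq n \<eta> \<or> sumsq n \<nu> = sumsq n \<eta> \<and> nat (weight n \<nu>) < nat (weight n \<eta>)"
proof -
  have "0 \<le> weight n \<nu>" by (simp add: weight_def sum_nonneg)
  then show ?thesis
    using assms perm_invariants(2)[of n \<nu> \<eta>] dominance_less_weight[of n \<nu> \<eta>]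
    by (auto simp: below_def lower_def)
qed

lemma wf_below: "wf {(\<nu>, \<eta>). below n \<nu> \<eta>}"
proof (rule wf_subset)
  show "wf (measures [sumsq n, \<lambda>\<nu>. nat (weight n \<nu>)])" by simp
  show "{(\<nu>, \<eta>). below n \<nu> \<eta>} \<subseteq> measures [sumsq n, \<lambda>\<nu>. nat (weight n \<nu>)]"
    using below_measure by auto
qed

lemma below_irrefl: "\<not> below n \<nu> \<nu>"
  using below_measure[of n \<nu> \<nu>] by auto

text \<open>Elements of B outside 1..p are traded for the equally many missing elements of 1..p; the
  entry at p separates the two kinds.\<close>

lemma partition_sum_le:
  assumes "is_partition n \<kappa>" "B \<subseteq> {1..n}"
  shows "sum (lk \<kappa>) B \<le> (\<Sum>i=1..card B. lk \<kappa> i)"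
proof (cases "card B = 0")
  case True
  then show ?thesis using assms finite_subset[OF assms(2)] by auto
next
  case False
  define p A where "p = card B" and "A = {1..p}"
  have fin: "finite B" "finite A" using assms(2) finite_subset by (auto simp: A_def)
  have p: "1 \<le> p" "p \<le> n" using False card_mono[OF _ assms(2)] by (auto simp: p_def)
  have mono: "lk \<kappa> j \<le> lk \<kappa> i" if "1 \<le> i" "i \<le> j" "j \<le> n" for i j
    using assms(1) that by (auto simp: is_partition_def)
  have "card (B - A) = card (A - B)"
    using card_Diff_subset_Int[of B A] card_Diff_subset_Int[of A B] fin
    by (simp add: Int_commute A_def p_def)
  moreover have "lk \<kappa> k \<le> lk \<kappa> p" if "k \<in> B - A" for k
    using that assms(2) p by (intro mono) (auto simp: A_def)
  ultimately have "sum (lk \<kappa>) (B - A) \<le> of_nat (card (A - B)) * lk \<kappa> p"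
    using sum_bounded_above[of "B - A" "lk \<kappa>" "lk \<kappa> p"] by simp
  also have "\<dots> \<le> sum (lk \<kappa>) (A - B)"
    by (rule sum_bounded_below) (use p mono in \<open>auto simp: A_def\<close>)
  finally have "sum (lk \<kappa>) (B \<inter> A) + sum (lk \<kappa>) (B - A) \<le> sum (lk \<kappa>) (A \<inter> B) + sum (lk \<kappa>) (A - B)"
    by (simp add: Int_commute)
  then show ?thesis
    using sum.Int_Diff[of B "lk \<kappa>" A] sum.Int_Diff[of A "lk \<kappa>" B] fin by (simp add: A_def p_def)
qed

lemma subset_dom_prefix:
  assumes "subset_dom n \<nu> \<kappa>" "is_partition n \<kappa>" "p \<le> n"
  shows "(\<Sum>i=1..p. lk \<nu> i) \<le> (\<Sum>i=1..p. lk \<kappa> i)"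
proof -
  have "{1..p} \<subseteq> {1..n}" using assms(3) by auto
  then obtain B where B: "B \<subseteq> {1..n}" "card B = p" "sum (lk \<nu>) {1..p} \<le> sum (lk \<kappa>) B"
    using assms(1)[unfolded subset_dom_def, rule_format, of "{1..p}"] by auto
  then show ?thesis using partition_sum_le[OF assms(2) B(1)] by simp
qed

lemma partition_perm_unique:
  assumes "is_partition n \<kappa>" "is_partition n \<xi>" "is_permutation_of n \<kappa> \<xi>"
  shows "\<kappa> = \<xi>"
proof (rule prefix_sums_eqI[of n])
  show "composition n \<kappa>" "composition n \<xi>" using assms by (auto simp: is_partition_def)
  fix p assume "p \<in> {1..n}"
  then show "(\<Sum>i=1..p. lk \<kappa> i) = (\<Sum>i=1..p. lk \<xi> i)"
    using assms is_permutation_of_sym[OF assms(3)] by (intro antisym subset_dom_prefix subset_dom_perm) auto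
qed

lemma weight_sw:
  assumes "i \<in> {1..<n}" "lk \<nu> i < lk \<nu> (Suc i)" "composition n \<nu>"
  shows "weight n \<nu> < weight n (sw i \<nu>)"
proof (rule dominance_less_weight)
  have "(\<Sum>k=1..p. lk \<nu> k) \<le> (\<Sum>k=1..p. lk (sw i \<nu>) k)" for p
  proof -
    consider "p < i" | "p = i" | "i < p" by linarith
    then show ?thesis
    proof cases
      case 1
      then show ?thesis by (intro sum_mono) (auto simp: sw_def)
    next
      case 2
      then show ?thesis using assms(2) by (intro sum_mono) (auto simp: sw_def)
    next
      case 3
      then have "(\<Sum>k\<in>{1..p} - {i, Suc i}. lk (sw i \<nu>) k) = (\<Sum>k\<in>{1..p} - {i, Suc i}. lk \<nu> k)"
        by (intro sum.cong) (auto simp: sw_def)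
      then show ?thesis
        using 3 assms(1) by (simp add: sum_split2[of _ i "Suc i"]) (simp add: sw_def)
    qed
  qed
  then show "dominance_less n \<nu> (sw i \<nu>)"
    using perm_invariants(1)[OF is_permutation_of_sw[OF assms(1), of \<nu>]] assms(2)
    by (auto simp: dominance_less_iff sw_def dest!: arg_cong[of _ _ "\<lambda>\<nu>. lk \<nu> i"])
qed (use assms composition_sw in auto)

text \<open>A rearrangement of maximal weight is sorted, because exchanging an ascent raises the
  weight (\<open>weight_sw\<close>).\<close>

lemma partition_exists:
  assumes "composition n \<eta>"
  shows "\<exists>\<kappa>. is_partition n \<kappa> \<and> is_permutation_of n \<kappa> \<eta>"
proof -
  let ?P = "\<lambda>\<mu>. composition n \<mu> \<and> is_permutation_of n \<mu> \<eta>"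
  have bound0: "weight n \<mu> \<le> int (n * modulus n \<eta>)" if "?P \<mu>" for \<mu>
  proof -
    have "(\<Sum>i=1..p. int (lk \<mu> i)) \<le> int (modulus n \<mu>)" if "p \<in> {1..n}" for p
      unfolding modulus_def of_nat_sum by (rule sum_mono2) (use that in auto)
    then have "weight n \<mu> \<le> of_nat (card {1..n}) * int (modulus n \<mu>)"
      unfolding weight_def by (rule sum_bounded_above)
    also have "\<dots> = int (n * modulus n \<eta>)" using perm_invariants(1)[of n \<mu> \<eta>] that by simp
    finally show ?thesis .
  qed
  have bound: "nat (weight n \<mu>) < Suc (n * modulus n \<eta>)" if "?P \<mu>" for \<mu>
    using bound0[OF that] by linarith
  have \<eta>: "?P \<eta>" using assms is_permutation_of_refl by simp
  obtain \<kappa> where \<kappa>: "?P \<kappa>" "\<And>\<mu>. ?P \<mu> \<Longrightarrow> nat (weight n \<mu>) \<le> nat (weight n \<kappa>)"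
    using ex_has_greatest_nat[of ?P, OF \<eta>, of "\<lambda>\<mu>. nat (weight n \<mu>)" "Suc (n * modulus n \<eta>)"] bound by blast
  have nonneg: "0 \<le> weight n \<nu>" for \<nu> by (simp add: weight_def sum_nonneg)
  have adj: "lk \<kappa> (Suc i) \<le> lk \<kappa> i" if i: "i \<in> {1..<n}" for i
  proof (rule ccontr)
    assume "\<not> ?thesis"
    then have "weight n \<kappa> < weight n (sw i \<kappa>)" using weight_sw[OF i] \<kappa>(1) by auto
    moreover have "?P (sw i \<kappa>)"
      using \<kappa>(1) composition_sw[OF _ i] is_permutation_of_trans[OF is_permutation_of_sw[OF i]] by blast
    ultimately show False using \<kappa>(2)[of "sw i \<kappa>"] nonneg[of \<kappa>] by auto
  qed
  have "lk \<kappa> j \<le> lk \<kappa> i" if "1 \<le> i" "i \<le> j" "j \<le> n" for i j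
    using that(2,3)
  proof (induction j rule: dec_induct)
    case (step k)
    then show ?case using adj[of k] that(1) by auto
  qed simp
  then have "is_partition n \<kappa>" using \<kappa>(1) by (auto simp: is_partition_def)
  then show ?thesis using \<kappa>(1) by blast
qed

lemma plus_part:
  assumes "composition n \<eta>"
  shows "is_partition n (plus_part n \<eta>)" "is_permutation_of n (plus_part n \<eta>) \<eta>"
proof -
  have "\<exists>!\<kappa>. is_partition n \<kappa> \<and> is_permutation_of n \<kappa> \<eta>"
  proof (rule ex_ex1I[OF partition_exists[OF assms]])
    fix \<kappa> \<mu>
    assume *: "is_partition n \<kappa> \<and> is_permutation_of n \<kappa> \<eta>" "is_partition n \<mu> \<and> is_permutation_of n \<mu> \<eta>"
    then have "is_permutation_of n \<kappa> \<mu>"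
      by (meson is_permutation_of_sym is_permutation_of_trans)
    then show "\<kappa> = \<mu>" using * partition_perm_unique[of n \<kappa> \<mu>] by simp
  qed
  from theI'[OF this] show "is_partition n (plus_part n \<eta>)" "is_permutation_of n (plus_part n \<eta>) \<eta>"
    by (auto simp: plus_part_def)
qed

lemma below_prec:
  assumes "below n \<nu> \<eta>"
  shows "prec n \<nu> \<eta>"
proof -
  have c: "composition n \<nu>" "composition n \<eta>" using assms by (auto simp: below_def)
  note pn = plus_part[OF c(1)] and pe = plus_part[OF c(2)]
  from assms consider "lower n \<nu> \<eta>" | "is_permutation_of n \<nu> \<eta>" "dominance_less n \<nu> \<eta>" by (auto simp: below_def)
  then show ?thesis
  proof cases
    case 1
    have "lower n (plus_part n \<nu>) (plus_part n \<eta>)"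
      using lower_perm2[OF lower_perm1[OF pn(2) _ 1] is_permutation_of_sym[OF pe(2)]] pn(1)
      by (simp add: is_partition_def)
    then have "dominance_less n (plus_part n \<nu>) (plus_part n \<eta>)"
      using subset_dom_prefix[OF _ pe(1)] by (auto simp: lower_def dominance_less_iff)
    then show ?thesis by (simp add: prec_def)
  next
    case 2
    have "is_permutation_of n (plus_part n \<nu>) (plus_part n \<eta>)"
      by (rule is_permutation_of_trans[OF is_permutation_of_trans[OF pn(2) 2(1)] is_permutation_of_sym[OF pe(2)]])
    then have "plus_part n \<nu> = plus_part n \<eta>"
      by (rule partition_perm_unique[OF pn(1) pe(1)])
    then show ?thesis using 2 by (simp add: prec_def)
  qed
qed

section \<open>Action of T_i and of the cyclic operator on monomials\<close>

lemma mon_set2: "mon (set2 \<nu> i x y) = mon (set2 \<nu> i 0 0) * (var i ^ x * var (Suc i) ^ y)"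
proof -
  have "set2 \<nu> i x y = set2 \<nu> i 0 0 + (Poly_Mapping.single i x + Poly_Mapping.single (Suc i) y)"
    by (rule poly_mapping_eqI) (simp add: lookup_add lookup_single when_def)
  then show ?thesis by (simp add: mon_add var_power)
qed

lemma set2_self: "set2 \<nu> i (lk \<nu> i) (lk \<nu> (Suc i)) = \<nu>"
  by (rule poly_mapping_eqI) simp

lemma pmon_var: "pmon var \<alpha> = (mon \<alpha> :: 'a::field mpol)"
  using psubst_single[of var \<alpha> "1::'a"] by (simp add: psubst_var_id)

lemma swap_op_mon_fixed: "swap_op i (mon (set2 \<nu> i 0 0)) = mon (set2 \<nu> i 0 0)"
proof -
  have "pmon (\<lambda>j. var (transpose i (Suc i) j)) (set2 \<nu> i 0 0) = pmon var (set2 \<nu> i 0 0)"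
    unfolding pmon_def by (rule prod.cong) (auto simp: in_keys_iff transpose_def)
  then show ?thesis by (simp add: swap_op_def psubst_single pmon_var)
qed

lemma swap_op_mon: "swap_op i (mon \<nu>) = mon (sw i \<nu>)"
proof -
  have "swap_op i (mon (set2 \<nu> i (lk \<nu> i) (lk \<nu> (Suc i)))) = mon (set2 \<nu> i (lk \<nu> (Suc i)) (lk \<nu> i))"
    unfolding mon_set2[of \<nu> i "lk \<nu> i"] mon_set2[of \<nu> i "lk \<nu> (Suc i)"]
    by (simp add: swap_op_hom swap_op_mon_fixed mult_ac)
  then show ?thesis by (simp add: set2_self sw_def)
qed

text \<open>This is (v u^m - u v^m) / (u - v): the mixed monomials of degree m with both exponents
  positive, and 0 for m = 1. They are the terms of T_i on a pure power that leave the rearrangement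
  class.\<close>

definition betw :: "'a::comm_ring_1 \<Rightarrow> 'a \<Rightarrow> nat \<Rightarrow> 'a" where
  "betw u v m = (\<Sum>k=1..<m. u ^ (m - k) * v ^ k)"

lemma betw_eq: "1 \<le> m \<Longrightarrow> (u - v) * betw u v m = v * u ^ m - u * v ^ m"
proof (induction m rule: dec_induct)
  case (step m)
  have "betw u v (Suc m) = (\<Sum>k=1..<m. u ^ (Suc m - k) * v ^ k) + u * v ^ m"
    using step(1) by (simp add: betw_def)
  also have "(\<Sum>k=1..<m. u ^ (Suc m - k) * v ^ k) = u * betw u v m"
    unfolding betw_def sum_distrib_left by (rule sum.cong) (auto simp: Suc_diff_le mult.assoc)
  finally have *: "betw u v (Suc m) = u * betw u v m + u * v ^ m" .
  have "(u - v) * betw u v (Suc m) = u * ((u - v) * betw u v m) + (u - v) * (u * v ^ m)"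
    unfolding * by (simp add: algebra_simps)
  then show ?case unfolding step.IH by (simp add: algebra_simps)
qed (simp add: betw_def)

lemma T_op_var_Suc_power:
  assumes "1 \<le> m"
  shows "T_op t i (var (Suc i) ^ m) = const t * var i ^ m + const (t - 1) * var (Suc i) ^ m
    + const (t - 1) * betw (var i) (var (Suc i)) m"
proof (rule T_op_unique)
  let ?u = "var i :: 'a mpol" and ?v = "var (Suc i) :: 'a mpol"
  have "(?u - ?v) * (const t * ?u ^ m + const (t - 1) * ?v ^ m + const (t - 1) * betw ?u ?v m)
    = (?u - ?v) * (const t * ?u ^ m + const (t - 1) * ?v ^ m) + const (t - 1) * ((?u - ?v) * betw ?u ?v m)"
    by (simp add: algebra_simps)
  also have "\<dots> = const (1 - t) * ?v * ?v ^ m + (const t * ?u - ?v) * swap_op i (?v ^ m)"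
    unfolding betw_eq[OF assms] by (simp add: swap_op_hom const_diff algebra_simps)
  finally show "(?u - ?v) * (const t * ?u ^ m + const (t - 1) * ?v ^ m + const (t - 1) * betw ?u ?v m)
     = const (1 - t) * ?v * ?v ^ m + (const t * ?u - ?v) * swap_op i (?v ^ m)" .
qed

lemma T_op_var_power:
  assumes "1 \<le> m"
  shows "T_op t i (var i ^ m) = var (Suc i) ^ m + const (1 - t) * betw (var i) (var (Suc i)) m"
proof (rule T_op_unique)
  let ?u = "var i :: 'a mpol" and ?v = "var (Suc i) :: 'a mpol"
  have "(?u - ?v) * (?v ^ m + const (1 - t) * betw ?u ?v m)
    = (?u - ?v) * ?v ^ m + const (1 - t) * ((?u - ?v) * betw ?u ?v m)"
    by (simp add: algebra_simps)
  also have "\<dots> = const (1 - t) * ?v * ?u ^ m + (const t * ?u - ?v) * swap_op i (?u ^ m)"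
    unfolding betw_eq[OF assms] by (simp add: swap_op_hom const_diff algebra_simps)
  finally show "(?u - ?v) * (?v ^ m + const (1 - t) * betw ?u ?v m)
     = const (1 - t) * ?v * ?u ^ m + (const t * ?u - ?v) * swap_op i (?u ^ m)" .
qed

definition low_set :: "nat \<Rightarrow> expo \<Rightarrow> expo set" where
  "low_set n \<nu> = {\<mu>. lower n \<mu> \<nu>}"

lemma supp_add_subset: "supp f \<subseteq> S \<Longrightarrow> supp g \<subseteq> S \<Longrightarrow> supp (f + g) \<subseteq> S"
  using keys_add[of f g] by blast

lemma supp_const_mult_subset: "supp f \<subseteq> S \<Longrightarrow> supp (const c * f) \<subseteq> S"
  using supp_const_mult[of c f] by blast

lemma supp_sum_subset: "(\<And>x. x \<in> A \<Longrightarrow> supp (F x) \<subseteq> S) \<Longrightarrow> supp (sum F A) \<subseteq> S"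
  by (induction A rule: infinite_finite_induct) (simp_all add: supp_add_subset)

lemma betw_supp:
  fixes \<nu> :: expo and i :: nat
  defines "a \<equiv> lk \<nu> i" and "b \<equiv> lk \<nu> (Suc i)"
  assumes \<nu>: "composition n \<nu>" "i \<in> {1..<n}" "a \<noteq> b"
  shows "supp (mon (set2 \<nu> i (min a b) (min a b)) * betw (var i) (var (Suc i)) (max a b - min a b) :: 'a::field mpol) \<subseteq> low_set n \<nu>"
proof -
  let ?s = "min a b" and ?m = "max a b - min a b"
  have "mon (set2 \<nu> i ?s ?s) * betw (var i) (var (Suc i)) ?m
     = (\<Sum>k=1..<?m. mon (set2 \<nu> i (?s + (?m - k)) (?s + k)) :: 'a mpol)"
    unfolding betw_def sum_distrib_left
    by (rule sum.cong) (simp_all add: mon_set2[of \<nu> i "min a b"] mon_set2[of \<nu> i "min a b + _"] power_add mult_ac)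
  also have "supp \<dots> \<subseteq> low_set n \<nu>"
  proof (rule supp_sum_subset)
    fix k assume "k \<in> {1..<?m}"
    then have "lower n (set2 \<nu> i (?s + (?m - k)) (?s + k)) \<nu>"
      by (intro lower_set2[OF \<nu>(1,2)]) (auto simp: a_def b_def)
    then show "supp (mon (set2 \<nu> i (?s + (?m - k)) (?s + k)) :: 'a mpol) \<subseteq> low_set n \<nu>"
      by (simp add: low_set_def)
  qed
  finally show ?thesis .
qed

text \<open>The common power of z_i and z_(i+1) is symmetric and commutes with T_i; what remains is
  a pure power of one of the two variables.\<close>

lemma T_op_mon:
  fixes t :: "'a::field"
  assumes \<nu>: "composition n \<nu>" "i \<in> {1..<n}"
  shows "\<exists>g. T_op t i (mon \<nu>) = const (if lk \<nu> (Suc i) < lk \<nu> i then 1 else t) * mon (sw i \<nu>)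
      + const (if lk \<nu> i < lk \<nu> (Suc i) then t - 1 else 0) * mon \<nu> + g \<and> supp g \<subseteq> low_set n \<nu>"
proof -
  define a b where "a = lk \<nu> i" and "b = lk \<nu> (Suc i)"
  let ?u = "var i :: 'a mpol" and ?v = "var (Suc i) :: 'a mpol"
  have inv: "swap_op i (mon (set2 \<nu> i s s)) = mon (set2 \<nu> i s s)" for s
    by (simp add: mon_set2[of \<nu> i s] swap_op_hom swap_op_mon_fixed mult_ac)
  have fac: "mon (set2 \<nu> i (s + x) (s + y)) = mon (set2 \<nu> i s s) * (?u ^ x * ?v ^ y)" for s x y
    by (simp add: mon_set2[of \<nu> i s] mon_set2[of \<nu> i "s + _"] power_add mult_ac)
  have sw: "sw i \<nu> = set2 \<nu> i b a" and self: "\<nu> = set2 \<nu> i a b"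
    by (simp_all add: sw_def a_def b_def set2_self)
  have ab: "lk \<nu> i = a" "lk \<nu> (Suc i) = b" by (simp_all add: a_def b_def)
  consider "a < b" | "a = b" | "b < a" by linarith
  then show ?thesis
  proof cases
    case 1
    let ?M = "mon (set2 \<nu> i a a) :: 'a mpol"
    have n: "mon \<nu> = ?M * ?v ^ (b - a)" and s: "mon (sw i \<nu>) = ?M * ?u ^ (b - a)"
      using fac[of a 0 "b - a"] fac[of a "b - a" 0] 1 self sw by simp_all
    have "T_op t i (mon \<nu>) = ?M * (const t * ?u ^ (b - a) + const (t - 1) * ?v ^ (b - a) + const (t - 1) * betw ?u ?v (b - a))"
      unfolding n T_op_mult_sym[OF inv] using 1 by (subst T_op_var_Suc_power) auto
    also have "\<dots> = const t * mon (sw i \<nu>) + const (t - 1) * mon \<nu> + const (t - 1) * (?M * betw ?u ?v (b - a))"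
      unfolding n s by (simp add: algebra_simps)
    finally show ?thesis
      using 1 supp_const_mult_subset[OF betw_supp[OF \<nu>, where 'a='a], of "t - 1"] unfolding ab by auto
  next
    case 2
    have "T_op t i (mon (set2 \<nu> i a a) * 1) = mon (set2 \<nu> i a a) * const t"
      unfolding T_op_mult_sym[OF inv] by (rule arg_cong[OF T_op_unique]) (simp add: const_diff algebra_simps)
    then have "T_op t i (mon \<nu>) = const t * mon \<nu>" using self 2 by (simp add: mult.commute)
    moreover have "sw i \<nu> = \<nu>" using sw self 2 by simp
    ultimately show ?thesis unfolding ab using 2 by (intro exI[of _ 0]) simp
  next
    case 3
    let ?M = "mon (set2 \<nu> i b b) :: 'a mpol"
    have n: "mon \<nu> = ?M * ?u ^ (a - b)" and s: "mon (sw i \<nu>) = ?M * ?v ^ (a - b)"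
      using fac[of b 0 "a - b"] fac[of b "a - b" 0] 3 self sw by simp_all
    have "T_op t i (mon \<nu>) = ?M * (?v ^ (a - b) + const (1 - t) * betw ?u ?v (a - b))"
      unfolding n T_op_mult_sym[OF inv] using 3 by (subst T_op_var_power) auto
    also have "\<dots> = mon (sw i \<nu>) + const (1 - t) * (?M * betw ?u ?v (a - b))"
      unfolding s by (simp add: algebra_simps)
    finally show ?thesis
      using 3 supp_const_mult_subset[OF betw_supp[OF \<nu>, where 'a='a], of "1 - t"] unfolding ab by auto
  qed
qed

lemma supp_linear:
  fixes F :: "'a::field mpol \<Rightarrow> 'a mpol"
  assumes add: "\<And>f g. F (f + g) = F f + F g" and c: "\<And>c f. F (const c * f) = const c * F f"
    and m: "\<And>\<nu>. \<nu> \<in> supp f \<Longrightarrow> supp (F (mon \<nu>)) \<subseteq> S"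
  shows "supp (F f) \<subseteq> S"
proof -
  have "F 0 = 0" using c[of 0 0] by simp
  then have "F (sum G A) = (\<Sum>x\<in>A. F (G x))" for G :: "expo \<Rightarrow> 'a mpol" and A
    by (induction A rule: infinite_finite_induct) (simp_all add: add)
  then have "F f = (\<Sum>\<nu>\<in>supp f. const (coef f \<nu>) * F (mon \<nu>))"
    by (subst sum_mon_expand[of "supp f" f]) (simp_all add: c)
  then show ?thesis using m by (simp add: supp_sum_subset supp_const_mult_subset)
qed

definition lower_stable :: "nat \<Rightarrow> ('a::field mpol \<Rightarrow> 'a mpol) \<Rightarrow> bool" where
  "lower_stable n F \<longleftrightarrow> (\<forall>f S. (\<forall>\<nu>\<in>S. \<forall>\<mu>. composition n \<mu> \<and> (is_permutation_of n \<mu> \<nu> \<or> lower n \<mu> \<nu>) \<longrightarrow> \<mu> \<in> S)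
      \<longrightarrow> S \<subseteq> Collect (composition n) \<longrightarrow> supp f \<subseteq> S \<longrightarrow> supp (F f) \<subseteq> S)"

lemma lower_stable_T_op:
  assumes "i \<in> {1..<n}"
  shows "lower_stable n (T_op t i)"
  unfolding lower_stable_def
proof (intro allI impI)
  fix f :: "'a mpol" and S :: "expo set"
  assume S: "\<forall>\<nu>\<in>S. \<forall>\<mu>. composition n \<mu> \<and> (is_permutation_of n \<mu> \<nu> \<or> lower n \<mu> \<nu>) \<longrightarrow> \<mu> \<in> S"
    and c: "S \<subseteq> Collect (composition n)" and f: "supp f \<subseteq> S"
  show "supp (T_op t i f) \<subseteq> S"
  proof (rule supp_linear[where F = "T_op t i"])
    fix \<nu> assume "\<nu> \<in> supp f"
    then have \<nu>: "\<nu> \<in> S" "composition n \<nu>" using f c by auto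
    have "sw i \<nu> \<in> S" using S \<nu> composition_sw[OF \<nu>(2) assms] is_permutation_of_sw[OF assms] by blast
    moreover have "low_set n \<nu> \<subseteq> S" using S \<nu> by (auto simp: low_set_def lower_def)
    moreover obtain g where g: "T_op t i (mon \<nu>) = const (if lk \<nu> (Suc i) < lk \<nu> i then 1 else t) * mon (sw i \<nu>)
      + const (if lk \<nu> i < lk \<nu> (Suc i) then t - 1 else 0) * mon \<nu> + g" "supp g \<subseteq> low_set n \<nu>"
      using T_op_mon[OF \<nu>(2) assms] by blast
    ultimately show "supp (T_op t i (mon \<nu>)) \<subseteq> S"
      unfolding g(1) using \<nu>(1) by - (intro supp_add_subset supp_const_mult_subset; auto)
  qed (simp_all add: T_op_add T_op_const_mult)
qed

text \<open>The exponent after the cyclic operator: entries move one place to the left and the first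
  goes to place n. The cycle is given by a word so that bijectivity comes from
  \<open>bij_word_perm\<close>.\<close>

definition rot :: "nat \<Rightarrow> expo \<Rightarrow> expo" where
  "rot n \<nu> = Poly_Mapping.map_key (word_perm [1..<n]) \<nu>"

lemma word_perm_cycle: "k \<in> {1..n} \<Longrightarrow> word_perm [1..<n] k = (if k < n then Suc k else 1)"
proof (induction n)
  case (Suc n)
  show ?case
  proof (cases "k = Suc n")
    case True
    then show ?thesis by (cases "n = 0") (simp_all add: word_perm_upt del: upt_Suc)
  next
    case False
    then have k: "k \<in> {1..n}" using Suc.prems by auto
    then have "word_perm [1..<Suc n] k = word_perm [1..<n] (transpose n (Suc n) k)"
      by (simp add: word_perm_append word_perm_Cons)
    also have "\<dots> = Suc k"
    proof (cases "k = n")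
      case True
      then show ?thesis using word_perm_fixes[of "[1..<n]" n "Suc n"] by auto
    next
      case False
      then show ?thesis using Suc.IH[OF k] k by auto
    qed
    finally show ?thesis using k by simp
  qed
qed simp

lemma lk_rot: "lk (rot n \<nu>) k = lk \<nu> (word_perm [1..<n] k)"
  by (simp add: rot_def map_key.rep_eq bij_word_perm bij_is_inj)

lemma composition_rot: "composition n \<nu> \<Longrightarrow> composition n (rot n \<nu>)"
  using permutes_in_image[OF word_perm_permutes[of "[1..<n]" n]]
  by (auto simp: composition_lk lk_rot permutes_not_in[OF word_perm_permutes[of "[1..<n]" n]])

lemma is_permutation_of_rot: "is_permutation_of n (rot n \<nu>) \<nu>"
  unfolding is_permutation_of_def
  using word_perm_permutes[of "[1..<n]" n] by (intro exI[of _ "word_perm [1..<n]"]) (auto simp: lk_rot)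

lemma pmon_composition: "composition n \<nu> \<Longrightarrow> pmon g \<nu> = (\<Prod>i=1..n. g i ^ lk \<nu> i)"
  unfolding composition_def by (rule pmon_superset) simp_all

lemma omega0_mon:
  fixes q :: "'a::field"
  assumes "composition n \<nu>" "1 \<le> n"
  shows "omega0 q n (mon \<nu>) = const (q ^ lk \<nu> 1) * mon (rot n \<nu>)"
proof -
  define g where "g = (\<lambda>j. if j = 1 then const q * var n else if 2 \<le> j \<and> j \<le> n then var (j - 1) else (var j :: 'a mpol))"
  let ?c = "word_perm [1..<n]"
  have c: "?c permutes {1..n}" by (rule word_perm_permutes) auto
  have "omega0 q n (mon \<nu>) = (\<Prod>i=1..n. g i ^ lk \<nu> i)"
    by (simp only: omega0_def psubst_single g_def[symmetric] pmon_composition[OF assms(1)] const_1 mult_1)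
  also have "\<dots> = (\<Prod>k=1..n. g (?c k) ^ lk \<nu> (?c k))"
    using prod.permute[OF c, of "\<lambda>i. g i ^ lk \<nu> i"] by (simp add: comp_def)
  also have "\<dots> = (\<Prod>k=1..n. (if k = n then const (q ^ lk \<nu> 1) else 1) * var k ^ lk (rot n \<nu>) k)"
  proof (rule prod.cong)
    fix k assume k: "k \<in> {1..n}"
    show "g (?c k) ^ lk \<nu> (?c k) = (if k = n then const (q ^ lk \<nu> 1) else 1) * var k ^ lk (rot n \<nu>) k"
      using k by (simp only: lk_rot word_perm_cycle[OF k]) (auto simp: g_def power_mult_distrib const_power)
  qed simp
  also have "\<dots> = const (q ^ lk \<nu> 1) * mon (rot n \<nu>)"
    using assms(2) pmon_composition[OF composition_rot[OF assms(1)], of "var :: nat \<Rightarrow> 'a mpol"]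
    by (simp add: prod.distrib pmon_var)
  finally show ?thesis .
qed

context macdonald begin

lemma Ti_mon:
  assumes \<nu>: "composition n \<nu>" "i \<in> {1..<n}"
  shows "\<exists>g. Ti i (mon \<nu>) = const (if lk \<nu> i < lk \<nu> (Suc i) then 1 else inverse t) * mon (sw i \<nu>)
      + const (if lk \<nu> (Suc i) < lk \<nu> i then inverse t - 1 else 0) * mon \<nu> + g \<and> supp g \<subseteq> low_set n \<nu>"
proof -
  obtain g where g: "T i (mon \<nu>) = const (if lk \<nu> (Suc i) < lk \<nu> i then 1 else t) * mon (sw i \<nu>)
      + const (if lk \<nu> i < lk \<nu> (Suc i) then t - 1 else 0) * mon \<nu> + g" "supp g \<subseteq> low_set n \<nu>"
    using T_op_mon[OF assms] by blast
  have *: "const c * (const a * x + const b * y + g + const d * y) = const (c * a) * x + const (c * (b + d)) * y + const c * g"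
    for a b c d and x y g :: "'a mpol"
    by (simp add: const_mult const_add algebra_simps)
  have "Ti i (mon \<nu>) = const (inverse t * (if lk \<nu> (Suc i) < lk \<nu> i then 1 else t)) * mon (sw i \<nu>)
      + const (inverse t * ((if lk \<nu> i < lk \<nu> (Suc i) then t - 1 else 0) + (1 - t))) * mon \<nu> + const (inverse t) * g"
    unfolding Ti_eq g(1) * inverse_eq_divide by simp
  moreover have "supp (const (inverse t) * g) \<subseteq> low_set n \<nu>"
    using g(2) by (rule supp_const_mult_subset)
  moreover consider "lk \<nu> i < lk \<nu> (Suc i)" | "lk \<nu> i = lk \<nu> (Suc i)" | "lk \<nu> (Suc i) < lk \<nu> i" by linarith
  then have "const (inverse t * (if lk \<nu> (Suc i) < lk \<nu> i then 1 else t)) * mon (sw i \<nu>)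
      + const (inverse t * ((if lk \<nu> i < lk \<nu> (Suc i) then t - 1 else 0) + (1 - t))) * mon \<nu>
    = const (if lk \<nu> i < lk \<nu> (Suc i) then 1 else inverse t) * mon (sw i \<nu>)
      + const (if lk \<nu> (Suc i) < lk \<nu> i then inverse t - 1 else 0) * mon \<nu>"
  proof cases
    case 2
    then show ?thesis by (simp add: sw_eq const_diff algebra_simps)
  qed (simp_all add: algebra_simps)
  ultimately show ?thesis by auto
qed

end

section \<open>Leading terms of Y_i on monomials\<close>

lemma prod_if_power:
  "finite A \<Longrightarrow> (\<Prod>k\<in>A. if P k then 1 else (x::'a::comm_monoid_mult)) = x ^ card {k\<in>A. \<not> P k}"
proof (induction A rule: finite_induct)
  case (insert y F)
  have "{k \<in> insert y F. \<not> P k} = (if P y then {k\<in>F. \<not> P k} else insert y {k\<in>F. \<not> P k})" by auto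
  then show ?case using insert by simp
qed simp

lemma low_set_perm: "is_permutation_of n \<nu> \<eta> \<Longrightarrow> low_set n \<nu> \<subseteq> low_set n \<eta>"
  using lower_perm2 by (auto simp: low_set_def)

lemma stage:
  fixes F :: "'a::field mpol \<Rightarrow> 'a mpol"
  assumes add: "\<And>f g. F (f + g) = F f + F g" and c: "\<And>c f. F (const c * f) = const c * F f"
    and F: "\<And>\<nu>. composition n \<nu> \<Longrightarrow>
      \<exists>g. F (mon \<nu>) = const (A \<nu>) * mon (sw j \<nu>) + const (B \<nu>) * mon \<nu> + g \<and> supp g \<subseteq> low_set n \<nu>"
    and j: "j \<in> {1..<n}"
    and f: "f = const a * mon M + h" "supp h \<subseteq> S' \<union> low_set n \<eta>"
    and M: "composition n M" "is_permutation_of n M \<eta>" "B M \<noteq> 0 \<Longrightarrow> M \<in> S"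
    and S: "\<And>\<theta>. \<theta> \<in> S' \<Longrightarrow> composition n \<theta> \<and> is_permutation_of n \<theta> \<eta> \<and> sw j \<theta> \<in> S \<and> (B \<theta> \<noteq> 0 \<longrightarrow> \<theta> \<in> S)"
  shows "\<exists>h'. F f = const (a * A M) * mon (sw j M) + h' \<and> supp h' \<subseteq> S \<union> low_set n \<eta>"
proof -
  obtain g where g: "F (mon M) = const (A M) * mon (sw j M) + const (B M) * mon M + g" "supp g \<subseteq> low_set n M"
    using F[OF M(1)] by blast
  let ?h = "const a * (const (B M) * mon M + g) + F h"
  have 1: "supp (const (B M) * mon M) \<subseteq> S \<union> low_set n \<eta>"
    using M(3) by (cases "B M = 0") (auto intro!: supp_const_mult_subset simp del: const_eq_0_iff)
  have 2: "supp (F h) \<subseteq> S \<union> low_set n \<eta>"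
  proof (rule supp_linear[where F = F, OF add c])
    fix \<theta> assume "\<theta> \<in> supp h"
    then consider "\<theta> \<in> S'" | "\<theta> \<in> low_set n \<eta>" using f(2) by blast
    then show "supp (F (mon \<theta>)) \<subseteq> S \<union> low_set n \<eta>"
    proof cases
      case 1
      note S = S[OF 1]
      then obtain g where g: "F (mon \<theta>) = const (A \<theta>) * mon (sw j \<theta>) + const (B \<theta>) * mon \<theta> + g" "supp g \<subseteq> low_set n \<theta>"
        using F[of \<theta>] by blast
      have B: "supp (const (B \<theta>) * mon \<theta>) \<subseteq> S \<union> low_set n \<eta>"
        using S by (cases "B \<theta> = 0") (auto intro!: supp_const_mult_subset simp del: const_eq_0_iff)
      then show ?thesis
        unfolding g(1) using S g(2) low_set_perm[of n \<theta> \<eta>]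
        by (intro supp_add_subset[OF supp_add_subset[OF supp_const_mult_subset B]]) auto
    next
      case 2
      then have \<theta>: "lower n \<theta> \<eta>" "composition n \<theta>" by (auto simp: low_set_def lower_def)
      have "sw j \<theta> \<in> low_set n \<eta>"
        using lower_perm1[OF is_permutation_of_sw[OF j] composition_sw[OF \<theta>(2) j] \<theta>(1)] by (simp add: low_set_def)
      moreover have "low_set n \<theta> \<subseteq> low_set n \<eta>" using lower_trans[OF _ \<theta>(1)] by (auto simp: low_set_def)
      moreover obtain g where g: "F (mon \<theta>) = const (A \<theta>) * mon (sw j \<theta>) + const (B \<theta>) * mon \<theta> + g" "supp g \<subseteq> low_set n \<theta>"
        using F[OF \<theta>(2)] by blast
      ultimately show ?thesis
        unfolding g(1) using 2 by - (intro supp_add_subset supp_const_mult_subset; auto)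
    qed
  qed
  have "F f = const (a * A M) * mon (sw j M) + ?h"
    unfolding f(1) add c g(1) by (simp add: const_mult algebra_simps)
  moreover have "supp ?h \<subseteq> S \<union> low_set n \<eta>"
    using g(2) low_set_perm[OF M(2)]
    by (intro supp_add_subset[OF supp_const_mult_subset[OF supp_add_subset[OF 1]] 2]) auto
  ultimately show ?thesis by blast
qed

context macdonald begin

text \<open>The rearrangements that may accompany the tracked monomial once
  \<open>\<eta>\<^sub>i\<close> has reached place j. The tracked monomial has
  \<open>lk \<eta> (k - 1)\<close> at each k in between; the final strict inequality keeps it out of
  the set.\<close>

definition left_set :: "expo \<Rightarrow> nat \<Rightarrow> nat \<Rightarrow> expo set" where
  "left_set \<eta> i j = {\<theta>. composition n \<theta> \<and> is_permutation_of n \<theta> \<eta> \<and> (\<forall>k. k < j \<or> i < k \<longrightarrow> lk \<theta> k = lk \<eta> k) \<and>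
     (\<forall>k. j < k \<and> k \<le> i \<longrightarrow> lk \<theta> k \<le> lk \<eta> (k - 1)) \<and> (\<exists>k. j < k \<and> k \<le> i \<and> lk \<theta> k < lk \<eta> (k - 1))}"

text \<open>The corresponding invariant after \<open>rot\<close>, with j running from n down to i.
  Relative to \<eta>, entries before i can only have dropped and entries after j only have grown,
  and some change is strict.\<close>

definition right_set :: "expo \<Rightarrow> nat \<Rightarrow> nat \<Rightarrow> expo set" where
  "right_set \<eta> i j = {\<theta>. composition n \<theta> \<and> is_permutation_of n \<theta> \<eta> \<and> (\<forall>k. 1 \<le> k \<and> k < i \<longrightarrow> lk \<theta> k \<le> lk \<eta> k) \<and>
     (\<forall>k. i \<le> k \<and> k < j \<longrightarrow> lk \<theta> k = lk \<eta> (Suc k)) \<and> (\<forall>k. j < k \<and> k \<le> n \<longrightarrow> lk \<eta> k \<le> lk \<theta> k) \<and>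
     ((\<exists>k. 1 \<le> k \<and> k < i \<and> lk \<theta> k < lk \<eta> k) \<or> (\<exists>k. j < k \<and> k \<le> n \<and> lk \<eta> k < lk \<theta> k))}"

text \<open>
  The entry \<open>\<eta>\<^sub>i\<close> is carried leftwards to position \<open>j\<close>; whenever it is exchanged instead of carried
  on, a smaller entry is left behind.
\<close>

lemma left_stage:
  assumes \<eta>: "composition n \<eta>" and i: "i \<in> {1..n}" and j: "1 \<le> j" "j \<le> i"
  shows "\<exists>M h. word_op Ti [j..<i] (mon \<eta>)
        = const (\<Prod>k\<in>{j..<i}. if lk \<eta> k < lk \<eta> i then 1 else inverse t) * mon M + h
      \<and> supp h \<subseteq> left_set \<eta> i j \<union> low_set n \<eta> \<and> composition n M \<and> is_permutation_of n M \<eta>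
      \<and> (\<forall>k. lk M k = (if k = j then lk \<eta> i else if j < k \<and> k \<le> i then lk \<eta> (k - 1) else lk \<eta> k))"
  using j(2,1)
proof (induction j rule: inc_induct)
  case base
  then show ?case using \<eta> by (intro exI[of _ \<eta>] exI[of _ 0]) (auto simp: is_permutation_of_refl)
next
  case (step j)
  define a where "a = (\<Prod>k\<in>{Suc j..<i}. if lk \<eta> k < lk \<eta> i then 1 else inverse t)"
  obtain M h where IH: "word_op Ti [Suc j..<i] (mon \<eta>) = const a * mon M + h"
      "supp h \<subseteq> left_set \<eta> i (Suc j) \<union> low_set n \<eta>" "composition n M" "is_permutation_of n M \<eta>"
    and M: "\<And>k. lk M k = (if k = Suc j then lk \<eta> i else if Suc j < k \<and> k \<le> i then lk \<eta> (k - 1) else lk \<eta> k)"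
    using step.IH unfolding a_def by auto
  have j: "j \<in> {1..<n}" using step i by auto
  let ?A = "\<lambda>\<nu>. if lk \<nu> j < lk \<nu> (Suc j) then 1 else inverse t"
  let ?B = "\<lambda>\<nu>. if lk \<nu> (Suc j) < lk \<nu> j then inverse t - 1 else 0"
  have "\<exists>h'. Ti j (word_op Ti [Suc j..<i] (mon \<eta>)) = const (a * ?A M) * mon (sw j M) + h'
      \<and> supp h' \<subseteq> left_set \<eta> i j \<union> low_set n \<eta>"
  proof (rule stage[OF Ti_linear, where A = ?A and B = ?B])
    show "\<exists>g. Ti j (mon \<nu>) = const (?A \<nu>) * mon (sw j \<nu>) + const (?B \<nu>) * mon \<nu> + g \<and> supp g \<subseteq> low_set n \<nu>"
      if "composition n \<nu>" for \<nu>
      by (rule Ti_mon[OF that j])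
    show "M \<in> left_set \<eta> i j" if B: "?B M \<noteq> 0"
    proof -
      have lt: "lk M (Suc j) < lk M j" using B by (auto split: if_splits)
      then have "lk \<eta> i < lk \<eta> j" by (simp add: M)
      then show ?thesis
        using IH(3,4) step by (auto simp: left_set_def M intro!: exI[of _ "Suc j"])
    qed
    fix \<theta> assume "\<theta> \<in> left_set \<eta> i (Suc j)"
    then have \<theta>: "composition n \<theta>" "is_permutation_of n \<theta> \<eta>"
      and eq: "\<And>k. k \<le> j \<or> i < k \<Longrightarrow> lk \<theta> k = lk \<eta> k"
      and le: "\<And>k. Suc j < k \<Longrightarrow> k \<le> i \<Longrightarrow> lk \<theta> k \<le> lk \<eta> (k - Suc 0)"
      and ex: "\<exists>k. Suc j < k \<and> k \<le> i \<and> lk \<theta> k < lk \<eta> (k - 1)"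
      by (auto simp: left_set_def)
    obtain l where l: "Suc j < l" "l \<le> i" "lk \<theta> l < lk \<eta> (l - 1)" using ex by blast
    have sws: "lk (sw j \<theta>) k = (if k = j then lk \<theta> (Suc j) else if k = Suc j then lk \<theta> j else lk \<theta> k)" for k
      by (simp add: sw_def)
    have "sw j \<theta> \<in> left_set \<eta> i j"
      using \<theta> composition_sw[OF \<theta>(1) j] is_permutation_of_trans[OF is_permutation_of_sw[OF j] \<theta>(2)] step l
      by (auto simp: left_set_def sws eq le intro!: exI[of _ l])
    moreover have "\<theta> \<in> left_set \<eta> i j" if B: "?B \<theta> \<noteq> 0"
    proof -
      have lt: "lk \<theta> (Suc j) < lk \<theta> j" using B by (auto split: if_splits)
      have "lk \<theta> k \<le> lk \<eta> (k - Suc 0)" if "j < k" "k \<le> i" for k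
        using that le[of k] lt eq[of j] by (cases "k = Suc j") auto
      then show ?thesis
        using \<theta> l by (auto simp: left_set_def eq intro!: exI[of _ l])
    qed
    ultimately show "composition n \<theta> \<and> is_permutation_of n \<theta> \<eta> \<and> sw j \<theta> \<in> left_set \<eta> i j \<and> (?B \<theta> \<noteq> 0 \<longrightarrow> \<theta> \<in> left_set \<eta> i j)"
      using \<theta> by blast
  qed (use IH j in auto)
  then obtain h' where h': "Ti j (word_op Ti [Suc j..<i] (mon \<eta>)) = const (a * ?A M) * mon (sw j M) + h'"
    "supp h' \<subseteq> left_set \<eta> i j \<union> low_set n \<eta>" by blast
  have "a * ?A M = (\<Prod>k\<in>{j..<i}. if lk \<eta> k < lk \<eta> i then 1 else inverse t)"
    using step by (simp add: a_def M prod.atLeast_Suc_lessThan[of j i])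
  moreover have "[j..<i] = j # [Suc j..<i]" using step by (simp add: upt_conv_Cons)
  ultimately show ?case
    using h' composition_sw[OF IH(3) j] is_permutation_of_trans[OF is_permutation_of_sw[OF j] IH(4)] step
    by (intro exI[of _ "sw j M"] exI[of _ h']) (auto simp: word_op_Cons sw_def M)
qed

text \<open>After the rotation \<open>\<eta>\<^sub>i\<close> stands at place n; the factors T_(n-1),
  ..., T_j carry it back to j. Passing an entry that is not larger costs a factor t.\<close>

lemma right_stage:
  assumes \<eta>: "composition n \<eta>" and i: "i \<in> {1..n}" and j: "i \<le> j" "j \<le> n"
    and f: "f = const c * mon N + g" "supp g \<subseteq> right_set \<eta> i n \<union> low_set n \<eta>"
    and N: "composition n N" "is_permutation_of n N \<eta>"
      "\<And>k. lk N k = (if k = n then lk \<eta> i else if i \<le> k \<and> k < n then lk \<eta> (Suc k) else lk \<eta> k)"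
  shows "\<exists>M h. word_op T [j..<n] f
        = const (c * (\<Prod>k\<in>{j<..n}. if lk \<eta> i < lk \<eta> k then 1 else t)) * mon M + h
      \<and> supp h \<subseteq> right_set \<eta> i j \<union> low_set n \<eta> \<and> composition n M \<and> is_permutation_of n M \<eta>
      \<and> (\<forall>k. lk M k = (if k = j then lk \<eta> i else if i \<le> k \<and> k < j then lk \<eta> (Suc k) else lk \<eta> k))"
  using j(2,1)
proof (induction j rule: inc_induct)
  case base
  then show ?case using f N by (intro exI[of _ N] exI[of _ g]) auto
next
  case (step j)
  define a where "a = c * (\<Prod>k\<in>{Suc j<..n}. if lk \<eta> i < lk \<eta> k then 1 else t)"
  obtain M h where IH: "word_op T [Suc j..<n] f = const a * mon M + h"
      "supp h \<subseteq> right_set \<eta> i (Suc j) \<union> low_set n \<eta>" "composition n M" "is_permutation_of n M \<eta>"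
    and M: "\<And>k. lk M k = (if k = Suc j then lk \<eta> i else if i \<le> k \<and> k < Suc j then lk \<eta> (Suc k) else lk \<eta> k)"
    using step.IH step.prems unfolding a_def by auto
  have j: "j \<in> {1..<n}" using step i by auto
  let ?A = "\<lambda>\<nu>. if lk \<nu> (Suc j) < lk \<nu> j then 1 else t"
  let ?B = "\<lambda>\<nu>. if lk \<nu> j < lk \<nu> (Suc j) then t - 1 else 0"
  have "\<exists>h'. T j (word_op T [Suc j..<n] f) = const (a * ?A M) * mon (sw j M) + h'
      \<and> supp h' \<subseteq> right_set \<eta> i j \<union> low_set n \<eta>"
  proof (rule stage[OF T_op_add T_op_const_mult, where A = ?A and B = ?B])
    show "\<exists>g. T j (mon \<nu>) = const (?A \<nu>) * mon (sw j \<nu>) + const (?B \<nu>) * mon \<nu> + g \<and> supp g \<subseteq> low_set n \<nu>"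
      if "composition n \<nu>" for \<nu>
      by (rule T_op_mon[OF that j])
    show "M \<in> right_set \<eta> i j" if B: "?B M \<noteq> 0"
    proof -
      have "lk M j < lk M (Suc j)" using B by (auto split: if_splits)
      then have "lk \<eta> (Suc j) < lk \<eta> i" using step.prems by (simp add: M)
      then show ?thesis
        using IH(3,4) step by (auto simp: right_set_def M intro!: exI[of _ "Suc j"])
    qed
    fix \<theta> assume "\<theta> \<in> right_set \<eta> i (Suc j)"
    then have \<theta>: "composition n \<theta>" "is_permutation_of n \<theta> \<eta>"
      and le: "\<And>k. 1 \<le> k \<Longrightarrow> k < i \<Longrightarrow> lk \<theta> k \<le> lk \<eta> k"
      and eq: "\<And>k. i \<le> k \<Longrightarrow> k < Suc j \<Longrightarrow> lk \<theta> k = lk \<eta> (Suc k)"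
      and ge: "\<And>k. Suc j < k \<Longrightarrow> k \<le> n \<Longrightarrow> lk \<eta> k \<le> lk \<theta> k"
      and ex: "(\<exists>k. 1 \<le> k \<and> k < i \<and> lk \<theta> k < lk \<eta> k) \<or> (\<exists>k. Suc j < k \<and> k \<le> n \<and> lk \<eta> k < lk \<theta> k)"
      by (auto simp: right_set_def)
    have sws: "lk (sw j \<theta>) k = (if k = j then lk \<theta> (Suc j) else if k = Suc j then lk \<theta> j else lk \<theta> k)" for k
      by (simp add: sw_def)
    have ex1: "(\<exists>k. 1 \<le> k \<and> k < i \<and> lk (sw j \<theta>) k < lk \<eta> k) \<or> (\<exists>k. j < k \<and> k \<le> n \<and> lk \<eta> k < lk (sw j \<theta>) k)"
      using ex
    proof
      assume "\<exists>k. 1 \<le> k \<and> k < i \<and> lk \<theta> k < lk \<eta> k"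
      then obtain k where "1 \<le> k" "k < i" "lk \<theta> k < lk \<eta> k" by blast
      then show ?thesis using step.prems by (intro disjI1 exI[of _ k]) (auto simp: sws)
    next
      assume "\<exists>k. Suc j < k \<and> k \<le> n \<and> lk \<eta> k < lk \<theta> k"
      then obtain k where "Suc j < k" "k \<le> n" "lk \<eta> k < lk \<theta> k" by blast
      then show ?thesis by (intro disjI2 exI[of _ k]) (auto simp: sws)
    qed
    have ex2: "(\<exists>k. 1 \<le> k \<and> k < i \<and> lk \<theta> k < lk \<eta> k) \<or> (\<exists>k. j < k \<and> k \<le> n \<and> lk \<eta> k < lk \<theta> k)"
      using ex Suc_lessD by blast
    have "lk \<eta> k \<le> lk (sw j \<theta>) k" if "j < k" "k \<le> n" for k
      using that ge[of k] eq[of j] step.prems by (cases "k = Suc j") (auto simp: sws)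
    then have "sw j \<theta> \<in> right_set \<eta> i j"
      using \<theta> composition_sw[OF \<theta>(1) j] is_permutation_of_trans[OF is_permutation_of_sw[OF j] \<theta>(2)] step.prems ex1 le
      by (simp add: right_set_def) (simp add: sws eq)
    moreover have "\<theta> \<in> right_set \<eta> i j" if B: "?B \<theta> \<noteq> 0"
    proof -
      have lt: "lk \<theta> j < lk \<theta> (Suc j)" using B by (auto split: if_splits)
      have "lk \<eta> k \<le> lk \<theta> k" if "j < k" "k \<le> n" for k
        using that ge[of k] lt eq[of j] step.prems by (cases "k = Suc j") auto
      then show ?thesis
        using \<theta> ex2 le by (simp add: right_set_def eq)
    qed
    ultimately show "composition n \<theta> \<and> is_permutation_of n \<theta> \<eta> \<and> sw j \<theta> \<in> right_set \<eta> i j \<and> (?B \<theta> \<noteq> 0 \<longrightarrow> \<theta> \<in> right_set \<eta> i j)"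
      using \<theta> by blast
  qed (use IH j in auto)
  then obtain h' where h': "T j (word_op T [Suc j..<n] f) = const (a * ?A M) * mon (sw j M) + h'"
    "supp h' \<subseteq> right_set \<eta> i j \<union> low_set n \<eta>" by blast
  have "{j<..n} = insert (Suc j) {Suc j<..n}" using step by auto
  then have "a * ?A M = c * (\<Prod>k\<in>{j<..n}. if lk \<eta> i < lk \<eta> k then 1 else t)"
    using step.prems by (simp add: a_def M mult_ac)
  moreover have "[j..<n] = j # [Suc j..<n]" using step by (simp add: upt_conv_Cons)
  ultimately show ?case
    using h' composition_sw[OF IH(3) j] is_permutation_of_trans[OF is_permutation_of_sw[OF j] IH(4)] step.prems
    by (intro exI[of _ "sw j M"] exI[of _ h']) (auto simp: word_op_Cons sw_def M)
qed

text \<open>Before place i the partial sums are compared termwise; from i on, the complementary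
  tails are compared, using that both moduli agree.\<close>

lemma right_set_below:
  assumes "\<theta> \<in> right_set \<eta> i i" "composition n \<eta>" "i \<in> {1..n}"
  shows "below n \<theta> \<eta>"
proof -
  have \<theta>: "composition n \<theta>" "is_permutation_of n \<theta> \<eta>"
    and le: "\<And>k. 1 \<le> k \<Longrightarrow> k < i \<Longrightarrow> lk \<theta> k \<le> lk \<eta> k"
    and ge: "\<And>k. i < k \<Longrightarrow> k \<le> n \<Longrightarrow> lk \<eta> k \<le> lk \<theta> k"
    and "\<theta> \<noteq> \<eta>"
    using assms(1) by (auto simp: right_set_def)
  have m: "modulus n \<theta> = modulus n \<eta>" by (rule perm_invariants(1)[OF \<theta>(2)])
  have "(\<Sum>k=1..p. lk \<theta> k) \<le> (\<Sum>k=1..p. lk \<eta> k)" if "p \<in> {1..n}" for p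
  proof (cases "p < i")
    case True
    then show ?thesis using le by (intro sum_mono) auto
  next
    case False
    have split: "modulus n \<nu> = (\<Sum>k=1..p. lk \<nu> k) + (\<Sum>k\<in>{p<..n}. lk \<nu> k)" for \<nu>
    proof -
      have "{1..n} = {1..p} \<union> {p<..n}" using that by auto
      then show ?thesis unfolding modulus_def by (simp only:) (rule sum.union_disjoint, auto)
    qed
    have "(\<Sum>k\<in>{p<..n}. lk \<eta> k) \<le> (\<Sum>k\<in>{p<..n}. lk \<theta> k)"
      using False ge by (intro sum_mono) auto
    then show ?thesis using m split[of \<theta>] split[of \<eta>] by linarith
  qed
  then have "dominance_less n \<theta> \<eta>"
    using m \<open>\<theta> \<noteq> \<eta>\<close> by (simp add: dominance_less_iff)
  then show ?thesis using \<theta> assms by (simp add: below_def)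
qed

lemma Y_mon:
  assumes \<eta>: "composition n \<eta>" and i: "i \<in> {1..n}"
  shows "\<exists>h. Y i (mon \<eta>) = const (eigval q t n \<eta> i) * mon \<eta> + h \<and> supp h \<subseteq> {\<nu>. below n \<nu> \<eta>}"
proof -
  define \<alpha> where "\<alpha> = (\<Prod>k\<in>{1..<i}. if lk \<eta> k < lk \<eta> i then 1 else inverse t)"
  define \<gamma> where "\<gamma> = (\<Prod>k\<in>{i<..n}. if lk \<eta> i < lk \<eta> k then 1 else t)"
  obtain M h where L: "word_op Ti [1..<i] (mon \<eta>) = const \<alpha> * mon M + h"
      "supp h \<subseteq> left_set \<eta> i 1 \<union> low_set n \<eta>" "composition n M" "is_permutation_of n M \<eta>"
      and M: "\<And>k. lk M k = (if k = 1 then lk \<eta> i else if 1 < k \<and> k \<le> i then lk \<eta> (k - 1) else lk \<eta> k)"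
    using left_stage[OF \<eta> i, of 1] i unfolding \<alpha>_def by auto
  have n: "1 \<le> n" using i by auto
  have lkr: "lk (rot n \<nu>) k = (if k = n then lk \<nu> 1 else lk \<nu> (Suc k))" if "k \<in> {1..n}" for \<nu> k
    unfolding lk_rot word_perm_cycle[OF that] using that by auto
  have N: "lk (rot n M) k = (if k = n then lk \<eta> i else if i \<le> k \<and> k < n then lk \<eta> (Suc k) else lk \<eta> k)" for k
  proof (cases "k \<in> {1..n}")
    case True
    then show ?thesis using i by (simp only: lkr[OF True]) (auto simp: M)
  next
    case False
    then show ?thesis using composition_rot[OF L(3)] \<eta> n i by (auto simp: composition_lk)
  qed
  have om: "om (word_op Ti [1..<i] (mon \<eta>)) = const (\<alpha> * q ^ lk \<eta> i) * mon (rot n M) + om h"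
    unfolding L(1) om_hom omega0_mon[OF L(3) n] by (simp add: const_mult M mult.assoc)
  have omh: "supp (om h) \<subseteq> right_set \<eta> i n \<union> low_set n \<eta>"
  proof (rule supp_linear[where F = om])
    fix \<theta> assume "\<theta> \<in> supp h"
    then consider "\<theta> \<in> left_set \<eta> i 1" | "\<theta> \<in> low_set n \<eta>" using L(2) by blast
    then have "composition n \<theta> \<and> rot n \<theta> \<in> right_set \<eta> i n \<union> low_set n \<eta>"
    proof cases
      case 1
      then have \<theta>: "composition n \<theta>" "is_permutation_of n \<theta> \<eta>"
        and eq: "\<And>k. i < k \<Longrightarrow> lk \<theta> k = lk \<eta> k"
        and le: "\<And>k. 1 < k \<Longrightarrow> k \<le> i \<Longrightarrow> lk \<theta> k \<le> lk \<eta> (k - 1)"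
        and ex: "\<exists>k. 1 < k \<and> k \<le> i \<and> lk \<theta> k < lk \<eta> (k - 1)"
        by (auto simp: left_set_def)
      obtain l where l: "1 < l" "l \<le> i" "lk \<theta> l < lk \<eta> (l - 1)" using ex by blast
      have le': "lk (rot n \<theta>) k \<le> lk \<eta> k" if "1 \<le> k" "k < i" for k
        using that i le[of "Suc k"] by (subst lkr) auto
      have eq': "lk (rot n \<theta>) k = lk \<eta> (Suc k)" if "i \<le> k" "k < n" for k
        using that i eq[of "Suc k"] by (subst lkr) auto
      have "\<exists>k. 1 \<le> k \<and> k < i \<and> lk (rot n \<theta>) k < lk \<eta> k"
      proof -
        obtain m where "l = Suc m" using l by (cases l) auto
        then show ?thesis using l i by (intro exI[of _ m]) (subst lkr; auto)
      qed
      then have "rot n \<theta> \<in> right_set \<eta> i n"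
        using composition_rot[OF \<theta>(1)] is_permutation_of_trans[OF is_permutation_of_rot \<theta>(2)] le' eq'
        by (simp add: right_set_def)
      then show ?thesis using \<theta> by simp
    next
      case 2
      then have \<theta>: "composition n \<theta>" "lower n \<theta> \<eta>" by (auto simp: low_set_def lower_def)
      then show ?thesis
        using lower_perm1[OF is_permutation_of_rot composition_rot[OF \<theta>(1)] \<theta>(2)] by (simp add: low_set_def)
    qed
    then show "supp (om (mon \<theta>)) \<subseteq> right_set \<eta> i n \<union> low_set n \<eta>"
      using n by (auto simp only: omega0_mon intro!: supp_const_mult_subset) (auto split: if_splits)
  qed (simp_all add: om_hom)
  obtain M' h' where R: "word_op T [i..<n] (om (word_op Ti [1..<i] (mon \<eta>))) = const (\<alpha> * q ^ lk \<eta> i * \<gamma>) * mon M' + h'"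
      "supp h' \<subseteq> right_set \<eta> i i \<union> low_set n \<eta>" "composition n M'"
      "\<And>k. lk M' k = (if k = i then lk \<eta> i else if i \<le> k \<and> k < i then lk \<eta> (Suc k) else lk \<eta> k)"
    using right_stage[OF \<eta> i _ _ om omh composition_rot[OF L(3)] is_permutation_of_trans[OF is_permutation_of_rot L(4)] N, of i] i
    unfolding \<gamma>_def by auto
  have "M' = \<eta>" by (rule poly_mapping_eqI) (simp add: R(4))
  \<comment> \<open>\<open>\<alpha>\<close> has one 1/t for each earlier entry that is at least
    \<open>\<eta>\<^sub>i\<close>. \<open>\<gamma>\<close> has one t for each later entry that is at
    most \<open>\<eta>\<^sub>i\<close>, and against the prefactor t^-(n-i) this leaves one 1/t for
    each later larger entry.\<close>
  have coeff: "inverse t ^ (n - i) * (\<alpha> * q ^ lk \<eta> i * \<gamma>) = eigval q t n \<eta> i"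
  proof -
    have 1: "\<alpha> = inverse t ^ card {j\<in>{1..n}. j < i \<and> lk \<eta> j \<ge> lk \<eta> i}"
      unfolding \<alpha>_def by (subst prod_if_power) (use i in \<open>auto intro!: arg_cong[of _ _ "\<lambda>A. inverse t ^ card A"]\<close>)
    have 2: "\<gamma> = t ^ card {k\<in>{i<..n}. \<not> lk \<eta> i < lk \<eta> k}"
      unfolding \<gamma>_def by (rule prod_if_power) simp
    have "{i<..n} = {k\<in>{i<..n}. \<not> lk \<eta> i < lk \<eta> k} \<union> {j\<in>{1..n}. j > i \<and> lk \<eta> j > lk \<eta> i}"
      by auto
    then have "n - i = card ({k\<in>{i<..n}. \<not> lk \<eta> i < lk \<eta> k} \<union> {j\<in>{1..n}. j > i \<and> lk \<eta> j > lk \<eta> i})"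
      by (metis card_greaterThanAtMost)
    then have 3: "n - i = card {k\<in>{i<..n}. \<not> lk \<eta> i < lk \<eta> k} + card {j\<in>{1..n}. j > i \<and> lk \<eta> j > lk \<eta> i}"
      by (subst (asm) card_Un_disjoint) auto
    have 4: "inverse t ^ a * t ^ a = 1" for a by (simp flip: power_mult_distrib)
    show ?thesis
      unfolding 1 2 3 eigval_def leg_colength_def power_add using 4 by (simp add: mult_ac)
  qed
  have "Y i (mon \<eta>) = const (eigval q t n \<eta> i) * mon \<eta> + const (inverse t ^ (n - i)) * h'"
    unfolding Y_eq R(1) \<open>M' = \<eta>\<close> coeff[symmetric] by (simp add: const_mult algebra_simps)
  moreover have "right_set \<eta> i i \<union> low_set n \<eta> \<subseteq> {\<nu>. below n \<nu> \<eta>}"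
    using right_set_below[OF _ \<eta> i] \<eta> by (auto simp: low_set_def below_def lower_def)
  ultimately show ?thesis using R(2) supp_const_mult[of "inverse t ^ (n - i)" h'] by blast
qed

end

section \<open>Nonsymmetric Macdonald polynomials\<close>

text \<open>The order of the entries that \<open>leg_colength\<close> counts: larger ones first, ties by position.\<close>

definition before :: "expo \<Rightarrow> nat \<Rightarrow> nat \<Rightarrow> bool" where
  "before \<eta> j i \<longleftrightarrow> lk \<eta> i < lk \<eta> j \<or> lk \<eta> j = lk \<eta> i \<and> j < i"

lemma leg_colength_before: "leg_colength n \<eta> i = card {j\<in>{1..n}. before \<eta> j i}"
proof -
  let ?A = "{j\<in>{1..n}. j < i \<and> lk \<eta> j \<ge> lk \<eta> i}" and ?B = "{j\<in>{1..n}. j > i \<and> lk \<eta> j > lk \<eta> i}"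
  have "before \<eta> j i \<longleftrightarrow> j < i \<and> lk \<eta> i \<le> lk \<eta> j \<or> i < j \<and> lk \<eta> i < lk \<eta> j" for j
    by (cases j i rule: linorder_cases) (auto simp: before_def)
  then have "{j\<in>{1..n}. before \<eta> j i} = ?A \<union> ?B" by blast
  moreover have "card (?A \<union> ?B) = card ?A + card ?B"
  proof (rule card_Un_disjoint)
    show "?A \<inter> ?B = {}" by fastforce
  qed simp_all
  ultimately show ?thesis by (simp only: leg_colength_def)
qed

lemma leg_colength_less:
  assumes "i \<in> {1..n}" "before \<eta> i j"
  shows "leg_colength n \<eta> i < leg_colength n \<eta> j"
  unfolding leg_colength_before
  by (rule psubset_card_mono) (use assms in \<open>auto simp: before_def\<close>)

lemma leg_colength_inj: "inj_on (leg_colength n \<eta>) {1..n}"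
proof (rule inj_onI)
  fix i j assume *: "i \<in> {1..n}" "j \<in> {1..n}" "leg_colength n \<eta> i = leg_colength n \<eta> j"
  show "i = j"
  proof (rule ccontr)
    assume "i \<noteq> j"
    then have "before \<eta> i j \<or> before \<eta> j i" by (auto simp: before_def)
    then show False using leg_colength_less[of i n \<eta> j] leg_colength_less[of j n \<eta> i] * by auto
  qed
qed

lemma leg_colength_le: "leg_colength n \<eta> i \<le> n"
proof -
  have "card {j\<in>{1..n}. before \<eta> j i} \<le> card {1..n}" by (rule card_mono) auto
  then show ?thesis by (simp add: leg_colength_before)
qed

text \<open>Distinctness matters: ties are decided by position, so exchanging two equal entries
  would not transport the order.\<close>

lemma before_sw:
  assumes "lk \<eta> i \<noteq> lk \<eta> (Suc i)"
  shows "before (sw i \<eta>) j k \<longleftrightarrow> before \<eta> (transpose i (Suc i) j) (transpose i (Suc i) k)"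
  using assms unfolding before_def lk_sw by (auto simp: transpose_def)

lemma leg_colength_sw:
  assumes "i \<in> {1..<n}" "lk \<eta> i \<noteq> lk \<eta> (Suc i)"
  shows "leg_colength n (sw i \<eta>) k = leg_colength n \<eta> (transpose i (Suc i) k)"
proof -
  let ?s = "transpose i (Suc i)"
  have s: "?s permutes {1..n}" using assms(1) by (auto intro: permutes_swap_id)
  have "{j\<in>{1..n}. before \<eta> j (?s k)} = ?s ` {j\<in>{1..n}. before (sw i \<eta>) j k}"
  proof (intro equalityI subsetI)
    fix j assume j: "j \<in> {j\<in>{1..n}. before \<eta> j (?s k)}"
    then have "?s j \<in> {j\<in>{1..n}. before (sw i \<eta>) j k}"
      using permutes_in_image[OF s, of j] by (simp add: before_sw[OF assms(2)])
    then show "j \<in> ?s ` {j\<in>{1..n}. before (sw i \<eta>) j k}"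
      by (intro image_eqI[of _ _ "?s j"]) auto
  next
    fix j assume "j \<in> ?s ` {j\<in>{1..n}. before (sw i \<eta>) j k}"
    then obtain l where "j = ?s l" "l \<in> {1..n}" "before (sw i \<eta>) l k" by blast
    then show "j \<in> {j\<in>{1..n}. before \<eta> j (?s k)}"
      using permutes_in_image[OF s, of l] by (simp add: before_sw[OF assms(2)])
  qed
  then show ?thesis
    unfolding leg_colength_before by (simp add: card_image inj_on_subset[OF inj_transpose])
qed

lemma eigval_sw:
  assumes "i \<in> {1..<n}" "lk \<eta> i \<noteq> lk \<eta> (Suc i)"
  shows "eigval q t n (sw i \<eta>) k = eigval q t n \<eta> (transpose i (Suc i) k)"
  by (simp add: eigval_def leg_colength_sw[OF assms] lk_sw)

section \<open>Genericity and separation of eigenvalues\<close>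

lemma is_permutation_ofI:
  assumes inj: "inj_on f {1..n}" and im: "f ` {1..n} \<subseteq> {1..n}" and eq: "\<And>i. i \<in> {1..n} \<Longrightarrow> lk \<mu> i = lk \<nu> (f i)"
  shows "is_permutation_of n \<mu> \<nu>"
proof -
  define \<pi> where "\<pi> = (\<lambda>i. if i \<in> {1..n} then f i else i)"
  have "bij_betw f {1..n} {1..n}"
    using inj im endo_inj_surj[of "{1..n}" f] by (simp add: bij_betw_def)
  moreover have "bij_betw f {1..n} {1..n} = bij_betw \<pi> {1..n} {1..n}"
    by (rule bij_betw_cong) (simp add: \<pi>_def)
  ultimately have "bij_betw \<pi> {1..n} {1..n}" by simp
  moreover have "\<pi> x = x" if "x \<notin> {1..n}" for x
    unfolding \<pi>_def by (rule if_not_P[OF that])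
  ultimately have "\<pi> permutes {1..n}" by (rule bij_imp_permutes)
  then show ?thesis unfolding is_permutation_of_def using eq by (intro exI[of _ \<pi>]) (simp add: \<pi>_def)
qed

text \<open>The monomials q^a t^b are linearly independent over the integers. The case of the single
  exponent (0, 0) forces characteristic 0.\<close>

locale macdonald_generic = macdonald +
  assumes generic: "\<And>S c x. finite S \<Longrightarrow> (\<Sum>(a, b)\<in>S. of_int (c (a, b)) * q ^ a * t ^ b) = 0 \<Longrightarrow> x \<in> S \<Longrightarrow> c x = 0"
begin

text \<open>Different indices may carry the same exponents, so coefficients are collected over each
  exponent pair p before being compared.\<close>

lemma generic_families:
  fixes c d :: "nat \<Rightarrow> int" and a b a' b' :: "nat \<Rightarrow> nat"
  assumes fin: "finite I" "finite J"
    and eq: "(\<Sum>i\<in>I. of_int (c i) * q ^ a i * t ^ b i) = (\<Sum>j\<in>J. of_int (d j) * q ^ a' j * t ^ b' j)"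
  shows "(\<Sum>i | i \<in> I \<and> (a i, b i) = p. c i) = (\<Sum>j | j \<in> J \<and> (a' j, b' j) = p. d j)"
proof -
  define g g' where "g = (\<lambda>i. (a i, b i))" and "g' = (\<lambda>j. (a' j, b' j))"
  define S where "S = insert p (g ` I \<union> g' ` J)"
  define C where "C = (\<lambda>p. (\<Sum>i | i \<in> I \<and> g i = p. c i) - (\<Sum>j | j \<in> J \<and> g' j = p. d j))"
  have S: "finite S" "g ` I \<subseteq> S" "g' ` J \<subseteq> S" using fin by (auto simp: S_def)
  have "(\<Sum>x\<in>S. of_int (\<Sum>i | i \<in> I \<and> g i = x. c i) * q ^ fst x * t ^ snd x)
      = (\<Sum>x\<in>S. \<Sum>i | i \<in> I \<and> g i = x. of_int (c i) * q ^ a i * t ^ b i)"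
    by (rule sum.cong) (auto simp: sum_distrib_right g_def intro!: sum.cong)
  also have "\<dots> = (\<Sum>i\<in>I. of_int (c i) * q ^ a i * t ^ b i)"
    by (rule sum.group[OF fin(1) S(1,2)])
  also have "\<dots> = (\<Sum>j\<in>J. of_int (d j) * q ^ a' j * t ^ b' j)" by (rule eq)
  also have "\<dots> = (\<Sum>x\<in>S. \<Sum>j | j \<in> J \<and> g' j = x. of_int (d j) * q ^ a' j * t ^ b' j)"
    by (rule sum.group[OF fin(2) S(1,3), symmetric])
  also have "\<dots> = (\<Sum>x\<in>S. of_int (\<Sum>j | j \<in> J \<and> g' j = x. d j) * q ^ fst x * t ^ snd x)"
    by (rule sum.cong) (auto simp: sum_distrib_right g'_def intro!: sum.cong)
  finally have "(\<Sum>x\<in>S. of_int (C x) * q ^ fst x * t ^ snd x) = 0"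
    by (simp add: C_def left_diff_distrib sum_subtractf)
  then have "C p = 0" using generic[OF S(1), of C p] by (simp add: S_def case_prod_unfold)
  then show ?thesis by (simp add: C_def g_def g'_def)
qed

end

context macdonald_generic begin

text \<open>Multiplication by t^n clears the negative powers. Leg colengths are distinct within one
  composition, so each exponent pair occurs once there and its weight can be read off.\<close>

lemma eigval_sum_inj:
  assumes eq: "(\<Sum>i=1..n. of_nat (w i) * eigval q t n \<eta> i) = (\<Sum>i=1..n. of_nat (w i) * eigval q t n \<mu> i)"
    and w: "\<And>i. i \<in> {1..n} \<Longrightarrow> w i \<noteq> 0" and i: "i \<in> {1..n}"
  shows "\<exists>j\<in>{1..n}. lk \<mu> j = lk \<eta> i \<and> leg_colength n \<mu> j = leg_colength n \<eta> i \<and> w j = w i"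
proof -
  define b where "b = (\<lambda>\<nu> i. n - leg_colength n \<nu> i)"
  have e: "t ^ n * (of_nat (w i) * eigval q t n \<nu> i) = of_int (int (w i)) * q ^ lk \<nu> i * t ^ b \<nu> i" for \<nu> i
  proof -
    let ?l = "leg_colength n \<nu> i"
    have "t ^ n = t ^ b \<nu> i * t ^ ?l"
      unfolding b_def power_add[symmetric] using leg_colength_le[of n \<nu> i] by simp
    then have "t ^ n * (of_nat (w i) * eigval q t n \<nu> i) = of_int (int (w i)) * q ^ lk \<nu> i * t ^ b \<nu> i * (t ^ ?l * inverse t ^ ?l)"
      by (simp only: eigval_def of_int_of_nat_eq mult_ac)
    also have "t ^ ?l * inverse t ^ ?l = 1"
      unfolding power_mult_distrib[symmetric] by simp
    finally show ?thesis by simp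
  qed
  have "(\<Sum>i=1..n. of_int (int (w i)) * q ^ lk \<eta> i * t ^ b \<eta> i) = (\<Sum>i=1..n. of_int (int (w i)) * q ^ lk \<mu> i * t ^ b \<mu> i)"
    using arg_cong[OF eq, of "\<lambda>x. t ^ n * x"] by (simp only: sum_distrib_left e)
  note s = generic_families[OF finite_atLeastAtMost finite_atLeastAtMost this, of "(lk \<eta> i, b \<eta> i)"]
  have binj: "leg_colength n \<nu> j = leg_colength n \<nu>' k" if "b \<nu> j = b \<nu>' k" for \<nu> \<nu>' j k
    using that leg_colength_le[of n \<nu> j] leg_colength_le[of n \<nu>' k] by (simp add: b_def)
  have uniq: "j = k" if "j \<in> {1..n}" "k \<in> {1..n}" "b \<nu> j = b \<nu> k" for \<nu> j k
    using inj_onD[OF leg_colength_inj binj[OF that(3)] that(1,2)] .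
  have one: "{j. j \<in> {1..n} \<and> (lk \<nu> j, b \<nu> j) = (lk \<nu> k, b \<nu> k)} = {k}" if "k \<in> {1..n}" for \<nu> k
    using uniq[OF _ that, of _ \<nu>] that by blast
  have "{j. j \<in> {1..n} \<and> (lk \<mu> j, b \<mu> j) = (lk \<eta> i, b \<eta> i)} \<noteq> {}"
  proof
    assume e: "{j. j \<in> {1..n} \<and> (lk \<mu> j, b \<mu> j) = (lk \<eta> i, b \<eta> i)} = {}"
    have "int (w i) = 0" using s unfolding e one[OF i] by simp
    then show False using w[OF i] by simp
  qed
  then obtain j where j: "j \<in> {1..n}" "lk \<mu> j = lk \<eta> i" "b \<mu> j = b \<eta> i" by blast
  have "int (w i) = int (w j)" using s unfolding j(2,3)[symmetric] one[OF j(1)] unfolding j(2,3) one[OF i] by simp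
  then show ?thesis using j binj[OF j(3)] by (intro bexI[of _ j]) simp_all
qed

text \<open>With equal weights only the multiset of eigenvalues would be visible, that is, the
  partition. The weights i also record the positions, so the sum determines the composition.\<close>

definition ysep :: "expo \<Rightarrow> 'a" where
  "ysep \<eta> = (\<Sum>i=1..n. of_nat i * eigval q t n \<eta> i)"

definition Ysep :: "'a mpol \<Rightarrow> 'a mpol" where
  "Ysep f = (\<Sum>i=1..n. const (of_nat i) * Y i f)"

lemma ysep_inj:
  assumes "ysep \<eta> = ysep \<mu>" "composition n \<eta>" "composition n \<mu>"
  shows "\<eta> = \<mu>"
proof (rule composition_eqI[OF assms(2,3)])
  fix i assume i: "i \<in> {1..n}"
  have "\<exists>j\<in>{1..n}. lk \<mu> j = lk \<eta> i \<and> leg_colength n \<mu> j = leg_colength n \<eta> i \<and> j = i"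
    by (rule eigval_sum_inj) (use assms(1) i in \<open>auto simp: ysep_def\<close>)
  then show "lk \<eta> i = lk \<mu> i" by auto
qed

lemma eigval_sum_perm:
  assumes "(\<Sum>i=1..n. eigval q t n \<eta> i) = (\<Sum>i=1..n. eigval q t n \<mu> i)"
  shows "is_permutation_of n \<eta> \<mu>"
proof -
  have "\<forall>i\<in>{1..n}. \<exists>j\<in>{1..n}. lk \<mu> j = lk \<eta> i \<and> leg_colength n \<mu> j = leg_colength n \<eta> i"
    using eigval_sum_inj[of "\<lambda>_. 1" \<eta> \<mu>] assms by simp
  then obtain f where f: "\<And>i. i \<in> {1..n} \<Longrightarrow> f i \<in> {1..n} \<and> lk \<mu> (f i) = lk \<eta> i \<and> leg_colength n \<mu> (f i) = leg_colength n \<eta> i"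
    by metis
  show ?thesis
  proof (rule is_permutation_ofI[of f])
    show "inj_on f {1..n}"
      using f leg_colength_inj[of n \<eta>] by (intro inj_onI) (metis inj_onD)
  qed (use f in auto)
qed

section \<open>Eigenvectors of the separating operator\<close>

lemma Ysep_linear: "Ysep (f + g) = Ysep f + Ysep g" "Ysep (const c * f) = const c * Ysep f"
  by (simp_all add: Ysep_def Y_add Y_const_mult distrib_left sum.distrib sum_distrib_left mult.left_commute)

lemma Ysep_0: "Ysep 0 = 0"
  by (simp add: Ysep_def)

lemma Ysep_sum: "Ysep (sum F A) = (\<Sum>x\<in>A. Ysep (F x))"
  by (induction A rule: infinite_finite_induct) (simp_all add: Ysep_linear Ysep_0)

lemma Ysep_mon:
  assumes "composition n \<eta>"
  shows "\<exists>h. Ysep (mon \<eta>) = const (ysep \<eta>) * mon \<eta> + h \<and> supp h \<subseteq> {\<nu>. below n \<nu> \<eta>}"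
proof -
  have "\<forall>i\<in>{1..n}. \<exists>h. Y i (mon \<eta>) = const (eigval q t n \<eta> i) * mon \<eta> + h \<and> supp h \<subseteq> {\<nu>. below n \<nu> \<eta>}"
    using Y_mon[OF assms] by blast
  then obtain h where h: "\<And>i. i \<in> {1..n} \<Longrightarrow> Y i (mon \<eta>) = const (eigval q t n \<eta> i) * mon \<eta> + h i"
    "\<And>i. i \<in> {1..n} \<Longrightarrow> supp (h i) \<subseteq> {\<nu>. below n \<nu> \<eta>}" by metis
  have "Ysep (mon \<eta>) = (\<Sum>i=1..n. const (of_nat i * eigval q t n \<eta> i) * mon \<eta> + const (of_nat i) * h i)"
    unfolding Ysep_def by (rule sum.cong) (simp_all add: h(1) const_mult distrib_left mult.assoc)
  then have "Ysep (mon \<eta>) = const (ysep \<eta>) * mon \<eta> + (\<Sum>i=1..n. const (of_nat i) * h i)"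
    by (simp add: sum.distrib ysep_def const_sum sum_distrib_right)
  moreover have "supp (\<Sum>i=1..n. const (of_nat i) * h i) \<subseteq> {\<nu>. below n \<nu> \<eta>}"
    by (intro supp_sum_subset supp_const_mult_subset h(2))
  ultimately show ?thesis by blast
qed

text \<open>At an exponent lying below no exponent of f, the off-diagonal parts of F contribute
  nothing.\<close>

lemma triangular_coef:
  fixes F :: "'a mpol \<Rightarrow> 'a mpol"
  assumes add: "\<And>f g. F (f + g) = F f + F g" and c: "\<And>c f. F (const c * f) = const c * F f"
    and F: "\<And>\<eta>. composition n \<eta> \<Longrightarrow> \<exists>h. F (mon \<eta>) = const (y \<eta>) * mon \<eta> + h \<and> supp h \<subseteq> {\<nu>. below n \<nu> \<eta>}"
    and f: "supp f \<subseteq> Collect (composition n)" and m: "\<And>\<mu>. \<mu> \<in> supp f \<Longrightarrow> \<not> below n \<nu> \<mu>"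
  shows "coef (F f) \<nu> = y \<nu> * coef f \<nu>"
proof -
  have "F 0 = 0" using c[of 0 0] by simp
  then have "F (sum G A) = (\<Sum>x\<in>A. F (G x))" for G :: "expo \<Rightarrow> 'a mpol" and A
    by (induction A rule: infinite_finite_induct) (simp_all add: add)
  then have "F f = (\<Sum>\<mu>\<in>supp f. const (coef f \<mu>) * F (mon \<mu>))"
    by (subst sum_mon_expand[of "supp f" f]) (simp_all add: c)
  then have "coef (F f) \<nu> = (\<Sum>\<mu>\<in>supp f. coef f \<mu> * coef (F (mon \<mu>)) \<nu>)"
    by (simp add: lookup_sum)
  also have "\<dots> = (\<Sum>\<mu>\<in>supp f. if \<mu> = \<nu> then y \<nu> * coef f \<nu> else 0)"
  proof (rule sum.cong[OF HOL.refl])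
    fix \<mu> assume \<mu>: "\<mu> \<in> supp f"
    then obtain h where h: "F (mon \<mu>) = const (y \<mu>) * mon \<mu> + h" "supp h \<subseteq> {\<nu>. below n \<nu> \<mu>}"
      using F f by blast
    have "coef h \<nu> = 0" using h(2) m[OF \<mu>] by (auto simp: in_keys_iff)
    then show "coef f \<mu> * coef (F (mon \<mu>)) \<nu> = (if \<mu> = \<nu> then y \<nu> * coef f \<nu> else 0)"
      by (simp add: h(1) lookup_add lookup_single when_def)
  qed
  also have "\<dots> = y \<nu> * coef f \<nu>" by (auto simp: in_keys_iff)
  finally show ?thesis .
qed

lemma exists_maximal:
  assumes "finite A" "A \<noteq> {}"
  shows "\<exists>\<nu>\<in>A. \<forall>\<mu>\<in>A. \<not> below n \<nu> \<mu>"
proof -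
  have "asymp_on A (below n)" "transp_on A (below n)"
    using below_irrefl below_trans by (blast intro: asymp_onI transp_onI)+
  from Finite_Set.bex_max_element[OF assms(1) this assms(2)] show ?thesis
    using below_irrefl by metis
qed

lemma supp_below_chain: "supp f \<subseteq> {\<nu>. below n \<nu> \<eta>} \<Longrightarrow> supp f \<subseteq> Collect (composition n)"
  by (auto simp: below_def)

text \<open>After subtracting the multiple of E, a maximal exponent of the difference would have
  eigenvalue \<open>ysep \<eta>\<close>, hence be \<eta>, where the coefficient was just
  removed.\<close>

lemma Ysep_unique:
  assumes E: "coef E \<eta> = 1" "supp E \<subseteq> Collect (composition n)" "Ysep E = const (ysep \<eta>) * E"
    and \<eta>: "composition n \<eta>"
    and f: "supp f \<subseteq> Collect (composition n)" "Ysep f = const (ysep \<eta>) * f"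
  shows "f = const (coef f \<eta>) * E"
proof -
  define g where "g = f + const (- coef f \<eta>) * E"
  have gs: "supp g \<subseteq> Collect (composition n)"
    unfolding g_def by (rule supp_add_subset[OF f(1) supp_const_mult_subset[OF E(2)]])
  have gY: "Ysep g = const (ysep \<eta>) * g"
    unfolding g_def Ysep_linear f(2) E(3) by (simp add: algebra_simps)
  have g0: "coef g \<eta> = 0" by (simp add: g_def lookup_add E(1))
  have "g = 0"
  proof (rule ccontr)
    assume "g \<noteq> 0"
    then obtain \<nu> where \<nu>: "\<nu> \<in> supp g" "\<And>\<mu>. \<mu> \<in> supp g \<Longrightarrow> \<not> below n \<nu> \<mu>"
      using exists_maximal[of "supp g"] by (auto simp only: finite_keys keys_eq_empty)
    have "coef (Ysep g) \<nu> = ysep \<nu> * coef g \<nu>"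
      by (rule triangular_coef[where F = Ysep and y = ysep, OF Ysep_linear Ysep_mon gs \<nu>(2)])
    then have "ysep \<eta> = ysep \<nu>" using \<nu>(1) by (simp add: gY in_keys_iff)
    then have "\<eta> = \<nu>" using ysep_inj \<eta> gs \<nu>(1) by auto
    then show False using g0 \<nu>(1) by (simp add: in_keys_iff)
  qed
  then show ?thesis by (simp add: g_def const_uminus)
qed

text \<open>A family that is unitriangular for \<open>below\<close> spans: z^\<nu> is E \<nu> minus
  lower monomials, which are expressed by well-founded induction. \<open>D\<close> may be any
  down-set, so the expansion stays inside it.\<close>

lemma expand:
  fixes E :: "expo \<Rightarrow> 'a mpol"
  assumes D: "\<And>\<nu> \<mu>. \<nu> \<in> D \<Longrightarrow> below n \<mu> \<nu> \<Longrightarrow> \<mu> \<in> D"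
    and E: "\<And>\<nu>. \<nu> \<in> D \<Longrightarrow> \<exists>h. E \<nu> = mon \<nu> + h \<and> supp h \<subseteq> {\<mu>. below n \<mu> \<nu>}"
    and f: "supp f \<subseteq> D"
  shows "\<exists>A b. finite A \<and> A \<subseteq> D \<and> f = (\<Sum>\<nu>\<in>A. const (b \<nu>) * E \<nu>)"
proof -
  define P where "P f \<longleftrightarrow> (\<exists>A b. finite A \<and> A \<subseteq> D \<and> f = (\<Sum>\<nu>\<in>A. const (b \<nu>) * E \<nu>))" for f
  have P0: "P 0" unfolding P_def by (rule exI[of _ "{}"]) simp
  have Pc: "P (const c * f)" if f: "P f" for c f
  proof -
    obtain A b where "finite A" "A \<subseteq> D" "f = (\<Sum>\<nu>\<in>A. const (b \<nu>) * E \<nu>)" using f unfolding P_def by blast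
    then show ?thesis unfolding P_def
      by (intro exI[of _ A] exI[of _ "\<lambda>\<nu>. c * b \<nu>"]) (simp add: sum_distrib_left const_mult mult.assoc)
  qed
  have Padd: "P (f + g)" if fg: "P f" "P g" for f g
  proof -
    obtain A b where A: "finite A" "A \<subseteq> D" "f = (\<Sum>\<nu>\<in>A. const (b \<nu>) * E \<nu>)" using fg(1) unfolding P_def by blast
    obtain B c where B: "finite B" "B \<subseteq> D" "g = (\<Sum>\<nu>\<in>B. const (c \<nu>) * E \<nu>)" using fg(2) unfolding P_def by blast
    define b' c' where "b' = (\<lambda>\<nu>. if \<nu> \<in> A then b \<nu> else 0)" and "c' = (\<lambda>\<nu>. if \<nu> \<in> B then c \<nu> else 0)"
    have "f = (\<Sum>\<nu>\<in>A \<union> B. const (b' \<nu>) * E \<nu>)"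
      unfolding A(3) by (rule sum.mono_neutral_cong_left) (use A(1) B(1) in \<open>auto simp: b'_def\<close>)
    moreover have "g = (\<Sum>\<nu>\<in>A \<union> B. const (c' \<nu>) * E \<nu>)"
      unfolding B(3) by (rule sum.mono_neutral_cong_left) (use A(1) B(1) in \<open>auto simp: c'_def\<close>)
    ultimately have "f + g = (\<Sum>\<nu>\<in>A \<union> B. const (b' \<nu> + c' \<nu>) * E \<nu>)"
      by (simp only: sum.distrib const_add distrib_right)
    then show ?thesis unfolding P_def using A(1,2) B(1,2)
      by (intro exI[of _ "A \<union> B"] exI[of _ "\<lambda>\<nu>. b' \<nu> + c' \<nu>"]) simp
  qed
  have Psum: "P (sum G A)" if "\<And>x. x \<in> A \<Longrightarrow> P (G x)" for G :: "expo \<Rightarrow> 'a mpol" and A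
    using that by (induction A rule: infinite_finite_induct) (simp_all add: P0 Padd)
  have Pall: "P f" if "\<And>\<nu>. \<nu> \<in> supp f \<Longrightarrow> P (mon \<nu>)" for f
    by (subst sum_mon_expand[of "supp f" f]) (simp_all add: Psum Pc that)
  have PE: "P (E \<nu>)" if "\<nu> \<in> D" for \<nu>
    unfolding P_def using that by (intro exI[of _ "{\<nu>}"] exI[of _ "\<lambda>_. 1"] conjI) simp_all
  have "\<nu> \<in> D \<Longrightarrow> P (mon \<nu>)" for \<nu>
    using wf_below[of n]
  proof (induction \<nu> rule: wf_induct_rule)
    case (less \<nu>)
    obtain h where h: "E \<nu> = mon \<nu> + h" "supp h \<subseteq> {\<mu>. below n \<mu> \<nu>}" using E[OF less.prems] by blast
    have "P h"
    proof (rule Pall)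
      fix \<mu> assume "\<mu> \<in> supp h"
      then have \<mu>: "below n \<mu> \<nu>" using h(2) by blast
      then show "P (mon \<mu>)" using less.IH[of \<mu>] D[OF less.prems \<mu>] by simp
    qed
    then have "P (E \<nu> + const (- 1) * h)" by (rule Padd[OF PE[OF less.prems] Pc])
    moreover have "E \<nu> + const (- 1) * h = mon \<nu>" by (simp add: h(1) const_uminus)
    ultimately show ?case by (simp only:)
  qed
  then have "P f" using f by - (rule Pall, blast)
  then show ?thesis unfolding P_def .
qed

lemma Ysep_eigenvector_exists:
  assumes "composition n \<eta>"
  shows "\<exists>E h. E = mon \<eta> + h \<and> supp h \<subseteq> {\<nu>. below n \<nu> \<eta>} \<and> Ysep E = const (ysep \<eta>) * E"
  using wf_below[of n] assms
proof (induction \<eta> rule: wf_induct_rule)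
  case (less \<eta>)
  define Q where "Q \<nu> E \<longleftrightarrow> (\<exists>h. E = mon \<nu> + h \<and> supp h \<subseteq> {\<mu>. below n \<mu> \<nu>} \<and> Ysep E = const (ysep \<nu>) * E)" for \<nu> E
  have exQ: "\<exists>E. Q \<nu> E" if \<nu>: "below n \<nu> \<eta>" for \<nu>
  proof -
    have "composition n \<nu>" using \<nu> by (simp add: below_def)
    then show ?thesis using less.IH[of \<nu>] \<nu> unfolding Q_def by simp
  qed
  have QE: "Q \<nu> (SOME E. Q \<nu> E)" if "below n \<nu> \<eta>" for \<nu>
    by (rule someI_ex[OF exQ[OF that]])
  define E where "E \<nu> = (SOME E. Q \<nu> E)" for \<nu>
  have E: "\<And>\<nu>. below n \<nu> \<eta> \<Longrightarrow>
      \<exists>h. E \<nu> = mon \<nu> + h \<and> supp h \<subseteq> {\<mu>. below n \<mu> \<nu>} \<and> Ysep (E \<nu>) = const (ysep \<nu>) * E \<nu>"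
    using QE unfolding Q_def E_def .
  obtain h where h: "Ysep (mon \<eta>) = const (ysep \<eta>) * mon \<eta> + h" "supp h \<subseteq> {\<nu>. below n \<nu> \<eta>}"
    using Ysep_mon[OF less.prems] by blast
  have "\<exists>A b. finite A \<and> A \<subseteq> {\<nu>. below n \<nu> \<eta>} \<and> h = (\<Sum>\<nu>\<in>A. const (b \<nu>) * E \<nu>)"
  proof (rule expand[OF _ _ h(2)])
    fix \<nu> \<mu> assume "\<nu> \<in> {\<nu>. below n \<nu> \<eta>}" "below n \<mu> \<nu>"
    then show "\<mu> \<in> {\<nu>. below n \<nu> \<eta>}" using below_trans by blast
  next
    fix \<nu> assume "\<nu> \<in> {\<nu>. below n \<nu> \<eta>}"
    then show "\<exists>h. E \<nu> = mon \<nu> + h \<and> supp h \<subseteq> {\<mu>. below n \<mu> \<nu>}" using E by blast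
  qed
  then obtain A b where A: "finite A" "A \<subseteq> {\<nu>. below n \<nu> \<eta>}" "h = (\<Sum>\<nu>\<in>A. const (b \<nu>) * E \<nu>)" by blast
  \<comment> \<open>Solves (\<open>ysep \<eta>\<close> - \<open>Ysep\<close>) g = h in the
    eigenbasis already constructed below \<eta>; the eigenvalue differences are nonzero by
    \<open>ysep_inj\<close>.\<close>
  define g where "g = (\<Sum>\<nu>\<in>A. const (b \<nu> / (ysep \<eta> - ysep \<nu>)) * E \<nu>)"
  have ne: "ysep \<eta> \<noteq> ysep \<nu>" if "\<nu> \<in> A" for \<nu>
  proof
    assume eq: "ysep \<eta> = ysep \<nu>"
    have b: "below n \<nu> \<eta>" using A(2) that by blast
    then have "composition n \<nu>" by (simp add: below_def)
    then show False using ysep_inj[OF eq less.prems] below_irrefl b by simp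
  qed
  have "supp g \<subseteq> {\<nu>. below n \<nu> \<eta>}"
    unfolding g_def
  proof (intro supp_sum_subset supp_const_mult_subset)
    fix \<nu> assume "\<nu> \<in> A"
    then have \<nu>: "below n \<nu> \<eta>" using A(2) by blast
    then obtain k where k: "E \<nu> = mon \<nu> + k" "supp k \<subseteq> {\<mu>. below n \<mu> \<nu>}" using E[OF \<nu>] by blast
    have "{\<mu>. below n \<mu> \<nu>} \<subseteq> {\<mu>. below n \<mu> \<eta>}" using below_trans[OF _ \<nu>] by blast
    then show "supp (E \<nu>) \<subseteq> {\<mu>. below n \<mu> \<eta>}"
      unfolding k(1) using \<nu> k(2) by (intro supp_add_subset) (simp, blast)
  qed
  moreover have "Ysep (mon \<eta> + g) = const (ysep \<eta>) * (mon \<eta> + g)"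
  proof -
    have "h + Ysep g = (\<Sum>\<nu>\<in>A. const (b \<nu>) * E \<nu> + const (b \<nu> / (ysep \<eta> - ysep \<nu>)) * (const (ysep \<nu>) * E \<nu>))"
    proof -
      have "Ysep (E \<nu>) = const (ysep \<nu>) * E \<nu>" if "\<nu> \<in> A" for \<nu> using E[of \<nu>] A(2) that by blast
      then show ?thesis by (simp add: A(3) g_def Ysep_sum Ysep_linear sum.distrib)
    qed
    also have "\<dots> = (\<Sum>\<nu>\<in>A. const (ysep \<eta>) * (const (b \<nu> / (ysep \<eta> - ysep \<nu>)) * E \<nu>))"
    proof (rule sum.cong[OF HOL.refl])
      fix \<nu> assume "\<nu> \<in> A"
      then have "b \<nu> + b \<nu> / (ysep \<eta> - ysep \<nu>) * ysep \<nu> = ysep \<eta> * (b \<nu> / (ysep \<eta> - ysep \<nu>))"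
        using ne[of \<nu>] by (simp add: field_simps)
      then have "const (b \<nu> + b \<nu> / (ysep \<eta> - ysep \<nu>) * ysep \<nu>) * E \<nu> = const (ysep \<eta> * (b \<nu> / (ysep \<eta> - ysep \<nu>))) * E \<nu>"
        by (simp only:)
      then show "const (b \<nu>) * E \<nu> + const (b \<nu> / (ysep \<eta> - ysep \<nu>)) * (const (ysep \<nu>) * E \<nu>)
          = const (ysep \<eta>) * (const (b \<nu> / (ysep \<eta> - ysep \<nu>)) * E \<nu>)"
        by (simp only: const_add const_mult distrib_right mult.assoc)
    qed
    also have "\<dots> = const (ysep \<eta>) * g" by (simp add: g_def sum_distrib_left)
    finally show ?thesis by (simp add: Ysep_linear h(1) distrib_left add.assoc)
  qed
  ultimately show ?case by blast
qed

lemma Y_supp: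
  assumes "supp f \<subseteq> Collect (composition n)" "i \<in> {1..n}"
  shows "supp (Y i f) \<subseteq> Collect (composition n)"
proof (rule supp_linear[where F = "Y i"])
  fix \<nu> assume "\<nu> \<in> supp f"
  then have \<nu>: "composition n \<nu>" using assms by blast
  obtain h where h: "Y i (mon \<nu>) = const (eigval q t n \<nu> i) * mon \<nu> + h" "supp h \<subseteq> {\<mu>. below n \<mu> \<nu>}"
    using Y_mon[OF \<nu> assms(2)] by blast
  show "supp (Y i (mon \<nu>)) \<subseteq> Collect (composition n)"
    unfolding h(1)
    by (rule supp_add_subset[OF supp_const_mult_subset supp_below_chain[OF h(2)]]) (simp add: \<nu>)
qed (simp_all add: Y_add Y_const_mult)

lemma Ysep_Y: "i \<in> {1..n} \<Longrightarrow> Ysep (Y i f) = Y i (Ysep f)"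
  unfolding Ysep_def Y_sum Y_const_mult by (intro sum.cong HOL.refl arg_cong[of _ _ "(*) _"] Y_comm)

text \<open>Y_i commutes with \<open>Ysep\<close>, whose eigenspace for \<open>ysep \<eta>\<close>
  is one-dimensional. So the \<open>Ysep\<close>-eigenvector is an eigenvector of every Y_i, with
  eigenvalue read off at the leading exponent \<eta>.\<close>

lemma is_macdonald_E_exists:
  assumes \<eta>: "composition n \<eta>"
  shows "\<exists>h. is_macdonald_E q t n \<eta> (mon \<eta> + h) \<and> supp h \<subseteq> {\<nu>. below n \<nu> \<eta>}"
proof -
  obtain E h where E: "E = mon \<eta> + h" "supp h \<subseteq> {\<nu>. below n \<nu> \<eta>}" "Ysep E = const (ysep \<eta>) * E"
    using Ysep_eigenvector_exists[OF \<eta>] by blast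
  have "\<eta> \<notin> supp h" using E(2) below_irrefl[of n \<eta>] by blast
  then have h0: "coef h \<eta> = 0" by (simp add: in_keys_iff)
  have sE: "\<mu> = \<eta> \<or> below n \<mu> \<eta>" if "\<mu> \<in> supp E" for \<mu>
  proof -
    have "\<mu> \<in> supp (mon \<eta> :: 'a mpol) \<or> \<mu> \<in> supp h"
      using that keys_add[of "mon \<eta>" h] unfolding E(1) by blast
    then show ?thesis using E(2) by auto
  qed
  have E1: "coef E \<eta> = 1" by (simp add: E(1) lookup_add h0)
  have Es: "supp E \<subseteq> Collect (composition n)"
    unfolding E(1) by (rule supp_add_subset[OF _ supp_below_chain[OF E(2)]]) (simp add: \<eta>)
  have m: "\<not> below n \<eta> \<mu>" if "\<mu> \<in> supp E" for \<mu>
    using sE[OF that] below_irrefl[of n \<eta>] below_trans[of n \<eta> \<mu> \<eta>] by blast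
  have "Y i E = const (eigval q t n \<eta> i) * E" if i: "i \<in> {1..n}" for i
  proof -
    have "Y i E = const (coef (Y i E) \<eta>) * E"
      by (rule Ysep_unique[OF E1 Es E(3) \<eta> Y_supp[OF Es i]]) (simp add: Ysep_Y[OF i] E(3) Y_const_mult)
    also have "coef (Y i E) \<eta> = eigval q t n \<eta> i * coef E \<eta>"
      by (rule triangular_coef[where F = "Y i", OF Y_add Y_const_mult Y_mon[OF _ i] Es m])
    finally show ?thesis by (simp add: E1)
  qed
  moreover have "composition n \<nu> \<and> prec n \<nu> \<eta>" if "\<nu> \<in> supp E" "\<nu> \<noteq> \<eta>" for \<nu>
  proof -
    have "below n \<nu> \<eta>" using sE[OF that(1)] that(2) by blast
    then show ?thesis using below_prec[of n \<nu> \<eta>] by (simp add: below_def)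
  qed
  ultimately have "is_macdonald_E q t n \<eta> E"
    unfolding is_macdonald_E_def using E1 by blast
  then show ?thesis using E(1,2) by blast
qed

lemma eigen_Ysep:
  assumes "\<And>i. i \<in> {1..n} \<Longrightarrow> Y i f = const (eigval q t n \<eta> i) * f"
  shows "Ysep f = const (ysep \<eta>) * f"
proof -
  have "Ysep f = (\<Sum>i=1..n. const (of_nat i * eigval q t n \<eta> i) * f)"
    unfolding Ysep_def by (rule sum.cong) (simp_all add: assms const_mult mult.assoc)
  then show ?thesis by (simp add: ysep_def const_sum sum_distrib_right)
qed

abbreviation "E \<equiv> macdonald_E q t n"

lemma is_macdonald_E_supp:
  "is_macdonald_E q t n \<eta> f \<Longrightarrow> composition n \<eta> \<Longrightarrow> supp f \<subseteq> Collect (composition n)"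
  by (auto simp: is_macdonald_E_def)

text \<open>The uniqueness argument asks only that all exponents be compositions, so it covers every
  candidate that is triangular for \<open>prec\<close>.\<close>

lemma macdonald_E_eqI:
  assumes \<eta>: "composition n \<eta>" and f: "is_macdonald_E q t n \<eta> f"
  shows "E \<eta> = f"
  unfolding macdonald_E_def
proof (rule the_equality)
  show "is_macdonald_E q t n \<eta> f" by fact
  fix g assume g: "is_macdonald_E q t n \<eta> g"
  have Ye: "Ysep h = const (ysep \<eta>) * h" if "is_macdonald_E q t n \<eta> h" for h
    by (rule eigen_Ysep) (use that in \<open>simp add: is_macdonald_E_def\<close>)
  have "coef f \<eta> = 1" using f by (simp add: is_macdonald_E_def)
  from Ysep_unique[OF this is_macdonald_E_supp[OF f \<eta>] Ye[OF f] \<eta> is_macdonald_E_supp[OF g \<eta>] Ye[OF g]]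
  have "g = const (coef g \<eta>) * f" .
  then show "g = f" using g by (simp add: is_macdonald_E_def)
qed

lemma
  assumes "composition n \<eta>"
  shows macdonald_E: "is_macdonald_E q t n \<eta> (E \<eta>)"
    and macdonald_E_mon: "\<exists>h. E \<eta> = mon \<eta> + h \<and> supp h \<subseteq> {\<nu>. below n \<nu> \<eta>}"
  using is_macdonald_E_exists[OF assms] macdonald_E_eqI[OF assms] by auto

lemma eigen_unique:
  assumes "composition n \<eta>" "supp f \<subseteq> Collect (composition n)"
    and "\<And>i. i \<in> {1..n} \<Longrightarrow> Y i f = const (eigval q t n \<eta> i) * f"
  shows "f = const (coef f \<eta>) * E \<eta>"
proof (rule Ysep_unique[OF _ _ _ assms(1,2)])
  show "Ysep f = const (ysep \<eta>) * f" by (rule eigen_Ysep) (rule assms(3))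
  show "coef (E \<eta>) \<eta> = 1" using macdonald_E[OF assms(1)] by (simp add: is_macdonald_E_def)
  show "supp (E \<eta>) \<subseteq> Collect (composition n)"
    by (rule is_macdonald_E_supp[OF macdonald_E[OF assms(1)] assms(1)])
  show "Ysep (E \<eta>) = const (ysep \<eta>) * E \<eta>"
    by (rule eigen_Ysep) (use macdonald_E[OF assms(1)] in \<open>simp add: is_macdonald_E_def\<close>)
qed

end

section \<open>Symmetric and antisymmetric Macdonald polynomials\<close>

lemma T_op_1: "T_op t i 1 = const t"
  by (rule T_op_unique) (simp add: const_diff algebra_simps)

lemma T_op_sym: "swap_op i f = f \<Longrightarrow> T_op t i f = const t * f"
  using T_op_mult_sym[of i f t 1] by (simp add: T_op_1 mult.commute)

lemma const_var_diff_neq_0: "const t * var i - var (Suc i) \<noteq> (0 :: 'a::field mpol)"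
proof
  let ?e = "Poly_Mapping.single (Suc i) (1::nat)"
  assume "const t * var i - var (Suc i) = (0 :: 'a mpol)"
  then have "coef (const t * var i - var (Suc i) :: 'a mpol) ?e = 0" by simp
  moreover have "Poly_Mapping.single i (1::nat) \<noteq> ?e"
  proof
    assume e: "Poly_Mapping.single i (1::nat) = ?e"
    have "lk (Poly_Mapping.single i 1) i = 1" by (rule lookup_single_eq)
    then show False unfolding e by (simp add: lookup_single_not_eq)
  qed
  ultimately show False
    by (simp add: lookup_minus var_def lookup_single when_def)
qed

lemma swap_op_eq_if_T_op:
  assumes "T_op t i f = const t * f"
  shows "swap_op i f = f"
proof -
  have "(var i - var (Suc i)) * (const t * f)
    = const (1 - t) * var (Suc i) * f + (const t * var i - var (Suc i)) * swap_op i f"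
    using T_op_char[of i t f] unfolding assms .
  then have "(const t * var i - var (Suc i)) * swap_op i f = (const t * var i - var (Suc i)) * f"
    by (simp add: const_diff algebra_simps)
  then show ?thesis using const_var_diff_neq_0[of t i] by (simp only: mult_cancel_left) simp
qed

text \<open>Sets of exponents whose span is preserved by every T_i, and therefore by the
  symmetrisers.\<close>

definition lower_closed :: "nat \<Rightarrow> expo set \<Rightarrow> bool" where
  "lower_closed n S \<longleftrightarrow> S \<subseteq> Collect (composition n) \<and>
     (\<forall>\<nu>\<in>S. \<forall>\<mu>. composition n \<mu> \<and> (is_permutation_of n \<mu> \<nu> \<or> lower n \<mu> \<nu>) \<longrightarrow> \<mu> \<in> S)"

lemma lower_closed_composition: "lower_closed n (Collect (composition n))"
  by (simp add: lower_closed_def)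

lemma lower_closed_low_set: "lower_closed n (low_set n \<kappa>)"
  unfolding lower_closed_def low_set_def
proof (intro conjI ballI allI impI)
  show "{\<mu>. lower n \<mu> \<kappa>} \<subseteq> Collect (composition n)" by (auto simp: lower_def)
  fix \<nu> \<mu> assume "\<nu> \<in> {\<mu>. lower n \<mu> \<kappa>}" "composition n \<mu> \<and> (is_permutation_of n \<mu> \<nu> \<or> lower n \<mu> \<nu>)"
  then show "\<mu> \<in> {\<mu>. lower n \<mu> \<kappa>}"
    using lower_perm1[of n \<mu> \<nu> \<kappa>] lower_trans[of n \<mu> \<nu> \<kappa>] by blast
qed

definition weak_low_set :: "nat \<Rightarrow> expo \<Rightarrow> expo set" where
  "weak_low_set n \<kappa> = {\<nu>. composition n \<nu> \<and> (lower n \<nu> \<kappa> \<or> is_permutation_of n \<nu> \<kappa>)}"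

lemma lower_closed_weak_low_set: "lower_closed n (weak_low_set n \<kappa>)"
  unfolding lower_closed_def
proof (intro conjI ballI allI impI)
  show "weak_low_set n \<kappa> \<subseteq> Collect (composition n)" by (auto simp: weak_low_set_def)
  fix \<nu> \<mu> assume "\<nu> \<in> weak_low_set n \<kappa>" "composition n \<mu> \<and> (is_permutation_of n \<mu> \<nu> \<or> lower n \<mu> \<nu>)"
  then show "\<mu> \<in> weak_low_set n \<kappa>"
    unfolding weak_low_set_def
    using lower_perm1[of n \<mu> \<nu> \<kappa>] lower_perm2[of n \<mu> \<nu> \<kappa>] lower_trans[of n \<mu> \<nu> \<kappa>]
      is_permutation_of_trans[of n \<mu> \<nu> \<kappa>] by blast
qed

lemma lower_closed_below: "lower_closed n S \<Longrightarrow> \<nu> \<in> S \<Longrightarrow> below n \<mu> \<nu> \<Longrightarrow> \<mu> \<in> S"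
  unfolding lower_closed_def below_def by blast

lemma supp_T_op:
  assumes "lower_closed n S" "i \<in> {1..<n}" "supp f \<subseteq> S"
  shows "supp (T_op t i f) \<subseteq> S"
  using lower_stable_T_op[OF assms(2), of t] assms(1,3) unfolding lower_stable_def lower_closed_def by blast

lemma supp_word_op_T:
  assumes "lower_closed n S" "set w \<subseteq> {1..<n}" "supp f \<subseteq> S"
  shows "supp (word_op (T_op t) w f) \<subseteq> S"
  using assms(2)
proof (induction w)
  case (Cons i w)
  then show ?case using supp_T_op[OF assms(1), of i] by (simp add: word_op_Cons)
qed (simp add: assms(3))

lemma supp_U_sym:
  assumes "lower_closed n S" "supp f \<subseteq> S"
  shows "supp (U_sym x t n f) \<subseteq> S"
  unfolding U_sym_def
proof (intro supp_sum_subset supp_const_mult_subset)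
  fix \<sigma> assume "\<sigma> \<in> {\<sigma>. \<sigma> permutes {1..n}}"
  then obtain w where w: "reduced_word n \<sigma> w" using reduced_word_exists by blast
  then have "set w \<subseteq> {1..<n}" by (simp add: reduced_word_def)
  then show "supp (T_perm t n \<sigma> f) \<subseteq> S"
    unfolding T_perm_word[OF w] by (rule supp_word_op_T[OF assms(1) _ assms(2)])
qed

lemma U_sym_comm:
  assumes add: "\<And>f g. F (f + g) = F f + F g" and c: "\<And>c f. F (const c * f) = const c * F f"
    and T: "\<And>i f. i \<in> {1..<n} \<Longrightarrow> F (T_op t i f) = T_op t i (F f)"
  shows "F (U_sym x t n f) = U_sym x t n (F f)"
proof -
  have "F 0 = 0" using c[of 0 0] by simp
  then have s: "F (sum G A) = (\<Sum>x\<in>A. F (G x))" for G :: "(nat \<Rightarrow> nat) \<Rightarrow> 'a mpol" and A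
    by (induction A rule: infinite_finite_induct) (simp_all add: add)
  have "F (T_perm t n \<sigma> f) = T_perm t n \<sigma> (F f)" if "\<sigma> permutes {1..n}" for \<sigma>
  proof -
    obtain w where w: "reduced_word n \<sigma> w" using reduced_word_exists[OF \<open>\<sigma> permutes {1..n}\<close>] by blast
    then have "set w \<subseteq> {1..<n}" by (simp add: reduced_word_def)
    then show ?thesis unfolding T_perm_word[OF w] by (intro word_op_comm T) blast
  qed
  then show ?thesis unfolding U_sym_def s c by (intro sum.cong HOL.refl arg_cong[of _ _ "(*) _"]) blast
qed

definition pe :: "(nat \<Rightarrow> nat) \<Rightarrow> expo \<Rightarrow> expo" where
  "pe \<sigma> \<kappa> = Poly_Mapping.map_key \<sigma> \<kappa>"

lemma lk_pe: "\<sigma> permutes A \<Longrightarrow> lk (pe \<sigma> \<kappa>) k = lk \<kappa> (\<sigma> k)"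
  by (simp add: pe_def map_key.rep_eq permutes_inj)

text \<open>The monomial symmetric polynomial times the order of the stabiliser of \<kappa>.\<close>

definition msym :: "nat \<Rightarrow> expo \<Rightarrow> 'a::field mpol" where
  "msym n \<kappa> = (\<Sum>\<sigma> | \<sigma> permutes {1..n}. mon (pe \<sigma> \<kappa>))"

lemma swap_op_msym:
  assumes "i \<in> {1..<n}"
  shows "swap_op i (msym n \<kappa>) = msym n \<kappa>"
proof -
  let ?s = "transpose i (Suc i)"
  have s: "?s permutes {1..n}" using assms by (auto intro: permutes_swap_id)
  have sp: "\<sigma> \<circ> ?s permutes {1..n}" if "\<sigma> permutes {1..n}" for \<sigma>
    by (rule permutes_compose[OF s that])
  have "sw i (pe \<sigma> \<kappa>) = pe (\<sigma> \<circ> ?s) \<kappa>" if "\<sigma> permutes {1..n}" for \<sigma>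
    by (rule poly_mapping_eqI) (simp add: lk_sw lk_pe[OF that] lk_pe[OF sp[OF that]])
  then have "swap_op i (msym n \<kappa>) = (\<Sum>\<sigma> | \<sigma> permutes {1..n}. mon (pe (\<sigma> \<circ> ?s) \<kappa>))"
    unfolding msym_def swap_op_hom swap_op_mon by (intro sum.cong HOL.refl) simp
  also have "\<dots> = msym n \<kappa>"
    unfolding msym_def
    by (rule sum.reindex_bij_witness[of _ "\<lambda>\<sigma>. \<sigma> \<circ> ?s" "\<lambda>\<sigma>. \<sigma> \<circ> ?s"])
       (use sp in \<open>auto simp only: mem_Collect_eq comp_assoc transpose_comp_involutory comp_id\<close>)
  finally show ?thesis .
qed

lemma supp_msym:
  assumes "composition n \<kappa>"
  shows "supp (msym n \<kappa>) \<subseteq> weak_low_set n \<kappa>"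
  unfolding msym_def
proof (rule supp_sum_subset)
  fix \<sigma> assume "\<sigma> \<in> {\<sigma>. \<sigma> permutes {1..n}}"
  then have \<sigma>: "\<sigma> permutes {1..n}" by simp
  have "is_permutation_of n (pe \<sigma> \<kappa>) \<kappa>"
    unfolding is_permutation_of_def using \<sigma> lk_pe[OF \<sigma>] by blast
  moreover have "composition n (pe \<sigma> \<kappa>)"
    using assms permutes_not_in[OF \<sigma>] unfolding composition_lk lk_pe[OF \<sigma>] by metis
  ultimately show "supp (mon (pe \<sigma> \<kappa>)) \<subseteq> weak_low_set n \<kappa>" by (simp add: weak_low_set_def)
qed

context macdonald_generic begin

section \<open>Intertwiners and symmetrised E's\<close>

lemma monomial_neq: "a \<noteq> b \<Longrightarrow> q ^ a * t ^ c \<noteq> q ^ b * t ^ d"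
  using generic_families[of "{0::nat}" "{0::nat}" "\<lambda>_. 1" "\<lambda>_. a" "\<lambda>_. c" "\<lambda>_. 1" "\<lambda>_. b" "\<lambda>_. d" "(a, c)"]
  by auto

lemma eigval_neq:
  assumes "lk \<eta> i \<noteq> lk \<mu> j"
  shows "t ^ r * eigval q t n \<eta> i \<noteq> t ^ s * eigval q t n \<mu> j"
proof
  let ?k = "leg_colength n \<eta> i" and ?m = "leg_colength n \<mu> j"
  have c: "t ^ l * inverse t ^ l = 1" for l unfolding power_mult_distrib[symmetric] by simp
  assume eq: "t ^ r * eigval q t n \<eta> i = t ^ s * eigval q t n \<mu> j"
  have "q ^ lk \<eta> i * t ^ (r + ?m) * (t ^ ?k * inverse t ^ ?k) = t ^ ?k * t ^ ?m * (t ^ r * eigval q t n \<eta> i)"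
    by (simp add: eigval_def power_add mult_ac)
  also have "\<dots> = t ^ ?k * t ^ ?m * (t ^ s * eigval q t n \<mu> j)" by (simp only: eq)
  also have "\<dots> = q ^ lk \<mu> j * t ^ (s + ?k) * (t ^ ?m * inverse t ^ ?m)"
    by (simp add: eigval_def power_add mult_ac)
  finally show False using monomial_neq[OF assms] unfolding c by simp
qed

lemma E_supp: "composition n \<eta> \<Longrightarrow> supp (E \<eta>) \<subseteq> Collect (composition n)"
  by (rule is_macdonald_E_supp[OF macdonald_E])

lemma E_coef: "composition n \<eta> \<Longrightarrow> coef (E \<eta>) \<eta> = 1"
  and E_Y: "composition n \<eta> \<Longrightarrow> i \<in> {1..n} \<Longrightarrow> Y i (E \<eta>) = const (eigval q t n \<eta> i) * E \<eta>"
  using macdonald_E by (simp_all add: is_macdonald_E_def)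

text \<open>The combination has the eigenvalues of E \<eta> with those at i and i + 1 exchanged, so
  uniqueness identifies it up to a scalar. The exclusions \<gamma> = 1 and \<gamma> = -t are what
  keeps the symmetrisers from annihilating it.\<close>

lemma T_E:
  assumes \<eta>: "composition n \<eta>" and i: "i \<in> {1..<n}" and ne: "lk \<eta> i \<noteq> lk \<eta> (Suc i)"
  shows "\<exists>b \<gamma>. b \<noteq> 0 \<and> \<gamma> \<noteq> 1 \<and> \<gamma> \<noteq> - t \<and> T i (E \<eta>) + const \<gamma> * E \<eta> = const b * E (sw i \<eta>)"
proof -
  define y y' where "y = eigval q t n \<eta> i" and "y' = eigval q t n \<eta> (Suc i)"
  \<comment> \<open>Forced by \<open>Y_T_same\<close>: the coefficient of E \<eta> in Y_i f is (t -
    1) y + \<gamma> y, and it must equal \<gamma> y' for f to have eigenvalue y'.\<close>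
  define \<gamma> where "\<gamma> = (t - 1) * y / (y' - y)"
  define f where "f = T i (E \<eta>) + const \<gamma> * E \<eta>"
  have yy: "y \<noteq> y'" "t * y \<noteq> y'" "y \<noteq> t * y'"
    using eigval_neq[OF ne, of 0 0] eigval_neq[OF ne, of 1 0] eigval_neq[OF ne, of 0 1]
    by (simp_all add: y_def y'_def)
  have \<gamma>: "\<gamma> * (y' - y) = (t - 1) * y" using yy(1) by (simp add: \<gamma>_def)
  have g1: "\<gamma> \<noteq> 1" using \<gamma> yy(2) by (auto simp: algebra_simps)
  have gt: "\<gamma> \<noteq> - t"
  proof
    assume "\<gamma> = - t"
    then have "y = t * y'" using \<gamma> by (simp add: algebra_simps)
    then show False using yy(3) by simp
  qed
  have i': "1 \<le> i" "i < n" "i \<in> {1..n}" "Suc i \<in> {1..n}" using i by auto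
  have ys: "eigval q t n (sw i \<eta>) k = eigval q t n \<eta> (transpose i (Suc i) k)" for k
    by (rule eigval_sw[OF i ne])
  have Yf: "Y k f = const (eigval q t n (sw i \<eta>) k) * f" if k: "k \<in> {1..n}" for k
  proof -
    consider "k = i" | "k = Suc i" | "k \<noteq> i" "k \<noteq> Suc i" by blast
    then show ?thesis
    proof cases
      case 1
      have "Y i f = const y' * T i (E \<eta>) + const ((t - 1) * y + \<gamma> * y) * E \<eta>"
        unfolding f_def Y_add Y_const_mult Y_T_same[OF i'(1,2)] E_Y[OF \<eta> i'(3)] E_Y[OF \<eta> i'(4)] T_op_const_mult
          y_def[symmetric] y'_def[symmetric] by (simp add: const_add const_mult const_diff algebra_simps)
      also have "(t - 1) * y + \<gamma> * y = y' * \<gamma>" using \<gamma> by (simp add: algebra_simps)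
      finally show ?thesis
        by (simp add: 1 ys f_def const_mult distrib_left mult.assoc y'_def)
    next
      case 2
      have "Y (Suc i) f = const y * T i (E \<eta>) + const ((1 - t) * y + \<gamma> * y') * E \<eta>"
        unfolding f_def Y_add Y_const_mult Y_T_Suc[OF i'(1,2)] E_Y[OF \<eta> i'(3)] E_Y[OF \<eta> i'(4)] T_op_const_mult
          y_def[symmetric] y'_def[symmetric] by (simp add: const_add const_mult const_diff algebra_simps)
      also have "(1 - t) * y + \<gamma> * y' = y * \<gamma>" using \<gamma> by (simp add: algebra_simps)
      finally show ?thesis
        by (simp add: 2 ys f_def const_mult distrib_left mult.assoc y_def)
    next
      case 3
      have "T i (Y k (E \<eta>)) = Y k (T i (E \<eta>))"
        by (rule T_Y_comm) (use k 3 i in auto)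
      then show ?thesis using 3
        by (simp add: f_def Y_add Y_const_mult E_Y[OF \<eta> k] T_op_const_mult ys transpose_def distrib_left mult.left_commute flip: E_Y[OF \<eta> k])
           (simp add: E_Y[OF \<eta> k] mult.left_commute T_op_const_mult)
    qed
  qed
  have sf: "supp f \<subseteq> Collect (composition n)"
    unfolding f_def
    by (rule supp_add_subset[OF supp_T_op[OF lower_closed_composition i E_supp[OF \<eta>]] supp_const_mult_subset[OF E_supp[OF \<eta>]]])
  have f: "f = const (coef f (sw i \<eta>)) * E (sw i \<eta>)"
    by (rule eigen_unique[OF composition_sw[OF \<eta> i] sf Yf])
  \<comment> \<open>Otherwise -\<gamma> would be an eigenvalue of T_i, hence t or -1 by the
    quadratic relation.\<close>
  have "f \<noteq> 0"
  proof
    assume "f = 0"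
    then have TE: "T i (E \<eta>) = const (- \<gamma>) * E \<eta>" by (simp add: f_def const_uminus eq_neg_iff_add_eq_0)
    have "const (\<gamma> * \<gamma>) * E \<eta> = T i (T i (E \<eta>))"
      unfolding TE T_op_const_mult by (simp add: const_uminus const_mult mult.assoc)
    also have "\<dots> = const (t - 1) * T i (E \<eta>) + const t * E \<eta>" by (rule T_T)
    also have "\<dots> = const ((t - 1) * (- \<gamma>) + t) * E \<eta>"
      unfolding TE by (simp add: const_add const_diff const_uminus const_mult algebra_simps)
    finally have "coef (const (\<gamma> * \<gamma>) * E \<eta>) \<eta> = coef (const ((t - 1) * (- \<gamma>) + t) * E \<eta>) \<eta>"
      by (rule arg_cong)
    then have "\<gamma> * \<gamma> = (t - 1) * (- \<gamma>) + t" by (simp only: coef_const_mult E_coef[OF \<eta>] mult_1_right)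
    moreover have "(\<gamma> - 1) * (\<gamma> + t) = \<gamma> * \<gamma> - ((t - 1) * (- \<gamma>) + t)" by (simp add: algebra_simps)
    ultimately have "(\<gamma> - 1) * (\<gamma> + t) = 0" by (simp only: diff_self)
    then show False using g1 gt by (simp add: eq_neg_iff_add_eq_0)
  qed
  then have "coef f (sw i \<eta>) \<noteq> 0" using f by auto
  then show ?thesis using g1 gt f unfolding f_def by blast
qed

lemma U_E_sw:
  assumes x: "1 + x * (t - 1) = x * (x * t)" "x * t = t \<or> x * t = - 1"
    and \<eta>: "composition n \<eta>" and i: "i \<in> {1..<n}"
  shows "\<exists>c. c \<noteq> 0 \<and> U_sym x t n (E (sw i \<eta>)) = const c * U_sym x t n (E \<eta>)"
proof (cases "lk \<eta> i = lk \<eta> (Suc i)")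
  case True
  then show ?thesis by (intro exI[of _ 1]) (simp add: sw_eq)
next
  case False
  obtain b \<gamma> where b: "b \<noteq> 0" "\<gamma> \<noteq> 1" "\<gamma> \<noteq> - t" "T i (E \<eta>) + const \<gamma> * E \<eta> = const b * E (sw i \<eta>)"
    using T_E[OF \<eta> i False] by blast
  have "const b * U_sym x t n (E (sw i \<eta>)) = U_sym x t n (T i (E \<eta>) + const \<gamma> * E \<eta>)"
    by (simp only: b(4) U_sym_const_mult)
  also have "\<dots> = const (x * t + \<gamma>) * U_sym x t n (E \<eta>)"
    by (simp only: U_sym_add U_sym_const_mult U_sym_T_op[OF x(1) i] const_add distrib_right)
  finally have "const (1 / b) * (const b * U_sym x t n (E (sw i \<eta>))) = const (1 / b) * (const (x * t + \<gamma>) * U_sym x t n (E \<eta>))"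
    by (simp only:)
  then have "U_sym x t n (E (sw i \<eta>)) = const ((x * t + \<gamma>) / b) * U_sym x t n (E \<eta>)"
    using b(1) by (simp add: mult.assoc[symmetric] const_mult[symmetric])
  moreover have "x * t + \<gamma> \<noteq> 0"
    using x(2) b(2,3) by (auto simp: add_eq_0_iff2 minus_equation_iff[of t] add_eq_0_iff)
  ultimately show ?thesis using b(1) by (intro exI[of _ "(x * t + \<gamma>) / b"]) simp
qed

lemma U_E_perm:
  assumes x: "1 + x * (t - 1) = x * (x * t)" "x * t = t \<or> x * t = - 1"
    and "composition n \<eta>" "composition n \<mu>" "is_permutation_of n \<mu> \<eta>"
  shows "\<exists>c. c \<noteq> 0 \<and> U_sym x t n (E \<mu>) = const c * U_sym x t n (E \<eta>)"
proof -
  obtain \<pi> where \<pi>: "\<pi> permutes {1..n}" "\<forall>i\<in>{1..n}. lk \<mu> i = lk \<eta> (\<pi> i)"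
    using assms(5) by (auto simp: is_permutation_of_def)
  obtain w where w: "reduced_word n \<pi> w" using reduced_word_exists[OF \<pi>(1)] by blast
  have "set w \<subseteq> {1..<n} \<Longrightarrow> \<forall>i\<in>{1..n}. lk \<mu> i = lk \<eta> (word_perm w i) \<Longrightarrow> composition n \<eta> \<Longrightarrow>
      \<exists>c. c \<noteq> 0 \<and> U_sym x t n (E \<mu>) = const c * U_sym x t n (E \<eta>)" for w
  proof (induction w arbitrary: \<eta>)
    case Nil
    then have "\<mu> = \<eta>" using assms(4) by (intro composition_eqI[of n]) simp_all
    then show ?case by (intro exI[of _ 1]) simp
  next
    case (Cons i w)
    have i: "i \<in> {1..<n}" using Cons.prems by simp
    have "\<exists>c. c \<noteq> 0 \<and> U_sym x t n (E \<mu>) = const c * U_sym x t n (E (sw i \<eta>))"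
      by (rule Cons.IH) (use Cons.prems composition_sw[OF _ i] in \<open>auto simp: word_perm_Cons lk_sw\<close>)
    then obtain c where c: "c \<noteq> 0" "U_sym x t n (E \<mu>) = const c * U_sym x t n (E (sw i \<eta>))" by blast
    obtain d where d: "d \<noteq> 0" "U_sym x t n (E (sw i \<eta>)) = const d * U_sym x t n (E \<eta>)"
      using U_E_sw[OF x Cons.prems(3) i] by blast
    show ?case using c(1) d(1) by (intro exI[of _ "c * d"]) (simp add: c(2) d(2) const_mult mult.assoc)
  qed
  from this[of w] show ?thesis using w \<pi>(2) assms(3) by (simp add: reduced_word_def)
qed

text \<open>Collecting equal powers of t leaves positive integer coefficients, which cannot cancel
  for generic t.\<close>

lemma poincare_neq_0:
  "(\<Sum>\<sigma> | \<sigma> permutes {1..n}. t ^ perm_length n \<sigma>) \<noteq> 0" (is ?thesis1)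
  "(\<Sum>\<sigma> | \<sigma> permutes {1..n}. inverse t ^ perm_length n \<sigma>) \<noteq> 0" (is ?thesis2)
proof -
  let ?P = "{\<sigma>. \<sigma> permutes {1..n}}" and ?l = "perm_length n"
  have fin: "finite ?P" by (rule finite_permutations) simp
  have key: "(\<Sum>\<sigma>\<in>?P. t ^ b \<sigma>) \<noteq> 0" for b :: "(nat \<Rightarrow> nat) \<Rightarrow> nat"
  proof
    assume z: "(\<Sum>\<sigma>\<in>?P. t ^ b \<sigma>) = 0"
    define S where "S = b ` ?P"
    have "(\<Sum>x\<in>(\<lambda>m. (0::nat, m)) ` S. of_int (int (card {\<sigma>\<in>?P. b \<sigma> = snd x})) * q ^ fst x * t ^ snd x)
       = (\<Sum>m\<in>S. of_nat (card {\<sigma>\<in>?P. b \<sigma> = m}) * t ^ m)"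
      by (subst sum.reindex) (simp_all add: inj_on_def)
    also have "\<dots> = (\<Sum>m\<in>S. \<Sum>\<sigma>\<in>{\<sigma>\<in>?P. b \<sigma> = m}. t ^ b \<sigma>)"
    proof (rule sum.cong[OF HOL.refl])
      fix m assume "m \<in> S"
      have "(\<Sum>\<sigma>\<in>{\<sigma>\<in>?P. b \<sigma> = m}. t ^ b \<sigma>) = (\<Sum>\<sigma>\<in>{\<sigma>\<in>?P. b \<sigma> = m}. t ^ m)"
        by (rule sum.cong) simp_all
      then show "of_nat (card {\<sigma>\<in>?P. b \<sigma> = m}) * t ^ m = (\<Sum>\<sigma>\<in>{\<sigma>\<in>?P. b \<sigma> = m}. t ^ b \<sigma>)"
        by (simp only: sum_constant)
    qed
    also have "\<dots> = (\<Sum>\<sigma>\<in>?P. t ^ b \<sigma>)"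
      unfolding S_def by (rule sum.group[OF fin finite_imageI[OF fin] order_refl])
    finally have e: "(\<Sum>x\<in>(\<lambda>m. (0::nat, m)) ` S. of_int (int (card {\<sigma>\<in>?P. b \<sigma> = snd x})) * q ^ fst x * t ^ snd x) = 0"
      by (simp only: z)
    have id: "id \<in> ?P" by (simp add: permutes_id)
    have "int (card {\<sigma>\<in>?P. b \<sigma> = snd (0::nat, b id)}) = 0"
    proof (rule generic)
      show "finite ((\<lambda>m. (0::nat, m)) ` S)" unfolding S_def using fin by (intro finite_imageI)
      show "(\<Sum>(x, y)\<in>(\<lambda>m. (0::nat, m)) ` S. of_int (int (card {\<sigma>\<in>?P. b \<sigma> = snd (x, y)})) * q ^ x * t ^ y) = 0"
        using e by (simp only: case_prod_unfold prod.collapse)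
      show "(0, b id) \<in> (\<lambda>m. (0::nat, m)) ` S" unfolding S_def using id by (intro imageI)
    qed
    then have "card {\<sigma>\<in>?P. b \<sigma> = b id} = 0" by (simp only: snd_conv of_nat_eq_0_iff)
    moreover have "finite {\<sigma>\<in>?P. b \<sigma> = b id}" using fin by simp
    ultimately have "{\<sigma>\<in>?P. b \<sigma> = b id} = {}" by (simp only: card_0_eq)
    then show False using id by blast
  qed
  show ?thesis1 by (rule key)
  \<comment> \<open>A crude common bound of all lengths; multiplying by t^N turns the negative
    powers into nonnegative ones.\<close>
  define N where "N = (\<Sum>\<sigma>\<in>?P. ?l \<sigma>)"
  have le: "?l \<sigma> \<le> N" if "\<sigma> \<in> ?P" for \<sigma>
    unfolding N_def by (rule member_le_sum[OF that _ fin]) simp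
  have "t ^ N * inverse t ^ ?l \<sigma> = t ^ (N - ?l \<sigma>)" if "\<sigma> \<in> ?P" for \<sigma>
  proof -
    have "t ^ N = t ^ (N - ?l \<sigma>) * t ^ ?l \<sigma>" using le[OF that] by (simp flip: power_add)
    moreover have "t ^ l * inverse t ^ l = 1" for l unfolding power_mult_distrib[symmetric] by simp
    ultimately show ?thesis by (simp add: mult.assoc)
  qed
  then have "t ^ N * (\<Sum>\<sigma>\<in>?P. inverse t ^ ?l \<sigma>) = (\<Sum>\<sigma>\<in>?P. t ^ (N - ?l \<sigma>))"
    unfolding sum_distrib_left by (intro sum.cong HOL.refl)
  then have "t ^ N * (\<Sum>\<sigma>\<in>?P. inverse t ^ ?l \<sigma>) \<noteq> 0" using key[of "\<lambda>\<sigma>. N - ?l \<sigma>"] by (simp only:) simp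
  then show ?thesis2 by (simp only: mult_eq_0_iff de_Morgan_disj not_False_eq_True)
qed

lemma expand_E:
  assumes "lower_closed n S" "supp f \<subseteq> S"
  shows "\<exists>A b. finite A \<and> A \<subseteq> S \<and> f = (\<Sum>\<nu>\<in>A. const (b \<nu>) * E \<nu>)"
proof (rule expand[OF _ _ assms(2)])
  fix \<nu> assume \<nu>: "\<nu> \<in> S"
  then show "\<exists>h. E \<nu> = mon \<nu> + h \<and> supp h \<subseteq> {\<mu>. below n \<mu> \<nu>}"
    using macdonald_E_mon[of \<nu>] assms(1) by (auto simp: lower_closed_def)
  fix \<mu> assume "below n \<mu> \<nu>"
  then show "\<mu> \<in> S" by (rule lower_closed_below[OF assms(1) \<nu>])
qed

lemma supp_E_low:
  assumes "lower_closed n S" "\<nu> \<in> S"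
  shows "supp (E \<nu>) \<subseteq> S"
proof -
  have "composition n \<nu>" using assms by (auto simp: lower_closed_def)
  then obtain h where h: "E \<nu> = mon \<nu> + h" "supp h \<subseteq> {\<mu>. below n \<mu> \<nu>}" using macdonald_E_mon by blast
  have "supp h \<subseteq> S" using h(2) lower_closed_below[OF assms] by blast
  then show ?thesis unfolding h(1) using assms(2) by (intro supp_add_subset) simp_all
qed

text \<open>U^+ multiplies \<open>msym\<close> by a nonzero scalar, and \<open>msym\<close> has a
  nonzero coefficient at \<kappa>. Expanding \<open>msym\<close> in the E's, some U^+ E \<nu> must
  reach \<kappa>. Strictly lower \<nu> cannot, since \<open>low_set\<close> is stable, so \<nu> is a
  rearrangement of \<kappa> and U^+ E \<nu> is proportional to U^+ E \<eta>.\<close>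

lemma U_plus_coef_neq_0:
  assumes \<kappa>: "composition n \<kappa>" and \<eta>: "composition n \<eta>" "is_permutation_of n \<eta> \<kappa>"
  shows "coef (U_sym 1 t n (E \<eta>)) \<kappa> \<noteq> 0"
proof -
  define C where "C = (\<Sum>\<sigma> | \<sigma> permutes {1..n}. (1 * t) ^ perm_length n \<sigma>)"
  have C: "C \<noteq> 0" using poincare_neq_0(1) by (simp add: C_def)
  have U: "U_sym 1 t n (msym n \<kappa>) = const C * msym n \<kappa>"
    unfolding C_def by (rule U_sym_eigen) (rule T_op_sym[OF swap_op_msym])
  obtain A b where A: "finite A" "A \<subseteq> weak_low_set n \<kappa>" "msym n \<kappa> = (\<Sum>\<nu>\<in>A. const (b \<nu>) * E \<nu>)"
    using expand_E[OF lower_closed_weak_low_set supp_msym[OF \<kappa>]] by blast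
  have m: "coef (msym n \<kappa> :: 'a mpol) \<kappa> \<noteq> 0"
  proof -
    let ?P = "{\<sigma>. \<sigma> permutes {1..n}}" and ?K = "{\<sigma>. \<sigma> permutes {1..n} \<and> pe \<sigma> \<kappa> = \<kappa>}"
    have fin: "finite ?P" by (rule finite_permutations) simp
    have "coef (msym n \<kappa> :: 'a mpol) \<kappa> = (\<Sum>\<sigma>\<in>?P. if pe \<sigma> \<kappa> = \<kappa> then 1 else 0)"
      unfolding msym_def lookup_sum by (rule sum.cong) (auto simp: lookup_single when_def)
    also have "\<dots> = of_nat (card ?K)"
      using fin by (subst sum.inter_filter[symmetric]) simp_all
    finally have e: "coef (msym n \<kappa> :: 'a mpol) \<kappa> = of_int (int (card ?K))" by simp
    have "pe id \<kappa> = \<kappa>" by (rule poly_mapping_eqI) (simp add: lk_pe[OF permutes_id])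
    then have "id \<in> ?K" by (simp add: permutes_id)
    moreover have "finite ?K" by (rule finite_subset[OF _ fin]) auto
    ultimately have "card ?K \<noteq> 0" using card_0_eq[of ?K] by blast
    moreover have "int (card ?K) = 0" if "of_int (int (card ?K)) = (0 :: 'a)"
      by (rule generic[of "{(0, 0)}" "\<lambda>_. int (card ?K)" "(0, 0)"]) (use that in simp_all)
    ultimately show ?thesis unfolding e by (simp only: of_nat_eq_0_iff) blast
  qed
  have "C * coef (msym n \<kappa>) \<kappa> = coef (U_sym 1 t n (msym n \<kappa>)) \<kappa>" by (simp add: U)
  also have "\<dots> = (\<Sum>\<nu>\<in>A. b \<nu> * coef (U_sym 1 t n (E \<nu>)) \<kappa>)"
    unfolding A(3) U_sym_sum U_sym_const_mult lookup_sum by simp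
  finally have "(\<Sum>\<nu>\<in>A. b \<nu> * coef (U_sym 1 t n (E \<nu>)) \<kappa>) \<noteq> 0" using C m by auto
  then obtain \<nu> where \<nu>: "\<nu> \<in> A" "coef (U_sym 1 t n (E \<nu>)) \<kappa> \<noteq> 0"
    using sum.neutral[of A "\<lambda>\<nu>. b \<nu> * coef (U_sym 1 t n (E \<nu>)) \<kappa>"] mult_zero_right by metis
  have \<nu>c: "composition n \<nu>" using \<nu>(1) A(2) by (auto simp: weak_low_set_def)
  have "\<not> lower n \<nu> \<kappa>"
  proof
    assume "lower n \<nu> \<kappa>"
    then have "supp (U_sym 1 t n (E \<nu>)) \<subseteq> low_set n \<kappa>"
      by (intro supp_U_sym[OF lower_closed_low_set] supp_E_low[OF lower_closed_low_set]) (simp add: low_set_def)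
    moreover have "\<kappa> \<in> supp (U_sym 1 t n (E \<nu>))" using \<nu>(2) by (simp add: in_keys_iff)
    ultimately show False by (auto simp: low_set_def lower_def)
  qed
  then have p: "is_permutation_of n \<nu> \<kappa>" using \<nu>(1) A(2) by (auto simp: weak_low_set_def)
  have "is_permutation_of n \<nu> \<eta>"
    by (rule is_permutation_of_trans[OF p is_permutation_of_sym[OF \<eta>(2)]])
  then have "\<exists>c. c \<noteq> 0 \<and> U_sym 1 t n (E \<nu>) = const c * U_sym 1 t n (E \<eta>)"
    by (intro U_E_perm[OF _ _ \<eta>(1) \<nu>c]) simp_all
  then obtain c where "U_sym 1 t n (E \<nu>) = const c * U_sym 1 t n (E \<eta>)" by blast
  then show ?thesis using \<nu>(2) by auto
qed

text \<open>The definition demands proportionality for all rearrangements at once;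
  \<open>U_E_perm\<close> provides it, and \<open>U_plus_coef_neq_0\<close> allows the normalisation
  at \<kappa>.\<close>

lemma macdonald_P:
  assumes \<kappa>: "composition n \<kappa>"
  shows "coef (macdonald_P q t n \<kappa>) \<kappa> = 1 \<and> (\<exists>c. macdonald_P q t n \<kappa> = const c * U_sym 1 t n (E \<kappa>))"
proof -
  let ?Q = "\<lambda>f. coef f \<kappa> = 1 \<and> (\<forall>\<eta>. composition n \<eta> \<and> is_permutation_of n \<eta> \<kappa> \<longrightarrow>
        (\<exists>c. f = const c * U_plus t n (E \<eta>)))"
  define u where "u = U_sym 1 t n (E \<kappa>)"
  have u: "coef u \<kappa> \<noteq> 0"
    unfolding u_def by (rule U_plus_coef_neq_0[OF \<kappa> \<kappa> is_permutation_of_refl])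
  define f where "f = const (1 / coef u \<kappa>) * u"
  have f1: "coef f \<kappa> = 1" using u by (simp add: f_def)
  have "?Q f"
  proof (intro conjI allI impI)
    fix \<eta> assume \<eta>: "composition n \<eta> \<and> is_permutation_of n \<eta> \<kappa>"
    have "\<exists>c. c \<noteq> 0 \<and> U_sym 1 t n (E \<kappa>) = const c * U_sym 1 t n (E \<eta>)"
      by (rule U_E_perm[OF _ _ _ \<kappa> is_permutation_of_sym]) (simp_all add: \<eta>)
    then obtain c where "u = const c * U_sym 1 t n (E \<eta>)" unfolding u_def by blast
    then have "f = const (1 / coef u \<kappa> * c) * U_plus t n (E \<eta>)"
      by (simp only: f_def U_plus_U_sym const_mult mult.assoc)
    then show "\<exists>c. f = const c * U_plus t n (E \<eta>)" by blast
  qed (rule f1)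
  moreover have "g = f" if g: "?Q g" for g
  proof -
    obtain c where c: "g = const c * u"
      using g[THEN conjunct2, rule_format, of \<kappa>] \<kappa> is_permutation_of_refl[of n \<kappa>]
      unfolding u_def U_plus_U_sym by blast
    have "c * coef u \<kappa> = 1" using g unfolding c by simp
    then have "c = 1 / coef u \<kappa>" using u by (simp add: field_simps)
    then show ?thesis by (simp add: c f_def)
  qed
  ultimately have P: "macdonald_P q t n \<kappa> = f"
    unfolding macdonald_P_def by (rule the_equality)
  show ?thesis
    unfolding P using f1 by (intro conjI exI[of _ "1 / coef u \<kappa>"]) (simp_all only: f_def u_def)
qed

lemma sum_Y_linear:
  "(\<Sum>i=1..n. Y i (f + g)) = (\<Sum>i=1..n. Y i f) + (\<Sum>i=1..n. Y i g)"
  "(\<Sum>i=1..n. Y i (const c * f)) = const c * (\<Sum>i=1..n. Y i f)"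
  by (simp_all add: Y_add Y_const_mult sum.distrib sum_distrib_left)

lemma sum_Y_E:
  assumes "composition n \<eta>"
  shows "(\<Sum>i=1..n. Y i (E \<eta>)) = const (\<Sum>i=1..n. eigval q t n \<eta> i) * E \<eta>"
  unfolding const_sum sum_distrib_right by (rule sum.cong[OF HOL.refl]) (rule E_Y[OF assms])

lemma macdonald_P_swap:
  assumes "composition n \<kappa>" "i \<in> {1..<n}"
  shows "swap_op i (macdonald_P q t n \<kappa>) = macdonald_P q t n \<kappa>"
proof -
  obtain c where c: "macdonald_P q t n \<kappa> = const c * U_sym 1 t n (E \<kappa>)" using macdonald_P[OF assms(1)] by blast
  have "T i (macdonald_P q t n \<kappa>) = const t * macdonald_P q t n \<kappa>"
    unfolding c T_op_const_mult by (subst T_op_U_sym[OF _ assms(2)]) (simp_all add: mult.left_commute)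
  then show ?thesis by (rule swap_op_eq_if_T_op)
qed

lemma macdonald_P_supp:
  assumes "composition n \<kappa>"
  shows "supp (macdonald_P q t n \<kappa>) \<subseteq> weak_low_set n \<kappa>"
proof -
  obtain c where c: "macdonald_P q t n \<kappa> = const c * U_sym 1 t n (E \<kappa>)" using macdonald_P[OF assms] by blast
  show ?thesis
    unfolding c
    by (intro supp_const_mult_subset supp_U_sym[OF lower_closed_weak_low_set] supp_E_low[OF lower_closed_weak_low_set])
       (simp add: weak_low_set_def assms is_permutation_of_refl)
qed

lemma macdonald_P_sum_Y:
  assumes "composition n \<kappa>"
  shows "(\<Sum>i=1..n. Y i (macdonald_P q t n \<kappa>)) = const (\<Sum>i=1..n. eigval q t n \<kappa> i) * macdonald_P q t n \<kappa>"
proof -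
  obtain c where c: "macdonald_P q t n \<kappa> = const c * U_sym 1 t n (E \<kappa>)" using macdonald_P[OF assms] by blast
  have "(\<Sum>i=1..n. Y i (U_sym 1 t n f)) = U_sym 1 t n (\<Sum>i=1..n. Y i f)" for f
    by (rule U_sym_comm[where F = "\<lambda>f. \<Sum>i=1..n. Y i f", OF sum_Y_linear sum_Y_T])
  then show ?thesis
    unfolding c sum_Y_linear by (simp only: sum_Y_E[OF assms] U_sym_const_mult mult.left_commute)
qed

end

section \<open>A criterion for S by antisymmetry and eigenvalue\<close>

context macdonald_generic begin

lemma E_independent:
  assumes "finite A" "A \<subseteq> Collect (composition n)" "(\<Sum>\<nu>\<in>A. const (b \<nu>) * E \<nu>) = 0" "\<nu> \<in> A"
  shows "b \<nu> = 0"
proof (rule ccontr)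
  assume "b \<nu> \<noteq> 0"
  define B where "B = {\<nu>\<in>A. b \<nu> \<noteq> 0}"
  have B: "finite B" "B \<noteq> {}" using assms(1,4) \<open>b \<nu> \<noteq> 0\<close> by (auto simp: B_def)
  obtain \<mu> where \<mu>: "\<mu> \<in> B" "\<And>\<xi>. \<xi> \<in> B \<Longrightarrow> \<not> below n \<mu> \<xi>" using exists_maximal[OF B] by blast
  have "(\<Sum>\<xi>\<in>A. b \<xi> * coef (E \<xi>) \<mu>) = (\<Sum>\<xi>\<in>A. if \<xi> = \<mu> then b \<mu> else 0)"
  proof (rule sum.cong[OF HOL.refl])
    fix \<xi> assume \<xi>: "\<xi> \<in> A"
    then have c: "composition n \<xi>" using assms(2) by blast
    obtain h where h: "E \<xi> = mon \<xi> + h" "supp h \<subseteq> {\<nu>. below n \<nu> \<xi>}" using macdonald_E_mon[OF c] by blast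
    show "b \<xi> * coef (E \<xi>) \<mu> = (if \<xi> = \<mu> then b \<mu> else 0)"
    proof (cases "\<xi> = \<mu>")
      case True
      then show ?thesis using E_coef[OF c] by simp
    next
      case False
      have "b \<xi> = 0 \<or> \<mu> \<notin> supp h" using h(2) \<mu>(2)[of \<xi>] \<xi> by (auto simp: B_def)
      then show ?thesis using False by (auto simp: h(1) lookup_add lookup_single when_def in_keys_iff)
    qed
  qed
  also have "\<dots> = b \<mu>" using \<mu>(1) assms(1) by (simp add: B_def)
  also have "(\<Sum>\<xi>\<in>A. b \<xi> * coef (E \<xi>) \<mu>) = coef (\<Sum>\<nu>\<in>A. const (b \<nu>) * E \<nu>) \<mu>"
    by (simp add: lookup_sum)
  finally show False using \<mu>(1) unfolding assms(3) by (simp add: B_def)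
qed

lemma macdonald_S_eqI:
  assumes \<kappa>: "composition n \<kappa>" and F1: "coef F \<kappa> = 1" and Fs: "supp F \<subseteq> Collect (composition n)"
    and FT: "\<And>i. i \<in> {1..<n} \<Longrightarrow> T i F = - F"
    and FY: "(\<Sum>i=1..n. Y i F) = const (\<Sum>i=1..n. eigval q t n \<kappa> i) * F"
  shows "macdonald_S q t n \<kappa> = F"
proof -
  define x where "x = - (1 / t)"
  have xt: "x * t = - 1" by (simp add: x_def)
  have x1: "1 + x * (t - 1) = x * (x * t)" unfolding xt using xt by (simp add: right_diff_distrib)
  define e where "e \<nu> = (\<Sum>i=1..n. eigval q t n \<nu> i)" for \<nu>
  define U where "U = U_sym x t n"
  define C where "C = (\<Sum>\<sigma> | \<sigma> permutes {1..n}. (x * - 1) ^ perm_length n \<sigma>)"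
  have C: "C \<noteq> 0" using poincare_neq_0(2) by (simp add: C_def x_def inverse_eq_divide)
  have UF: "U F = const C * F"
    unfolding C_def U_def by (rule U_sym_eigen) (simp add: FT const_uminus)
  obtain A b where A: "finite A" "A \<subseteq> Collect (composition n)" "F = (\<Sum>\<nu>\<in>A. const (b \<nu>) * E \<nu>)"
    using expand_E[OF lower_closed_composition Fs] by blast
  have YF: "(\<Sum>i=1..n. Y i F) = (\<Sum>\<nu>\<in>A. const (b \<nu> * e \<nu>) * E \<nu>)"
  proof -
    have "(\<Sum>i=1..n. Y i F) = (\<Sum>\<nu>\<in>A. \<Sum>i=1..n. Y i (const (b \<nu>) * E \<nu>))"
      unfolding A(3) Y_sum by (rule sum.swap)
    also have "\<dots> = (\<Sum>\<nu>\<in>A. const (b \<nu> * e \<nu>) * E \<nu>)"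
    proof (rule sum.cong[OF HOL.refl])
      fix \<nu> assume "\<nu> \<in> A"
      then have "composition n \<nu>" using A(2) by blast
      then show "(\<Sum>i=1..n. Y i (const (b \<nu>) * E \<nu>)) = const (b \<nu> * e \<nu>) * E \<nu>"
        unfolding sum_Y_linear by (simp only: sum_Y_E e_def const_mult mult.assoc)
    qed
    finally show ?thesis .
  qed
  have "(\<Sum>\<nu>\<in>A. const (b \<nu> * (e \<nu> - e \<kappa>)) * E \<nu>) = (\<Sum>i=1..n. Y i F) - const (e \<kappa>) * F"
  proof -
    have "const (e \<kappa>) * F = (\<Sum>\<nu>\<in>A. const (b \<nu> * e \<kappa>) * E \<nu>)"
      unfolding A(3) sum_distrib_left by (simp only: const_mult mult.assoc mult.left_commute mult.commute[of "b _"])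
    then show ?thesis
      unfolding YF by (simp only: right_diff_distrib const_diff left_diff_distrib sum_subtractf)
  qed
  also have "\<dots> = 0" unfolding FY e_def by simp
  finally have b: "b \<nu> = 0 \<or> e \<nu> = e \<kappa>" if "\<nu> \<in> A" for \<nu>
    using E_independent[OF A(1,2) _ that, of "\<lambda>\<nu>. b \<nu> * (e \<nu> - e \<kappa>)"] by simp
  have "\<exists>c. const (b \<nu>) * U (E \<nu>) = const c * U (E \<kappa>)" if \<nu>: "\<nu> \<in> A" for \<nu>
  proof (cases "b \<nu> = 0")
    case True
    then show ?thesis by (intro exI[of _ 0]) simp
  next
    case False
    then have "is_permutation_of n \<nu> \<kappa>" using b[OF \<nu>] eigval_sum_perm unfolding e_def by blast
    moreover have "composition n \<nu>" using A(2) \<nu> by blast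
    ultimately have "\<exists>c. c \<noteq> 0 \<and> U (E \<nu>) = const c * U (E \<kappa>)"
      unfolding U_def by (intro U_E_perm[OF x1 _ \<kappa>]) (simp_all add: xt)
    then obtain c where "U (E \<nu>) = const c * U (E \<kappa>)" by blast
    then show ?thesis by (intro exI[of _ "b \<nu> * c"]) (simp add: const_mult mult.assoc)
  qed
  then obtain c where c: "\<And>\<nu>. \<nu> \<in> A \<Longrightarrow> const (b \<nu>) * U (E \<nu>) = const (c \<nu>) * U (E \<kappa>)" by metis
  have "const C * F = (\<Sum>\<nu>\<in>A. const (b \<nu>) * U (E \<nu>))"
    unfolding UF[symmetric] by (subst A(3)) (simp only: U_def U_sym_sum U_sym_const_mult)
  also have "\<dots> = const (\<Sum>\<nu>\<in>A. c \<nu>) * U (E \<kappa>)"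
    unfolding const_sum sum_distrib_right by (rule sum.cong) (simp_all add: c)
  finally have "const (1 / C) * (const C * F) = const (1 / C) * (const (\<Sum>\<nu>\<in>A. c \<nu>) * U (E \<kappa>))" by (simp only:)
  then have FU: "F = const ((\<Sum>\<nu>\<in>A. c \<nu>) / C) * U (E \<kappa>)"
    using C by (simp add: mult.assoc[symmetric] const_mult[symmetric])
  show ?thesis
    unfolding macdonald_S_def U_minus_U_sym x_def[symmetric] U_def[symmetric]
  proof (rule the_equality)
    show "coef F \<kappa> = 1 \<and> (\<forall>\<mu>. composition n \<mu> \<and> is_permutation_of n \<mu> \<kappa> \<longrightarrow> (\<exists>c. F = const c * U (E \<mu>)))"
    proof (intro conjI allI impI F1)
      fix \<mu> assume \<mu>: "composition n \<mu> \<and> is_permutation_of n \<mu> \<kappa>"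
      have "\<exists>c. c \<noteq> 0 \<and> U (E \<kappa>) = const c * U (E \<mu>)"
        unfolding U_def by (rule U_E_perm[OF x1 _ _ \<kappa> is_permutation_of_sym]) (simp_all add: xt \<mu>)
      then obtain d where d: "U (E \<kappa>) = const d * U (E \<mu>)" by blast
      then show "\<exists>c. F = const c * U (E \<mu>)"
        by (intro exI[of _ "(\<Sum>\<nu>\<in>A. c \<nu>) / C * d"]) (simp only: FU d const_mult mult.assoc)
    qed
    fix g assume g: "coef g \<kappa> = 1 \<and> (\<forall>\<mu>. composition n \<mu> \<and> is_permutation_of n \<mu> \<kappa> \<longrightarrow> (\<exists>c. g = const c * U (E \<mu>)))"
    then obtain d where d: "g = const d * U (E \<kappa>)" using \<kappa> is_permutation_of_refl[of n \<kappa>] by blast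
    define a where "a = (\<Sum>\<nu>\<in>A. c \<nu>) / C"
    \<comment> \<open>That U^- E \<kappa> has a nonzero coefficient at \<kappa> comes from F itself,
      a multiple of it with coefficient 1 there. The normalisation then fixes the factor.\<close>
    have aX: "a * coef (U (E \<kappa>)) \<kappa> = 1" using F1 unfolding FU a_def[symmetric] by simp
    have dX: "d * coef (U (E \<kappa>)) \<kappa> = 1" using g unfolding d by simp
    have "a = a * (d * coef (U (E \<kappa>)) \<kappa>)" unfolding dX by simp
    also have "\<dots> = d * (a * coef (U (E \<kappa>)) \<kappa>)" by (rule mult.left_commute)
    also have "\<dots> = d" unfolding aX by simp
    finally have "a = d" .
    then show "g = F" unfolding d FU a_def by simp
  qed
qed

end

section \<open>Conjugation by \<open>\<Delta>\<^sub>t\<close>\<close>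

interpretation sK: braided "sK :: nat \<Rightarrow> 'a::field mpol fract \<Rightarrow> _"
  by unfold_locales (rule sK_braid, rule sK_comm)

interpretation TK: braided "TK t :: nat \<Rightarrow> 'a::field mpol fract \<Rightarrow> _" for t
  by unfold_locales (rule TK_braid, rule TK_comm)

lemma word_op_sK_hom:
  "word_op sK w (f + g) = word_op sK w f + word_op sK w g"
  "word_op sK w (f * g) = word_op sK w f * word_op sK w g"
  "word_op sK w (f - g) = word_op sK w f - word_op sK w g"
  "word_op sK w (f / g) = word_op sK w f / word_op sK w g"
  by (induction w) (simp_all add: word_op_Cons sK_hom)

lemma word_op_sK_1: "word_op sK w 1 = 1"
  by (induction w) (simp_all add: word_op_Cons)

lemma word_op_sK_prod: "word_op sK w (prod F A) = (\<Prod>x\<in>A. word_op sK w (F x))"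
  by (induction A rule: infinite_finite_induct) (simp_all add: word_op_sK_hom word_op_sK_1)

lemma word_op_sK_Kvar: "word_op sK w (Kvar l) = Kvar (word_perm w l)"
  by (induction w) (simp_all add: word_op_Cons word_perm_Cons)

lemma word_op_sK_Kconst: "word_op sK w (Kconst c) = Kconst c"
  by (induction w) (simp_all add: word_op_Cons)

lemma TK_add: "TK t i (f + g) = TK t i f + TK t i g"
  by (simp add: TK_def sK_hom add_divide_distrib[symmetric] algebra_simps)

lemma TK_0: "TK t i 0 = 0"
  by (simp add: TK_def)

lemma TK_diff: "TK t i (f - g) = TK t i f - TK t i g"
  using TK_add[of t i "f - g" g] by simp

lemma TK_sum: "TK t i (sum F A) = (\<Sum>x\<in>A. TK t i (F x))"
  by (induction A rule: infinite_finite_induct) (simp_all add: TK_add TK_0)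

lemma TK_mult_sym: "sK i g = g \<Longrightarrow> TK t i (g * f) = g * TK t i f"
  by (simp add: TK_def sK_hom algebra_simps)

lemma TK_sym:
  assumes "sK i f = f"
  shows "TK t i f = Kconst t * f"
proof -
  have "(Kconst (1 - t) * Kvar (Suc i) * f + (Kconst t * Kvar i - Kvar (Suc i)) * f) = Kconst t * f * (Kvar i - Kvar (Suc i))"
    by (simp add: const_diff algebra_simps)
  then show ?thesis unfolding TK_def assms by (simp add: nonzero_divide_eq_eq)
qed

text \<open>The factors of the coefficients in Macdonald's first-order q-difference operator. In
  \<open>pcoef\<close> the lower bound m restricts the product to the variables from m on.\<close>

definition acoef :: "'a::field \<Rightarrow> nat \<Rightarrow> nat \<Rightarrow> 'a mpol fract" where
  "acoef t k j = (Kconst t * Kvar k - Kvar j) / (Kvar k - Kvar j)"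

definition pcoef :: "'a::field \<Rightarrow> nat \<Rightarrow> nat \<Rightarrow> nat \<Rightarrow> 'a mpol fract" where
  "pcoef t n m k = (\<Prod>j\<in>{m..n} - {k}. acoef t k j)"

lemma pcoef_rec: "m \<le> n \<Longrightarrow> k \<noteq> m \<Longrightarrow> pcoef t n m k = acoef t k m * pcoef t n (Suc m) k"
proof -
  assume "m \<le> n" "k \<noteq> m"
  then have "{m..n} - {k} = insert m ({Suc m..n} - {k})" by auto
  then show ?thesis by (simp add: pcoef_def)
qed

lemma pcoef_same: "pcoef t n m m = pcoef t n (Suc m) m"
proof -
  have "{m..n} - {m} = {Suc m..n} - {m}" by auto
  then show ?thesis by (simp add: pcoef_def)
qed

lemma sK_acoef: "sK m (acoef t k j) = acoef t (transpose m (Suc m) k) (transpose m (Suc m) j)"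
  by (simp add: acoef_def sK_hom)

lemma sK_pcoef: "sK m (pcoef t n (Suc (Suc m)) k) = pcoef t n (Suc (Suc m)) (transpose m (Suc m) k)"
proof -
  have "{Suc (Suc m)..n} - {k} = {Suc (Suc m)..n} - {transpose m (Suc m) k}"
    by (auto simp: transpose_def)
  then show ?thesis
    unfolding pcoef_def sK_prod by (intro prod.cong) (auto simp: sK_acoef)
qed

text \<open>Both coefficients have the shape \<open>acoef\<close>, so 1 + T_m prolongs the products
  in \<open>pcoef\<close> by one variable.\<close>

lemma one_plus_TK: "f + TK t m f = acoef t m (Suc m) * sK m f + acoef t (Suc m) m * f"
proof -
  define x y where "x = (Kvar m :: 'a mpol fract)" and "y = (Kvar (Suc m) :: 'a mpol fract)"
  have "x \<noteq> y" by (simp add: x_def y_def)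
  then have "f + ((1 - Kconst t) * y * f + (Kconst t * x - y) * g) / (x - y)
      = (Kconst t * x - y) / (x - y) * g + (Kconst t * y - x) / (y - x) * f" for g
    by (simp add: divide_simps) (simp add: algebra_simps)
  then show ?thesis by (simp add: TK_def acoef_def const_diff x_def y_def)
qed

lemma acoef_identity:
  assumes "k \<noteq> m" "k \<noteq> l" "m \<noteq> l"
  shows "acoef t m l * acoef t k m + acoef t l m * acoef t k l - Kconst t = acoef t k m * acoef t k l"
proof -
  define x y z where "x = (Kvar m :: 'a mpol fract)" and "y = (Kvar l :: 'a mpol fract)" and "z = (Kvar k :: 'a mpol fract)"
  have "x \<noteq> y" "x \<noteq> z" "y \<noteq> z" using assms by (simp_all add: x_def y_def z_def)
  then have "(T * x - y) / (x - y) * ((T * z - x) / (z - x)) + (T * y - x) / (y - x) * ((T * z - y) / (z - y)) - T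
     = (T * z - x) / (z - x) * ((T * z - y) / (z - y))" for T
    by (simp add: divide_simps) (simp add: algebra_simps)
  then show ?thesis by (simp add: acoef_def x_def y_def z_def)
qed

text \<open>
  Explicit form of the partial symmetrisation: Macdonald's operator in the variables
  \<open>z\<^sub>m, \<dots>, z\<^sub>n\<close>. The recursion is \<open>R\<^sub>m = (1 + T\<^sub>m) R\<^bsub>m+1\<^esub> - t R\<^bsub>m+2\<^esub>\<close>.
\<close>

lemma sum_word_op_TK:
  fixes w :: "'a::field mpol fract"
  assumes w: "\<And>j. 1 \<le> j \<Longrightarrow> Suc j < n \<Longrightarrow> sK j w = w"
  shows "1 \<le> m \<Longrightarrow> m \<le> Suc n \<Longrightarrow>
    (\<Sum>i=m..n. word_op (TK t) [i..<n] w) = (\<Sum>k=m..n. pcoef t n m k * word_op sK [k..<n] w)"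
proof (induction "Suc n - m" arbitrary: m rule: less_induct)
  case less
  define R where "R m = (\<Sum>i=m..n. word_op (TK t) [i..<n] w)" for m
  define u where "u k = word_op sK [k..<n] w" for k
  consider "m = Suc n" | "m = n" | "m < n" using less.prems by linarith
  then show ?case
  proof cases
    case 1
    then show ?thesis by simp
  next
    case 2
    then show ?thesis by (simp add: pcoef_def)
  next
    case 3
    have su1: "sK m (u k) = u k" if k: "Suc m < k" "k \<le> n" for k
    proof -
      have "sK m (u k) = word_op sK [k..<n] (sK m w)"
        unfolding u_def by (rule word_op_comm) (use k in \<open>auto intro!: sK_comm\<close>)
      then show ?thesis using w[of m] less.prems k by (simp add: u_def)
    qed
    have su2: "sK m (u (Suc m)) = u m"
      using 3 by (simp add: u_def upt_conv_Cons word_op_Cons)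
    \<comment> \<open>The words in this tail sum have letters above m + 1, which commute with T_m,
      and T_m acts on w as t because s_m fixes w.\<close>
    have Rm2: "TK t m (R (Suc (Suc m))) = Kconst t * R (Suc (Suc m))"
    proof -
      have "TK t m (word_op (TK t) [i..<n] w) = Kconst t * word_op (TK t) [i..<n] w" if i: "i \<in> {Suc (Suc m)..n}" for i
      proof -
        have "TK t m (word_op (TK t) [i..<n] w) = word_op (TK t) [i..<n] (TK t m w)"
          by (rule word_op_comm) (use i in \<open>auto intro!: TK_comm\<close>)
        also have "TK t m w = Kconst t * w" using i w[of m] less.prems by (intro TK_sym) auto
        also have "word_op (TK t) v (Kconst t * w) = Kconst t * word_op (TK t) v w" for v
          by (induction v) (simp_all add: word_op_Cons TK_mult_sym)
        finally show ?thesis .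
      qed
      then show ?thesis unfolding R_def TK_sum sum_distrib_left by (intro sum.cong) auto
    qed
    have Rs: "R m = word_op (TK t) [m..<n] w + R (Suc m)" "R (Suc m) = word_op (TK t) [Suc m..<n] w + R (Suc (Suc m))"
      using 3 by (simp_all add: R_def sum.atLeast_Suc_atMost)
    have "word_op (TK t) [m..<n] w = TK t m (R (Suc m) - R (Suc (Suc m)))"
      using 3 Rs(2) by (simp add: upt_conv_Cons word_op_Cons)
    then have R1: "R m = (R (Suc m) + TK t m (R (Suc m))) - Kconst t * R (Suc (Suc m))"
      using Rs(1) by (simp add: TK_diff Rm2)
    have IH1: "R (Suc m) = (\<Sum>k=Suc m..n. pcoef t n (Suc m) k * u k)"
      unfolding R_def u_def by (rule less.hyps) (use 3 in auto)
    have IH2: "R (Suc (Suc m)) = (\<Sum>k=Suc (Suc m)..n. pcoef t n (Suc (Suc m)) k * u k)"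
      unfolding R_def u_def by (rule less.hyps) (use 3 in auto)
    let ?c = "acoef t m (Suc m)" and ?c' = "acoef t (Suc m) m"
    let ?Q = "\<lambda>k. pcoef t n (Suc (Suc m)) k" and ?S = "{Suc (Suc m)..n}"
    have S1: "R (Suc m) = ?Q (Suc m) * u (Suc m) + (\<Sum>k\<in>?S. acoef t k (Suc m) * ?Q k * u k)"
      unfolding IH1 using 3 by (simp add: sum.atLeast_Suc_atMost pcoef_same pcoef_rec)
    have S2: "sK m (R (Suc m)) = ?Q m * u m + (\<Sum>k\<in>?S. acoef t k m * ?Q k * u k)"
    proof -
      have sk: "sK m (acoef t k (Suc m) * ?Q k * u k) = acoef t k m * ?Q k * u k" if "k \<in> ?S" for k
        using that su1[of k] by (simp add: sK_hom sK_acoef sK_pcoef transpose_def)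
      have "(\<Sum>k\<in>?S. sK m (acoef t k (Suc m) * ?Q k * u k)) = (\<Sum>k\<in>?S. acoef t k m * ?Q k * u k)"
        by (rule sum.cong[OF HOL.refl]) (rule sk)
      moreover have "sK m (?Q (Suc m) * u (Suc m)) = ?Q m * u m"
        by (simp add: sK_hom sK_pcoef su2)
      ultimately show ?thesis
        unfolding S1 sK_hom(1) sK_sum by (simp only:)
    qed
    \<comment> \<open>Sorted by \<open>u k\<close>: k = m comes only from the exchanged part, k = m
      + 1 only from the fixed part, and for later k the bracket is the left side of
      \<open>acoef_identity\<close>.\<close>
    have "R m = ?c * (?Q m * u m) + ?c' * (?Q (Suc m) * u (Suc m))
       + (\<Sum>k\<in>?S. (?c * acoef t k m + ?c' * acoef t k (Suc m) - Kconst t) * (?Q k * u k))"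
      unfolding R1 one_plus_TK S2 unfolding S1 IH2
      by (simp add: sum_distrib_left sum.distrib sum_subtractf algebra_simps)
    also have "(\<Sum>k\<in>?S. (?c * acoef t k m + ?c' * acoef t k (Suc m) - Kconst t) * (?Q k * u k))
       = (\<Sum>k\<in>?S. pcoef t n m k * u k)"
    proof (rule sum.cong[OF HOL.refl])
      fix k assume "k \<in> ?S"
      then show "(?c * acoef t k m + ?c' * acoef t k (Suc m) - Kconst t) * (?Q k * u k) = pcoef t n m k * u k"
        using 3 acoef_identity[of k m "Suc m" t] by (simp add: pcoef_rec[of m n k] pcoef_rec[of "Suc m" n k] mult.assoc)
    qed
    also have "?c * (?Q m * u m) = pcoef t n m m * u m"
      using 3 by (simp add: pcoef_same pcoef_rec[of "Suc m" n m] mult.assoc)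
    also have "?c' * (?Q (Suc m) * u (Suc m)) = pcoef t n m (Suc m) * u (Suc m)"
      using 3 by (simp add: pcoef_rec[of m n "Suc m"] pcoef_same[of t n "Suc m"] mult.assoc)
    finally have "R m = (\<Sum>k=m..n. pcoef t n m k * u k)"
      using 3 by (simp add: sum.atLeast_Suc_atMost add.assoc)
    then show ?thesis unfolding R_def u_def .
  qed
qed

section \<open>The product over pairs and its behaviour under exchanges\<close>

definition pairs :: "nat \<Rightarrow> (nat \<times> nat) set" where
  "pairs n = Sigma {1..n} (\<lambda>i. {i<..n})"

lemma Delta_t_pairs: "Delta_t t n = (\<Prod>p\<in>pairs n. var (fst p) - const (inverse t) * var (snd p))"
  unfolding Delta_t_def pairs_def by (subst prod.Sigma) (auto simp: case_prod_unfold)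

lemma finite_pairs: "finite (pairs n)"
  by (simp add: pairs_def)

text \<open>s_i permutes all factors except the one for the pair (i, i + 1). The relation is
  cross-multiplied so that it stays in the polynomial ring.\<close>

lemma swap_op_Delta_t:
  assumes i: "i \<in> {1..<n}"
  shows "swap_op i (Delta_t t n) * (var i - const (inverse t) * var (Suc i))
       = Delta_t t n * (var (Suc i) - const (inverse t) * var i)"
proof -
  let ?s = "transpose i (Suc i)"
  let ?f = "\<lambda>p. var (fst p) - const (inverse t) * var (snd p) :: 'a mpol"
  let ?P = "pairs n - {(i, Suc i)}"
  have mem: "(i, Suc i) \<in> pairs n" using i by (auto simp: pairs_def)
  have D: "Delta_t t n = ?f (i, Suc i) * prod ?f ?P"
    unfolding Delta_t_pairs by (rule prod.remove[OF finite_pairs mem])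
  have pres: "map_prod ?s ?s p \<in> ?P" if p: "p \<in> ?P" for p
  proof -
    obtain a b where ab: "p = (a, b)" "1 \<le> a" "a < b" "b \<le> n" "(a, b) \<noteq> (i, Suc i)"
      using p by (cases p) (auto simp: pairs_def)
    then show ?thesis using i by (auto simp: pairs_def transpose_def)
  qed
  have "swap_op i (prod ?f ?P) = (\<Prod>p\<in>?P. ?f (map_prod ?s ?s p))"
    unfolding swap_op_hom by simp
  also have "\<dots> = prod ?f ?P"
    by (rule prod.reindex_bij_witness[of _ "map_prod ?s ?s" "map_prod ?s ?s"])
       (use pres in \<open>simp_all add: map_prod.compositionality comp_def map_prod.identity[unfolded id_def]\<close>)
  finally show ?thesis unfolding D swap_op_hom by (simp add: mult_ac)
qed

text \<open>Conjugation by \<open>\<Delta>\<^sub>t\<close> replaces \<open>t\<close> by \<open>1/t\<close> and reverses the sign of the eigenvalues.\<close>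

lemma TK_Delta_t:
  fixes t :: "'a::field"
  assumes i: "i \<in> {1..<n}" and t: "t \<noteq> 0"
  shows "TK t i (K (Delta_t t n) * f) = - Kconst t * (K (Delta_t t n) * TK (inverse t) i f)"
proof -
  define D s x y where "D = K (Delta_t t n)" and "s = Kconst (inverse t)" and "x = (Kvar i :: 'a mpol fract)"
    and "y = (Kvar (Suc i) :: 'a mpol fract)"
  have st: "Kconst t * s = 1" unfolding s_def to_fract_mult[symmetric] const_mult[symmetric] using t by simp
  have ne: "x - y \<noteq> 0" by (simp add: x_def y_def)
  have "K (swap_op i (Delta_t t n) * (var i - const (inverse t) * var (Suc i)))
       = K (Delta_t t n * (var (Suc i) - const (inverse t) * var i))"
    by (simp only: swap_op_Delta_t[OF i])
  then have sD: "sK i D * (x - s * y) = D * (y - s * x)"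
    by (simp add: sK_K D_def s_def x_def y_def)
  have "(Kconst t * x - y) * sK i D = Kconst t * (sK i D * (x - s * y)) - y * sK i D + Kconst t * s * (y * sK i D)"
    by (simp add: algebra_simps)
  also have "\<dots> = Kconst t * (D * (y - s * x))" unfolding sD st by simp
  finally have e: "(Kconst t * x - y) * sK i D = Kconst t * (D * (y - s * x))" .
  have "TK t i (D * f) = ((1 - Kconst t) * y * (D * f) + (Kconst t * x - y) * sK i D * sK i f) / (x - y)"
    by (simp add: TK_def sK_hom const_diff x_def y_def mult.assoc)
  also have "\<dots> = - Kconst t * (D * (((1 - s) * y * f + (s * x - y) * sK i f) / (x - y)))"
  proof -
    have "Kconst t * (D * ((1 - s) * y * f)) = Kconst t * (D * (y * f)) - Kconst t * s * (D * (y * f))"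
      by (simp add: algebra_simps)
    then have "Kconst t * (D * ((1 - s) * y * f)) = Kconst t * (D * (y * f)) - D * (y * f)" unfolding st by simp
    then have "(1 - Kconst t) * y * (D * f) + (Kconst t * x - y) * sK i D * sK i f
        = - Kconst t * (D * ((1 - s) * y * f + (s * x - y) * sK i f))"
      unfolding e by (simp add: algebra_simps)
    then show ?thesis by simp
  qed
  also have "((1 - s) * y * f + (s * x - y) * sK i f) / (x - y) = TK (inverse t) i f"
    by (simp add: TK_def const_diff x_def y_def s_def)
  finally show ?thesis unfolding D_def .
qed

lemma var_const_diff_neq_0: "i \<noteq> j \<Longrightarrow> var i - const c * var j \<noteq> (0 :: 'a::field mpol)"
proof
  let ?e = "Poly_Mapping.single i (1::nat)"
  assume ij: "i \<noteq> j" and "var i - const c * var j = (0 :: 'a mpol)"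
  then have "coef (var i - const c * var j :: 'a mpol) ?e = 0" by simp
  moreover have "Poly_Mapping.single j (1::nat) \<noteq> ?e"
  proof
    assume e: "Poly_Mapping.single j (1::nat) = ?e"
    have "lk (Poly_Mapping.single j 1) j = 1" by (rule lookup_single_eq)
    then show False unfolding e using ij by (simp add: lookup_single_not_eq)
  qed
  ultimately show False by (simp add: lookup_minus var_def lookup_single when_def)
qed

lemma Delta_t_neq_0: "Delta_t t n \<noteq> (0 :: 'a::field mpol)"
proof
  assume "Delta_t t n = (0 :: 'a mpol)"
  then obtain p where p: "p \<in> pairs n" "var (fst p) - const (inverse t) * var (snd p) = (0 :: 'a mpol)"
    unfolding Delta_t_pairs prod_zero_iff[OF finite_pairs] by blast
  moreover have "fst p \<noteq> snd p" using p(1) by (auto simp: pairs_def)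
  ultimately show False using var_const_diff_neq_0 by blast
qed

text \<open>On symmetric h the conjugated operator has parameter 1/t and eigenvalue 1/t; together
  with the factor -t this gives -1.\<close>

lemma T_op_Delta_t:
  assumes i: "i \<in> {1..<n}" and t: "t \<noteq> 0" and h: "swap_op i h = h"
  shows "T_op t i (Delta_t t n * h) = - (Delta_t t n * h)"
proof -
  have "Kconst t * Kconst (inverse t) = 1" unfolding to_fract_mult[symmetric] const_mult[symmetric] using t by simp
  moreover have "TK (inverse t) i (K h) = Kconst (inverse t) * K h" by (rule TK_sym) (simp add: sK_K h)
  ultimately have "K (T_op t i (Delta_t t n * h)) = K (- (Delta_t t n * h))"
    by (simp add: K_T_op TK_Delta_t[OF i t] mult.left_commute[of "Kconst t"] mult.assoc[symmetric])
  then show ?thesis by (simp only: to_fract_eq_iff)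
qed

section \<open>From \<open>t\<close> to \<open>qt\<close>\<close>

lemma to_fract_power: "to_fract (x ^ k) = to_fract x ^ k"
  by (induction k) simp_all

lemma const_eigen_inverse:
  assumes "t \<noteq> 0" "T_op t i f = const e * f" "e \<noteq> 0"
  shows "inv (T_op t i) f = const (inverse e) * f"
proof -
  interpret macdonald 1 t 1 by unfold_locales (use assms in auto)
  have "T_op t i (const (inverse e) * f) = f"
    using assms(3) by (simp add: T_op_const_mult assms(2) mult.assoc[symmetric] const_mult[symmetric])
  then show ?thesis using Ti_T[of i "const (inverse e) * f"] by simp
qed

context macdonald begin

text \<open>On a common eigenvector the inverse T's to the right of the cyclic operator become
  scalars. Used with e = t for symmetric and e = -1 for antisymmetric polynomials.\<close>

lemma Y_eigen:
  assumes f: "\<And>i. i \<in> {1..<n} \<Longrightarrow> T i f = const e * f" and e: "e \<noteq> 0" and i: "i \<in> {1..n}"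
  shows "Y i f = const (inverse t ^ (n - i) * inverse e ^ (i - 1)) * word_op T [i..<n] (om f)"
proof -
  have "word_op Ti w f = const (inverse e ^ length w) * f" if "set w \<subseteq> {1..<n}" for w
    using that
  proof (induction w)
    case (Cons j w)
    have "Ti j f = const (inverse e) * f"
      by (rule const_eigen_inverse[OF t_nz f e]) (use Cons.prems in simp)
    then show ?case using Cons by (simp add: word_op_Cons Ti_linear const_mult mult.left_commute mult.assoc)
  qed simp
  from this[of "[1..<i]"] have "word_op Ti [1..<i] f = const (inverse e ^ (i - 1)) * f" using i by auto
  then show ?thesis
    by (simp add: Y_eq om_hom word_op_T_const const_mult mult.assoc)
qed

lemma K_word_op_T: "K (word_op T w f) = word_op (TK t) w (K f)"
  by (induction w) (simp_all add: word_op_Cons K_T_op)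

text \<open>The scalars from \<open>Y_eigen\<close> are t^-(n-1) for every i, so the sum of the
  words in T applied to the shifted h remains, and \<open>sum_word_op_TK\<close> evaluates it as
  Macdonald's operator.\<close>

lemma sum_Y_sym:
  assumes h: "\<And>i. i \<in> {1..<n} \<Longrightarrow> swap_op i h = h"
  shows "K (\<Sum>i=1..n. Y i h) = Kconst (inverse t ^ (n - 1)) *
     (\<Sum>k=1..n. pcoef t n 1 k * word_op sK [k..<n] (K (om h)))"
proof -
  have Y: "Y i h = const (inverse t ^ (n - 1)) * word_op T [i..<n] (om h)" if "i \<in> {1..n}" for i
  proof -
    have "Y i h = const (inverse t ^ (n - i) * inverse t ^ (i - 1)) * word_op T [i..<n] (om h)"
      by (rule Y_eigen[OF T_op_sym[OF h] t_nz that])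
    moreover have "n - i + (i - 1) = n - 1" using that by auto
    ultimately show ?thesis by (simp only: power_add[symmetric])
  qed
  have "K (\<Sum>i=1..n. Y i h) = (\<Sum>i=1..n. K (Y i h))"
    by (induction rule: infinite_finite_induct[of _ "{1..n}"]) simp_all
  also have "\<dots> = (\<Sum>i=1..n. Kconst (inverse t ^ (n - 1)) * word_op (TK t) [i..<n] (K (om h)))"
    by (rule sum.cong[OF HOL.refl]) (simp only: Y to_fract_mult K_word_op_T)
  also have "\<dots> = Kconst (inverse t ^ (n - 1)) * (\<Sum>i=1..n. word_op (TK t) [i..<n] (K (om h)))"
    by (simp only: sum_distrib_left)
  also have "(\<Sum>i=1..n. word_op (TK t) [i..<n] (K (om h))) = (\<Sum>k=1..n. pcoef t n 1 k * word_op sK [k..<n] (K (om h)))"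
  proof (rule sum_word_op_TK)
    fix j assume j: "1 \<le> j" "Suc j < n"
    then have "swap_op j (om h) = om h" using om_swap[OF j, of h] h[of "Suc j"] by simp
    then show "sK j (K (om h)) = K (om h)" by (simp only: sK_K)
  qed simp_all
  finally show ?thesis .
qed

text \<open>Pairs (1, j) become (n, j - 1) with a factor q, and the other pairs become the pairs
  among the first N variables. The product over the latter is common to both sides.\<close>

lemma om_Delta_t:
  assumes n: "n = Suc N"
  shows "om (Delta_t t n) * (\<Prod>j=1..N. var j - const (inverse t) * var n)
       = Delta_t t n * (\<Prod>j=1..N. const q * var n - const (inverse t) * var j)"
proof -
  let ?c = "const (inverse t) :: 'a mpol"
  have S: "{1..n} = insert 1 (Suc ` {1..N})"
    unfolding image_Suc_atLeastAtMost n by auto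
  have S': "{Suc i<..n} = Suc ` {i<..N}" for i
    unfolding atLeastSucAtMost_greaterThanAtMost[symmetric] image_Suc_atLeastAtMost n ..
  have S1: "{1<..n} = Suc ` {1..N}"
    unfolding atLeastSucAtMost_greaterThanAtMost[symmetric] image_Suc_atLeastAtMost n by simp
  have v: "om (var (Suc i)) = var i" if "i \<in> {1..N}" for i
  proof -
    have "Suc i \<le> n" "1 \<le> i" using that n by simp_all
    then show ?thesis by (simp add: om_var)
  qed
  have v1: "om (var 1) = const q * var n" by (simp add: om_var)
  have "om (Delta_t t n) = (\<Prod>i\<in>{1..n}. \<Prod>j\<in>{i<..n}. om (var i) - ?c * om (var j))"
    by (simp add: Delta_t_def om_hom)
  also have "\<dots> = (\<Prod>j\<in>{1<..n}. om (var 1) - ?c * om (var j)) *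
      (\<Prod>i\<in>Suc ` {1..N}. \<Prod>j\<in>{i<..n}. om (var i) - ?c * om (var j))"
    unfolding S by (subst prod.insert) auto
  also have "(\<Prod>j\<in>{1<..n}. om (var 1) - ?c * om (var j)) = (\<Prod>j=1..N. const q * var n - ?c * var j)"
    unfolding S1 by (subst prod.reindex) (auto simp: v v1[simplified] intro!: prod.cong)
  also have "(\<Prod>i\<in>Suc ` {1..N}. \<Prod>j\<in>{i<..n}. om (var i) - ?c * om (var j)) = Delta_t t N"
  proof -
    have "(\<Prod>i\<in>Suc ` {1..N}. \<Prod>j\<in>{i<..n}. om (var i) - ?c * om (var j))
        = (\<Prod>i\<in>{1..N}. \<Prod>j\<in>{Suc i<..n}. om (var (Suc i)) - ?c * om (var j))"
      by (simp only: prod.reindex[OF inj_Suc] comp_def)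
    also have "\<dots> = (\<Prod>i\<in>{1..N}. \<Prod>j\<in>{i<..N}. om (var (Suc i)) - ?c * om (var (Suc j)))"
      by (simp only: S' prod.reindex[OF inj_Suc] comp_def)
    also have "\<dots> = Delta_t t N"
      unfolding Delta_t_def by (intro prod.cong HOL.refl) (simp add: v)
    finally show ?thesis .
  qed
  finally have 1: "om (Delta_t t n) = (\<Prod>j=1..N. const q * var n - ?c * var j) * Delta_t t N" .
  have "Delta_t t n = (\<Prod>i\<in>{1..N}. \<Prod>j\<in>{i<..n}. var i - ?c * var j)"
    unfolding Delta_t_def n by simp
  also have "\<dots> = (\<Prod>i\<in>{1..N}. (var i - ?c * var n) * (\<Prod>j\<in>{i<..N}. var i - ?c * var j))"
  proof (rule prod.cong[OF HOL.refl])
    fix i assume "i \<in> {1..N}"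
    then have "{i<..n} = insert n {i<..N}" by (auto simp: n)
    then show "(\<Prod>j\<in>{i<..n}. var i - ?c * var j) = (var i - ?c * var n) * (\<Prod>j\<in>{i<..N}. var i - ?c * var j)"
      by (simp add: n)
  qed
  also have "\<dots> = (\<Prod>j=1..N. var j - ?c * var n) * Delta_t t N"
    by (simp add: prod.distrib Delta_t_def)
  finally have 2: "Delta_t t n = (\<Prod>j=1..N. var j - ?c * var n) * Delta_t t N" .
  show ?thesis unfolding 1 by (subst 2) (simp only: mult_ac)
qed

text \<open>
  On \<open>t\<close>-antisymmetric polynomials \<open>\<Delta>\<^sub>t h\<close> the operator \<open>\<Sum>\<^sub>i Y\<^sub>i\<close> acts on \<open>h\<close> as the one with
  parameter \<open>qt\<close>: the factors of \<open>\<omega>\<^sub>0 \<Delta>\<^sub>t / \<Delta>\<^sub>t\<close> turn \<open>(z\<^sub>k/t - z\<^sub>j)\<close> into \<open>- (q z\<^sub>k - z\<^sub>j/t)\<close>.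
\<close>

lemma sum_Y_antisym:
  assumes h: "\<And>i. i \<in> {1..<n} \<Longrightarrow> swap_op i h = h" and n: "1 \<le> n"
  shows "(\<Sum>i=1..n. Y i (Delta_t t n * h))
       = const (q ^ (n - 1)) * (Delta_t t n * (\<Sum>i=1..n. Y_op q (q * t) n i h))"
proof -
  interpret qt: macdonald q "q * t" n by unfold_locales simp_all
  obtain N where N: "n = Suc N" using n by (cases n) auto
  define D where "D = K (Delta_t t n)"
  have D0: "D \<noteq> 0" using Delta_t_neq_0 by (simp add: D_def)
  define s where "s = Kconst (inverse t)"
  \<comment> \<open>What remains to the right of the words in T once \<Delta> has been moved to the
    left of them, which turns their parameter into 1/t.\<close>
  define w where "w = K (om (Delta_t t n * h)) / D"
  define g where "g = K (om h)"
  let ?m1 = "(- 1) ^ N :: 'a mpol fract"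
  have Y: "K (Y i (Delta_t t n * h)) = ?m1 * D * word_op (TK (inverse t)) [i..<n] w" if i: "i \<in> {1..n}" for i
  proof -
    have TD: "T j (Delta_t t n * h) = const (- 1) * (Delta_t t n * h)" if "j \<in> {1..<n}" for j
      by (simp add: T_op_Delta_t[OF that t_nz h[OF that]] const_uminus)
    have "Y i (Delta_t t n * h) = const (inverse t ^ (n - i) * inverse (- 1) ^ (i - 1)) * word_op T [i..<n] (om (Delta_t t n * h))"
      by (rule Y_eigen[OF TD _ i]) simp_all
    then have 1: "K (Y i (Delta_t t n * h)) = Kconst (inverse t ^ (n - i) * inverse (- 1) ^ (i - 1)) * word_op (TK t) [i..<n] (D * w)"
      using D0 by (simp add: K_word_op_T w_def)
    have 2: "set v \<subseteq> {1..<n} \<Longrightarrow> word_op (TK t) v (D * w) = Kconst ((- t) ^ length v) * (D * word_op (TK (inverse t)) v w)" for v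
    proof (induction v)
      case (Cons j v)
      have "TK t j (Kconst c * (D * f)) = Kconst (- t * c) * (D * TK (inverse t) j f)" for c f
      proof -
        have "TK t j (Kconst c * (D * f)) = Kconst c * TK t j (D * f)"
          by (rule TK_mult_sym) simp
        also have "TK t j (D * f) = - Kconst t * (D * TK (inverse t) j f)"
          unfolding D_def by (rule TK_Delta_t) (use Cons.prems in simp_all)
        finally show ?thesis by (simp add: const_mult const_uminus)
      qed
      then show ?case using Cons by (simp add: word_op_Cons)
    qed simp
    \<comment> \<open>The inverse T's contribute (-1)^(i-1) and the conjugation contributes
      (-t)^(n-i). The powers of t cancel against the prefactor of Y_i, and the remaining sign does
      not depend on i.\<close>
    have 3: "inverse t ^ (n - i) * inverse (- 1) ^ (i - 1) * (- t) ^ (n - i) = (- 1) ^ N"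
    proof -
      have m: "inverse (- 1 :: 'a) = - 1" by simp
      have "inverse t ^ (n - i) * inverse (- 1) ^ (i - 1) * (- t) ^ (n - i)
          = (inverse t * - t) ^ (n - i) * (- 1) ^ (i - 1)"
        by (simp only: power_mult_distrib m mult_ac)
      also have "inverse t * - t = - 1" by simp
      also have "(- 1) ^ (n - i) * (- 1) ^ (i - 1) = (- 1 :: 'a) ^ (n - i + (i - 1))"
        by (simp only: power_add)
      also have "n - i + (i - 1) = N" using i N by auto
      finally show ?thesis .
    qed
    have "K (Y i (Delta_t t n * h)) = Kconst (inverse t ^ (n - i) * inverse (- 1) ^ (i - 1) * (- t) ^ (n - i)) * (D * word_op (TK (inverse t)) [i..<n] w)"
      unfolding 1 using i by (subst 2) (auto simp: const_mult mult.assoc)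
    then show ?thesis unfolding 3 by (simp add: const_power const_uminus to_fract_power mult.assoc)
  qed
  have wg: "w = g * (\<Prod>j=1..N. (Kconst q * Kvar n - s * Kvar j) / (Kvar j - s * Kvar n))"
  proof -
    define A B where "A = (\<Prod>j=1..N. Kconst q * Kvar n - s * Kvar j)" and "B = (\<Prod>j=1..N. Kvar j - s * Kvar n)"
    have Kp: "K (prod F S) = (\<Prod>x\<in>S. K (F x))" for F :: "nat \<Rightarrow> 'a mpol" and S
      by (induction S rule: infinite_finite_induct) simp_all
    have "K (om (Delta_t t n) * (\<Prod>j=1..N. var j - const (inverse t) * var n))
       = K (Delta_t t n * (\<Prod>j=1..N. const q * var n - const (inverse t) * var j))"
      by (simp only: om_Delta_t[OF N])
    then have e: "K (om (Delta_t t n)) * B = D * A" by (simp add: Kp A_def B_def s_def D_def)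
    have "B \<noteq> 0"
    proof
      assume "B = 0"
      then obtain j where "j \<in> {1..N}" "K (var j - const (inverse t) * var n) = 0"
        unfolding B_def s_def by auto
      then show False using var_const_diff_neq_0[of j n "inverse t"] N by (simp only: to_fract_eq_0_iff) auto
    qed
    then have "K (om (Delta_t t n)) / D = A / B" using e D0 by (simp add: frac_eq_eq mult_ac)
    moreover have "w = g * (K (om (Delta_t t n)) / D)" by (simp add: w_def g_def om_hom)
    ultimately have "w = g * (A / B)" by (simp only:)
    then show ?thesis by (simp add: A_def B_def prod_dividef)
  qed
  have gs: "sK j g = g" if j: "1 \<le> j" "Suc j < n" for j
    using om_swap[OF j, of h] h[of "Suc j"] j by (simp add: g_def sK_K)
  have tr: "transpose j (Suc j) ` {1..N} = {1..N}" if "1 \<le> j" "Suc j < n" for j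
    using permutes_image[of "transpose j (Suc j)" "{1..N}"] that N by (auto intro: permutes_swap_id)
  have ws: "sK j w = w" if j: "1 \<le> j" "Suc j < n" for j
  proof -
    have "sK j (\<Prod>l=1..N. (Kconst q * Kvar n - s * Kvar l) / (Kvar l - s * Kvar n))
       = (\<Prod>l=1..N. (Kconst q * Kvar n - s * Kvar (transpose j (Suc j) l)) / (Kvar (transpose j (Suc j) l) - s * Kvar n))"
      using j by (simp add: sK_prod sK_hom s_def transpose_def)
    also have "\<dots> = (\<Prod>l\<in>transpose j (Suc j) ` {1..N}. (Kconst q * Kvar n - s * Kvar l) / (Kvar l - s * Kvar n))"
      by (subst prod.reindex) (simp_all add: comp_def inj_on_subset[OF inj_transpose])
    finally show ?thesis unfolding wg sK_hom(2) gs[OF j] tr[OF j] by simp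
  qed
  have wk: "word_op sK [k..<n] w = word_op sK [k..<n] g *
      (\<Prod>j\<in>{1..n} - {k}. (Kconst q * Kvar k - s * Kvar j) / (Kvar j - s * Kvar k))" if k: "k \<in> {1..n}" for k
  proof -
    let ?p = "word_perm [k..<n]"
    have pn: "?p n = k" using k by (simp add: word_perm_upt)
    have p: "?p permutes {1..n}" by (rule word_perm_permutes) (use k in auto)
    have "{1..N} = {1..n} - {n}" using N by auto
    then have im: "?p ` {1..N} = {1..n} - {k}"
      using permutes_image[OF p] permutes_inj[OF p] pn image_set_diff[OF permutes_inj[OF p], of "{1..n}" "{n}"] by simp
    have "word_op sK [k..<n] (\<Prod>j=1..N. (Kconst q * Kvar n - s * Kvar j) / (Kvar j - s * Kvar n))
       = (\<Prod>j=1..N. (Kconst q * Kvar k - s * Kvar (?p j)) / (Kvar (?p j) - s * Kvar k))"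
      by (simp add: word_op_sK_prod word_op_sK_hom word_op_sK_Kvar word_op_sK_Kconst s_def pn)
    also have "\<dots> = (\<Prod>j\<in>?p ` {1..N}. (Kconst q * Kvar k - s * Kvar j) / (Kvar j - s * Kvar k))"
      by (subst prod.reindex) (simp_all add: comp_def inj_on_subset[OF permutes_inj[OF p]])
    finally show ?thesis unfolding wg word_op_sK_hom(2) im by simp
  qed
  have pc: "pcoef (inverse t) n 1 k * word_op sK [k..<n] w
      = ?m1 * s ^ N * (pcoef (q * t) n 1 k * word_op sK [k..<n] g)" if k: "k \<in> {1..n}" for k
  proof -
    have st: "Kconst t * s = 1" unfolding s_def to_fract_mult[symmetric] const_mult[symmetric] by simp
    \<comment> \<open>The denominator z_j - z_k/t cancels the numerator of \<open>acoef\<close> at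
      1/t up to sign, and q z_k - z_j/t is 1/t times q t z_k - z_j, the numerator of
      \<open>acoef\<close> at q t.\<close>
    have "acoef (inverse t) k j * ((Kconst q * Kvar k - s * Kvar j) / (Kvar j - s * Kvar k)) = - s * acoef (q * t) k j"
      if j: "j \<in> {1..n} - {k}" for j
    proof -
      have "K (var j - const (inverse t) * var k) \<noteq> 0"
        using var_const_diff_neq_0[of j k "inverse t"] j by (simp only: to_fract_eq_0_iff) auto
      then have ne: "Kvar j - s * Kvar k \<noteq> 0" by (simp add: s_def)
      have "s * (Kconst q * Kconst t * Kvar k - Kvar j) = Kconst q * (Kconst t * s) * Kvar k - s * Kvar j"
        by (simp add: algebra_simps)
      then have 1: "Kconst q * Kvar k - s * Kvar j = s * (Kconst (q * t) * Kvar k - Kvar j)"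
        by (simp add: st const_mult)
      have "acoef (inverse t) k j = - ((Kvar j - s * Kvar k) / (Kvar k - Kvar j))"
        by (simp add: acoef_def s_def minus_divide_left)
      then show ?thesis unfolding 1 acoef_def[of "q * t"] using ne by simp
    qed
    then have "pcoef (inverse t) n 1 k * (\<Prod>j\<in>{1..n} - {k}. (Kconst q * Kvar k - s * Kvar j) / (Kvar j - s * Kvar k))
        = (\<Prod>j\<in>{1..n} - {k}. - s * acoef (q * t) k j)"
      unfolding pcoef_def prod.distrib[symmetric] by (intro prod.cong HOL.refl)
    also have "\<dots> = (- s) ^ N * pcoef (q * t) n 1 k"
    proof -
      have "card ({1..n} - {k}) = N" using k N by simp
      then show ?thesis unfolding prod.distrib pcoef_def prod_constant by (simp only:)
    qed
    also have "(- s) ^ N = ?m1 * s ^ N" by (rule power_minus)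
    finally have e: "pcoef (inverse t) n 1 k * (\<Prod>j\<in>{1..n} - {k}. (Kconst q * Kvar k - s * Kvar j) / (Kvar j - s * Kvar k))
        = ?m1 * s ^ N * pcoef (q * t) n 1 k" .
    show ?thesis
      unfolding wk[OF k] mult.left_commute[of _ "word_op sK [k..<n] g"] e by (simp only: mult_ac)
  qed
  have Ks: "K (sum F S) = (\<Sum>x\<in>S. K (F x))" for F :: "nat \<Rightarrow> 'a mpol" and S
    by (induction S rule: infinite_finite_induct) simp_all
  define Z where "Z = (\<Sum>k=1..n. pcoef (q * t) n 1 k * word_op sK [k..<n] g)"
  have "K (\<Sum>i=1..n. Y i (Delta_t t n * h)) = (\<Sum>i=1..n. ?m1 * D * word_op (TK (inverse t)) [i..<n] w)"
    unfolding Ks by (rule sum.cong[OF HOL.refl]) (rule Y)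
  also have "\<dots> = ?m1 * D * (\<Sum>i=1..n. word_op (TK (inverse t)) [i..<n] w)"
    by (simp only: sum_distrib_left)
  also have "(\<Sum>i=1..n. word_op (TK (inverse t)) [i..<n] w) = (\<Sum>k=1..n. pcoef (inverse t) n 1 k * word_op sK [k..<n] w)"
    by (rule sum_word_op_TK[OF ws]) simp_all
  also have "\<dots> = ?m1 * s ^ N * Z"
    unfolding Z_def sum_distrib_left by (rule sum.cong[OF HOL.refl]) (rule pc)
  also have "?m1 * D * (?m1 * s ^ N * Z) = (?m1 * ?m1) * (D * (s ^ N * Z))" by (simp only: mult_ac)
  also have "?m1 * ?m1 = 1" by (simp flip: power_mult_distrib)
  finally have L: "K (\<Sum>i=1..n. Y i (Delta_t t n * h)) = D * (s ^ N * Z)" by simp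
  have "K (\<Sum>i=1..n. Y_op q (q * t) n i h) = Kconst (inverse (q * t) ^ N) * Z"
    using qt.sum_Y_sym[OF h] N by (simp add: Z_def g_def)
  then have "K (const (q ^ (n - 1)) * (Delta_t t n * (\<Sum>i=1..n. Y_op q (q * t) n i h)))
      = D * (Kconst (q ^ N * inverse (q * t) ^ N) * Z)"
    using N by (simp add: D_def const_mult mult_ac)
  \<comment> \<open>The powers of 1/t collected in \<open>pc\<close> differ from the normalisation
    (qt)^-N of the operator at q t by q^N; this is the factor q^(n-1) in the statement.\<close>
  also have "q ^ N * inverse (q * t) ^ N = inverse t ^ N"
  proof -
    have "q * inverse (q * t) = inverse t" by simp
    then show ?thesis by (simp only: power_mult_distrib[symmetric])
  qed
  also have "Kconst (inverse t ^ N) = s ^ N" by (simp add: s_def const_power to_fract_power)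
  finally have "K (\<Sum>i=1..n. Y i (Delta_t t n * h))
      = K (const (q ^ (n - 1)) * (Delta_t t n * (\<Sum>i=1..n. Y_op q (q * t) n i h)))"
    by (simp only: L)
  then show ?thesis by (simp only: to_fract_eq_iff)
qed

end

text \<open>Exponents bounded by \<open>\<alpha>\<close> in the sense of partial sums, so that \<open>\<alpha>\<close> is a leading exponent.\<close>

definition prefix_le :: "nat \<Rightarrow> expo \<Rightarrow> expo \<Rightarrow> bool" where
  "prefix_le n \<nu> \<alpha> \<longleftrightarrow> composition n \<nu> \<and> (\<forall>p\<in>{1..n}. (\<Sum>i=1..p. lk \<nu> i) \<le> (\<Sum>i=1..p. lk \<alpha> i))"

lemma prefix_le_add: "prefix_le n \<nu> \<alpha> \<Longrightarrow> prefix_le n \<mu> \<beta> \<Longrightarrow> prefix_le n (\<nu> + \<mu>) (\<alpha> + \<beta>)"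
  by (simp add: prefix_le_def composition_lk lookup_add sum.distrib add_mono)

lemma prefix_le_add_eq:
  assumes "prefix_le n \<nu> \<alpha>" "prefix_le n \<mu> \<beta>" "\<nu> + \<mu> = \<alpha> + \<beta>" "composition n \<alpha>" "composition n \<beta>"
  shows "\<nu> = \<alpha> \<and> \<mu> = \<beta>"
proof -
  have e: "(\<Sum>i=1..p. lk \<nu> i) + (\<Sum>i=1..p. lk \<mu> i) = (\<Sum>i=1..p. lk \<alpha> i) + (\<Sum>i=1..p. lk \<beta> i)" for p
    unfolding sum.distrib[symmetric] lookup_add[symmetric] assms(3) ..
  have "(\<Sum>i=1..p. lk \<nu> i) = (\<Sum>i=1..p. lk \<alpha> i) \<and> (\<Sum>i=1..p. lk \<mu> i) = (\<Sum>i=1..p. lk \<beta> i)"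
    if p: "p \<in> {1..n}" for p
  proof -
    have "(\<Sum>i=1..p. lk \<nu> i) \<le> (\<Sum>i=1..p. lk \<alpha> i)" "(\<Sum>i=1..p. lk \<mu> i) \<le> (\<Sum>i=1..p. lk \<beta> i)"
      using assms(1,2) p unfolding prefix_le_def by blast+
    then show ?thesis using e[of p] by linarith
  qed
  then show ?thesis
    using assms prefix_sums_eqI[of n \<nu> \<alpha>] prefix_sums_eqI[of n \<mu> \<beta>] by (simp add: prefix_le_def)
qed

definition leading :: "nat \<Rightarrow> 'a::field mpol \<Rightarrow> expo \<Rightarrow> bool" where
  "leading n f \<alpha> \<longleftrightarrow> composition n \<alpha> \<and> (\<forall>\<nu>\<in>supp f. prefix_le n \<nu> \<alpha>) \<and> coef f \<alpha> = 1"

text \<open>If bounded partial sums add up to those of \<alpha> + \<beta>, every bound is attained.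
  So only the two leading terms meet at \<alpha> + \<beta>, and no cancellation occurs
  there.\<close>

lemma leading_mult:
  assumes f: "leading n f \<alpha>" and g: "leading n g \<beta>"
  shows "leading n (f * g) (\<alpha> + \<beta>)"
proof -
  have c: "composition n \<alpha>" "composition n \<beta>" using f g by (auto simp: leading_def)
  have "prefix_le n \<nu> (\<alpha> + \<beta>)" if "\<nu> \<in> supp (f * g)" for \<nu>
  proof -
    obtain a b where "\<nu> = a + b" "a \<in> supp f" "b \<in> supp g" using \<open>\<nu> \<in> supp (f * g)\<close> keys_mult[of f g] by blast
    then show ?thesis using f g prefix_le_add by (simp add: leading_def)
  qed
  moreover have "coef (f * g) (\<alpha> + \<beta>) = 1"
  proof -
    have "f * g = (\<Sum>\<nu>\<in>supp f. Poly_Mapping.single \<nu> (coef f \<nu>)) * (\<Sum>\<mu>\<in>supp g. Poly_Mapping.single \<mu> (coef g \<mu>))"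
      using sum_single_expand[of "supp f" f] sum_single_expand[of "supp g" g] by simp
    then have "coef (f * g) (\<alpha> + \<beta>) = (\<Sum>\<nu>\<in>supp f. \<Sum>\<mu>\<in>supp g. coef (Poly_Mapping.single (\<nu> + \<mu>) (coef f \<nu> * coef g \<mu>)) (\<alpha> + \<beta>))"
      by (simp only: sum_product mult_single lookup_sum)
    also have "\<dots> = (\<Sum>\<nu>\<in>supp f. \<Sum>\<mu>\<in>supp g. if \<mu> = \<beta> then (if \<nu> = \<alpha> then 1 else 0) else 0)"
    proof (intro sum.cong HOL.refl)
      fix \<nu> \<mu> assume "\<nu> \<in> supp f" "\<mu> \<in> supp g"
      then have "\<nu> + \<mu> = \<alpha> + \<beta> \<longleftrightarrow> \<nu> = \<alpha> \<and> \<mu> = \<beta>"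
        using f g c prefix_le_add_eq[of n \<nu> \<alpha> \<mu> \<beta>] by (auto simp: leading_def)
      then show "coef (Poly_Mapping.single (\<nu> + \<mu>) (coef f \<nu> * coef g \<mu>)) (\<alpha> + \<beta>)
          = (if \<mu> = \<beta> then (if \<nu> = \<alpha> then 1 else 0) else 0)"
        using f g by (auto simp: lookup_single when_def leading_def)
    qed
    also have "\<dots> = 1"
    proof -
      have "\<alpha> \<in> supp f" "\<beta> \<in> supp g" using f g by (simp_all add: leading_def in_keys_iff)
      then show ?thesis by (simp only: sum.delta finite_keys if_True)
    qed
    finally show ?thesis .
  qed
  moreover have "composition n (\<alpha> + \<beta>)" using c by (simp add: composition_lk lookup_add)
  ultimately show ?thesis by (simp add: leading_def)
qed

lemma leading_1: "leading n 1 0"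
  by (auto simp: leading_def prefix_le_def composition_lk)

lemma leading_prod:
  assumes "\<And>x. x \<in> A \<Longrightarrow> leading n (F x) (\<alpha> x)"
  shows "leading n (prod F A) (sum \<alpha> A)"
  using assms by (induction A rule: infinite_finite_induct) (simp_all add: leading_1 leading_mult)

text \<open>Moving a unit from place i to the later place j can only lower partial sums, so z_i
  leads.\<close>

lemma leading_factor:
  fixes c :: "'a::field"
  assumes "1 \<le> i" "i < j" "j \<le> n"
  shows "leading n (var i - const c * var j) (Poly_Mapping.single i 1)"
proof -
  have cs: "composition n (Poly_Mapping.single k (1::nat))" if "1 \<le> k" "k \<le> n" for k
    using that by (auto simp: composition_def)
  have s: "(\<Sum>l=1..p. lk (Poly_Mapping.single k 1) l) = (if k \<in> {1..p} then 1 else 0)" for k p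
    by (simp add: lookup_single when_def)
  have "prefix_le n \<nu> (Poly_Mapping.single i 1)" if "\<nu> \<in> supp (var i - const c * var j)" for \<nu>
  proof -
    have "\<nu> \<in> supp (var i :: 'a mpol) \<or> \<nu> \<in> supp (const c * var j)"
      using \<open>\<nu> \<in> supp (var i - const c * var j)\<close> by (auto simp: in_keys_iff lookup_minus)
    then have "\<nu> = Poly_Mapping.single i 1 \<or> \<nu> = Poly_Mapping.single j 1"
      using supp_const_mult[of c "var j"] by (auto simp: var_def split: if_splits)
    then show ?thesis
    proof
      assume "\<nu> = Poly_Mapping.single i 1"
      then show ?thesis unfolding prefix_le_def using cs[of i] assms by simp
    next
      assume "\<nu> = Poly_Mapping.single j 1"
      moreover have "composition n (Poly_Mapping.single j (1::nat))" using cs[of j] assms by simp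
      moreover have "(if j \<in> {1..p} then 1 else 0 :: nat) \<le> (if i \<in> {1..p} then 1 else 0)" for p
        using assms by auto
      ultimately show ?thesis unfolding prefix_le_def by (simp only: s) blast
    qed
  qed
  moreover have "Poly_Mapping.single j (1::nat) \<noteq> Poly_Mapping.single i 1"
  proof
    assume e: "Poly_Mapping.single j (1::nat) = Poly_Mapping.single i 1"
    have "lk (Poly_Mapping.single j 1) j = 1" by (rule lookup_single_eq)
    then show False unfolding e using assms by (simp add: lookup_single_not_eq)
  qed
  ultimately show ?thesis
    using cs[of i] assms by (simp add: leading_def lookup_minus var_def lookup_single when_def)
qed

lemma leading_Delta_t: "leading n (Delta_t t n) (delta n)"
proof -
  have "leading n (\<Prod>j\<in>{i<..n}. var i - const (inverse t) * var j) (Poly_Mapping.single i (n - i))" if "i \<in> {1..n}" for i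
  proof -
    have "leading n (\<Prod>j\<in>{i<..n}. var i - const (inverse t) * var j) (\<Sum>j\<in>{i<..n}. Poly_Mapping.single i 1)"
      by (rule leading_prod, rule leading_factor) (use that in auto)
    moreover have "(\<Sum>j\<in>{i<..n}. Poly_Mapping.single i 1) = Poly_Mapping.single i (n - i)"
      by (rule poly_mapping_eqI) (simp only: lookup_sum lookup_single when_def, simp)
    ultimately show ?thesis by simp
  qed
  then show ?thesis unfolding Delta_t_def delta_def by (rule leading_prod)
qed

section \<open>Eigenvalues after adding the staircase\<close>

lemma lk_delta: "lk (delta n) k = (if k \<in> {1..n} then n - k else 0)"
  by (simp add: delta_def lookup_sum lookup_single when_def)

lemma is_partition_add_delta:
  assumes "is_partition n \<kappa>"
  shows "is_partition n (\<kappa> + delta n)"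
  unfolding is_partition_def
proof (intro conjI allI impI)
  show "composition n (\<kappa> + delta n)"
    using assms by (simp add: is_partition_def composition_lk lookup_add lk_delta)
  fix i j assume ij: "1 \<le> i \<and> i \<le> j \<and> j \<le> n"
  then have "lk \<kappa> j \<le> lk \<kappa> i" using assms by (simp add: is_partition_def)
  moreover have "lk (delta n) j \<le> lk (delta n) i" using ij by (simp add: lk_delta diff_le_mono2)
  ultimately show "lk (\<kappa> + delta n) j \<le> lk (\<kappa> + delta n) i"
    unfolding lookup_add by (rule add_mono)
qed

lemma leg_colength_partition:
  assumes "is_partition n \<kappa>" "i \<in> {1..n}"
  shows "leg_colength n \<kappa> i = i - 1"
proof -
  have mono: "lk \<kappa> k \<le> lk \<kappa> j" if "1 \<le> j" "j \<le> k" "k \<le> n" for j k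
    using assms(1) that unfolding is_partition_def by blast
  have "{j\<in>{1..n}. j < i \<and> lk \<kappa> j \<ge> lk \<kappa> i} = {1..<i}"
    using mono[of _ i] assms(2) by auto
  moreover have "{j\<in>{1..n}. j > i \<and> lk \<kappa> j > lk \<kappa> i} = {}"
    using mono[of i] assms(2) by (auto simp: not_less[symmetric])
  ultimately show ?thesis by (simp only: leg_colength_def card.empty card_atLeastLessThan)
qed

text \<open>The equality is termwise. Both partitions have leg colength i - 1 at i, and the
  staircase entry n - i gives q^(n-i) t^-(i-1) = q^(n-1) (qt)^-(i-1).\<close>

lemma sum_eigval_add_delta:
  assumes \<kappa>: "is_partition n \<kappa>" and "q \<noteq> 0"
  shows "(\<Sum>i=1..n. eigval q t n (\<kappa> + delta n) i) = q ^ (n - 1) * (\<Sum>i=1..n. eigval q (q * t) n \<kappa> i)"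
  unfolding sum_distrib_left
proof (rule sum.cong[OF HOL.refl])
  fix i assume i: "i \<in> {1..n}"
  have "q ^ (n - 1) = q ^ (n - i) * q ^ (i - 1)" using i by (simp flip: power_add)
  moreover have "q ^ (i - 1) * inverse (q * t) ^ (i - 1) = inverse t ^ (i - 1)"
  proof -
    have "q * inverse (q * t) = inverse t" using assms(2) by simp
    then show ?thesis by (simp only: power_mult_distrib[symmetric])
  qed
  moreover have "q ^ (n - i) * q ^ (i - 1) * (q ^ lk \<kappa> i * inverse (q * t) ^ (i - 1))
      = q ^ lk \<kappa> i * q ^ (n - i) * (q ^ (i - 1) * inverse (q * t) ^ (i - 1))"
    by (simp only: mult_ac)
  ultimately have "q ^ (n - 1) * (q ^ lk \<kappa> i * inverse (q * t) ^ (i - 1)) = q ^ (lk \<kappa> i + (n - i)) * inverse t ^ (i - 1)"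
    by (simp only: power_add)
  then show "eigval q t n (\<kappa> + delta n) i = q ^ (n - 1) * eigval q (q * t) n \<kappa> i"
    unfolding eigval_def leg_colength_partition[OF \<kappa> i] leg_colength_partition[OF is_partition_add_delta[OF \<kappa>] i]
    using i by (simp only: lookup_add lk_delta if_True)
qed

lemma macdonald_generic_mult:
  assumes "macdonald_generic q t"
  shows "macdonald_generic q (q * t)"
proof -
  interpret macdonald_generic q t by fact
  show ?thesis
  proof
    fix S :: "(nat \<times> nat) set" and c :: "nat \<times> nat \<Rightarrow> int" and x
    assume S: "finite S" "(\<Sum>(a, b)\<in>S. of_int (c (a, b)) * q ^ a * (q * t) ^ b) = 0" "x \<in> S"
    \<comment> \<open>The exponents of q^a (qt)^b rewritten in q and t. The map is injective, and
      the truncated subtraction in \<open>?\<psi>\<close> is exact on its image.\<close>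
    let ?\<phi> = "\<lambda>x :: nat \<times> nat. (fst x + snd x, snd x)" and ?\<psi> = "\<lambda>y :: nat \<times> nat. (fst y - snd y, snd y)"
    have "(\<Sum>(a, b)\<in>?\<phi> ` S. of_int (c (?\<psi> (a, b))) * q ^ a * t ^ b) = (\<Sum>(a, b)\<in>S. of_int (c (a, b)) * q ^ a * (q * t) ^ b)"
      by (subst sum.reindex) (auto simp: inj_on_def case_prod_unfold power_add power_mult_distrib mult_ac intro!: sum.cong)
    then have "c (?\<psi> (?\<phi> x)) = 0"
      using S by (intro generic[of "?\<phi> ` S" "\<lambda>y. c (?\<psi> y)" "?\<phi> x"]) simp_all
    then show "c x = 0" by simp
  qed simp_all
qed

text \<open>The elements q^a t^b already lie in the polynomial ring, where they are distinct
  monomials, so the relation is tested coefficient by coefficient.\<close>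

lemma macdonald_generic_ind: "macdonald_generic q_ind t_ind"
proof
  have q: "q_ind = to_fract [:[:0, 1:]:]" and t: "t_ind = to_fract [:0, 1:]"
    by (simp_all add: q_ind_def t_ind_def to_fract_def)
  show "q_ind \<noteq> 0" "t_ind \<noteq> 0" by (simp_all add: q t)
  fix S :: "(nat \<times> nat) set" and c :: "nat \<times> nat \<Rightarrow> int" and x
  assume S: "finite S" "(\<Sum>(a, b)\<in>S. of_int (c (a, b)) * q_ind ^ a * t_ind ^ b) = 0" "x \<in> S"
  have of_int: "of_int k = (to_fract [:[:of_int k:]:] :: ratfun_qt)" for k
  proof -
    have "of_int k = (to_fract (of_int k) :: ratfun_qt)"
      by (cases k rule: int_cases2) (simp_all add: to_fract_def of_nat_fract)
    then show ?thesis by (simp only: of_int_poly)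
  qed
  have qp: "[:[:0, 1:]:] ^ a = [:monom (1::rat) a:]" for a
    by (induction a) (simp_all add: monom_Suc one_pCons)
  have tp: "[:0, 1:] ^ b = monom (1::rat poly) b" for b
    by (induction b) (simp_all add: monom_Suc)
  have trm: "of_int k * q_ind ^ a * t_ind ^ b = to_fract (monom (monom (of_int k) a) b)" for k a b
    unfolding of_int q t to_fract_power[symmetric] to_fract_mult[symmetric] qp tp
    by (simp add: smult_monom)
  have Ks: "to_fract (sum F S) = (\<Sum>x\<in>S. to_fract (F x))" for F :: "nat \<times> nat \<Rightarrow> rat poly poly"
    by (induction S rule: infinite_finite_induct) simp_all
  have "to_fract (\<Sum>y\<in>S. monom (monom (of_int (c y)) (fst y)) (snd y)) = (0 :: ratfun_qt)"
    using S(2) unfolding trm Ks by (simp add: case_prod_unfold)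
  then have z: "(\<Sum>y\<in>S. monom (monom (of_int (c y)) (fst y)) (snd y)) = (0 :: rat poly poly)"
    by (simp only: to_fract_eq_0_iff)
  have "0 = coeff (coeff (\<Sum>y\<in>S. monom (monom (of_int (c y) :: rat) (fst y)) (snd y)) (snd x)) (fst x)"
    unfolding z by simp
  also have "\<dots> = (\<Sum>y\<in>S. if y = x then (of_int (c x) :: rat) else 0)"
    unfolding coeff_sum by (rule sum.cong) (auto simp: coeff_monom prod_eq_iff)
  also have "\<dots> = of_int (c x)" using S(1,3) by simp
  finally show "c x = 0" by simp
qed

section \<open>Leading exponent of P and conclusion\<close>

lemma leading_macdonald_P:
  assumes "macdonald_generic q t" "is_partition n \<kappa>"
  shows "leading n (macdonald_P q t n \<kappa>) \<kappa>"
proof -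
  interpret macdonald_generic q t n by (rule assms(1))
  have \<kappa>: "composition n \<kappa>" using assms(2) by (simp add: is_partition_def)
  show ?thesis
    unfolding leading_def
  proof (intro conjI ballI \<kappa>)
    show "coef (macdonald_P q t n \<kappa>) \<kappa> = 1" by (rule macdonald_P[OF \<kappa>, THEN conjunct1])
    fix \<nu> assume "\<nu> \<in> supp (macdonald_P q t n \<kappa>)"
    then have "\<nu> \<in> weak_low_set n \<kappa>" by (rule subsetD[OF macdonald_P_supp[OF \<kappa>]])
    then have c: "composition n \<nu>" and "lower n \<nu> \<kappa> \<or> is_permutation_of n \<nu> \<kappa>"
      unfolding weak_low_set_def by blast+
    then have d: "subset_dom n \<nu> \<kappa>"
      unfolding lower_def using subset_dom_perm[of n \<nu> \<kappa>] by blast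
    show "prefix_le n \<nu> \<kappa>"
      unfolding prefix_le_def
    proof (intro conjI ballI c)
      fix p assume "p \<in> {1..n}"
      then have "p \<le> n" by simp
      then show "(\<Sum>i=1..p. lk \<nu> i) \<le> (\<Sum>i=1..p. lk \<kappa> i)" by (rule subset_dom_prefix[OF d assms(2)])
    qed
  qed
qed

lemma macdonald_S_Delta_t:
  assumes gen: "macdonald_generic q t" and n: "1 \<le> n" and \<kappa>: "is_partition n \<kappa>"
  shows "macdonald_S q t n (\<kappa> + delta n) = Delta_t t n * macdonald_P q (q * t) n \<kappa>"
proof -
  interpret macdonald_generic q t n by (rule gen)
  define P where "P = macdonald_P q (q * t) n \<kappa>"
  note gen' = macdonald_generic_mult[OF gen]
  have c: "composition n \<kappa>" using \<kappa> by (simp add: is_partition_def)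
  have P_swap: "swap_op i P = P" if "i \<in> {1..<n}" for i
    unfolding P_def by (rule macdonald_generic.macdonald_P_swap[OF gen' c that])
  have P_sum_Y: "(\<Sum>i=1..n. Y_op q (q * t) n i P) = const (\<Sum>i=1..n. eigval q (q * t) n \<kappa> i) * P"
    unfolding P_def by (rule macdonald_generic.macdonald_P_sum_Y[OF gen' c])
  have lead: "leading n (Delta_t t n * P) (\<kappa> + delta n)"
    unfolding add.commute[of \<kappa>] P_def
    by (rule leading_mult[OF leading_Delta_t leading_macdonald_P[OF gen' \<kappa>]])
  have "macdonald_S q t n (\<kappa> + delta n) = Delta_t t n * P"
  proof (rule macdonald_S_eqI)
    show "composition n (\<kappa> + delta n)" "coef (Delta_t t n * P) (\<kappa> + delta n) = 1"
      using lead unfolding leading_def by blast+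
    show "supp (Delta_t t n * P) \<subseteq> Collect (composition n)"
      using lead unfolding leading_def prefix_le_def by blast
    show "T_op t i (Delta_t t n * P) = - (Delta_t t n * P)" if "i \<in> {1..<n}" for i
      by (rule T_op_Delta_t[OF that t_nz P_swap[OF that]])
    have "(\<Sum>i=1..n. Y_op q t n i (Delta_t t n * P))
        = const (q ^ (n - 1)) * (Delta_t t n * (\<Sum>i=1..n. Y_op q (q * t) n i P))"
      by (rule sum_Y_antisym[OF _ n]) (rule P_swap)
    also have "\<dots> = const (q ^ (n - 1)) * (Delta_t t n * (const (\<Sum>i=1..n. eigval q (q * t) n \<kappa> i) * P))"
      unfolding P_sum_Y ..
    also have "\<dots> = const (q ^ (n - 1) * (\<Sum>i=1..n. eigval q (q * t) n \<kappa> i)) * (Delta_t t n * P)"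
      unfolding const_mult mult.left_commute[of "Delta_t t n"] mult.assoc ..
    also have "q ^ (n - 1) * (\<Sum>i=1..n. eigval q (q * t) n \<kappa> i) = (\<Sum>i=1..n. eigval q t n (\<kappa> + delta n) i)"
      by (rule sum_eigval_add_delta[OF \<kappa> q_nz, symmetric])
    finally show "(\<Sum>i=1..n. Y_op q t n i (Delta_t t n * P))
        = const (\<Sum>i=1..n. eigval q t n (\<kappa> + delta n) i) * (Delta_t t n * P)" .
  qed
  then show ?thesis unfolding P_def .
qed

theorem theorem5:
  fixes n :: nat and \<kappa> :: expo
  assumes "n \<ge> 1" and "is_partition n \<kappa>"
  shows "macdonald_S q_ind t_ind n (\<kappa> + delta n) =
         Delta_t t_ind n * macdonald_P q_ind (q_ind * t_ind) n \<kappa>"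
  by (rule macdonald_S_Delta_t[OF macdonald_generic_ind assms])

end
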